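(* Let $f\in L^1(X,\nu)$ and $\lambda>0$. For every $v_0\in L^2(X,\nu)$ there exists a unique strong solution, in $(0,T)$ for any $T>0$, of the Cauchy problem $$\begin{cases} v_t\in\Delta_1^m v(t)-\lambda\,\mathrm{sign}(v(t)-f)&\text{in }(0,T)\times X,\\ v(0,x)=v_0(x)&\text{for }x\in X.\end{cases}$$ Moreover, the following contraction principle holds in any $L^q(X,\nu)$-space, $1\le q\le\infty$: $$\|v(t)-w(t)\|_q\le\|v_0-w_0\|_q\quad\forall\,0<t<T,$$ for any pair of solutions $v,w$ of this problem with initial data $v_0,w_0$ respectively.
   Context: Setting: $(X,d)$ is a Polish metric space with its Borel $\sigma$-algebra. A random walk $m=(m_x)_{x\in X}$ on $X$ is a family of Borel probability measures on $X$ such that $x\mapsto m_x(A)$ is Borel for every Borel $A\subset X$ and $\int_X d(z,y)\,dm_x(y)<\infty$ for all $x\in X$ and some (hence any) $z\in X$; $[X,d,m]$ is a metric random walk space. $\nu$ is a finite (nonzero) Radon measure on $X$ which is reversible for $m$: $dm_x(y)d\nu(x)=dm_y(x)d\nu(y)$ as measures on $X\times X$ (this implies invariance, $\nu(A)=\int_X m_x(A)\,d\nu(x)$). It is also assumed that $\frac1{\nu(X)}\nu$ is ergodic with respect to $m$: every Borel set $B$ with $m_x(B)=1$ for all $x\in B$ satisfies $\nu(B)=0$ or $\nu(B)=\nu(X)$. $m$-total variation: $TV_m(u)=\frac12\int_X\int_X|u(y)-u(x)|\,dm_x(y)\,d\nu(x)$. $\mathcal F_m:L^2(X,\nu)\to\,]-\infty,+\infty]$,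 $\mathcal F_m(u)=TV_m(u)$, is convex and lower semicontinuous; $\partial\mathcal F_m$ is its subdifferential in $L^2(X,\nu)$. $\Delta_1^m$ is the multivalued operator in $L^2(X,\nu)$ with $v\in\Delta_1^m(u)$ iff $-v\in\partial\mathcal F_m(u)$. $\xi\in\mathrm{sign}(u)$ means $\xi$ is $\nu$-measurable and, $\nu$-a.e., $\xi=1$ where $u>0$, $\xi=-1$ where $u<0$, $\xi\in[-1,1]$ where $u=0$. A (strong) solution of the Cauchy problem in $(0,T)$ is a function $v\in C([0,T];L^2(X,\nu))\cap W^{1,1}_{loc}(0,T;L^2(X,\nu))$ such that $v(0,x)=v_0(x)$ for $\nu$-a.e. $x\in X$ and, for almost all $t\in(0,T)$, there exists $\xi(t)\in\mathrm{sign}(v(t)-f)$ satisfying $\lambda\xi(t)+v_t(t)\in\Delta_1^m(v(t))$. $\|\cdot\|_q$ is the norm of $L^q(X,\nu)$ (possibly $+\infty$). *)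

theory Defs
  imports "HOL-Probability.Probability"
begin

section \<open>Metric random walk spaces\<close>

definition random_walk :: "('a::polish_space \<Rightarrow> 'a measure) \<Rightarrow> bool" where
  "random_walk m \<longleftrightarrow>
     (\<forall>x. prob_space (m x) \<and> sets (m x) = sets borel) \<and>
     (\<forall>A\<in>sets borel. (\<lambda>x. measure (m x) A) \<in> borel_measurable borel) \<and>
     (\<exists>z. \<forall>x. (\<integral>\<^sup>+ y. ennreal (dist z y) \<partial>m x) < \<infinity>)"

definition radon_measure :: "'a::polish_space measure \<Rightarrow> bool" where
  "radon_measure \<nu> \<longleftrightarrow>
     sets \<nu> = sets borel \<and>
     (\<forall>x. \<exists>U. open U \<and> x \<in> U \<and> emeasure \<nu> U < \<infinity>) \<and>
     (\<forall>A\<in>sets borel. emeasure \<nu> A = (SUP K\<in>{K. compact K \<and> K \<subseteq> A}. emeasure \<nu> K))"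

text \<open>
  The two sides are the values on \<open>C\<close> of the measures \<open>dm\<^sub>x(y) d\<nu>(x)\<close> and
  \<open>dm\<^sub>y(x) d\<nu>(y)\<close> on the product space.
\<close>

definition reversible :: "('a::polish_space \<Rightarrow> 'a measure) \<Rightarrow> 'a measure \<Rightarrow> bool" where
  "reversible m \<nu> \<longleftrightarrow>
     (\<forall>C\<in>sets (borel :: ('a \<times> 'a) measure).
        (\<integral>\<^sup>+ x. emeasure (m x) {y. (x, y) \<in> C} \<partial>\<nu>) =
        (\<integral>\<^sup>+ y. emeasure (m y) {x. (x, y) \<in> C} \<partial>\<nu>))"

definition ergodic :: "('a::polish_space \<Rightarrow> 'a measure) \<Rightarrow> 'a measure \<Rightarrow> bool" where
  "ergodic m \<nu> \<longleftrightarrow>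
     (\<forall>B\<in>sets borel. (\<forall>x\<in>B. emeasure (m x) B = 1) \<longrightarrow>
        emeasure \<nu> B = 0 \<or> emeasure \<nu> B = emeasure \<nu> UNIV)"


section \<open>Lebesgue spaces\<close>

text \<open>
  Elements of the Lebesgue spaces are handled through Borel measurable representatives, and equality in
  them is equality almost everywhere.
\<close>

definition L2_space :: "'a measure \<Rightarrow> ('a \<Rightarrow> real) set" where
  "L2_space \<nu> = {u \<in> borel_measurable \<nu>. integrable \<nu> (\<lambda>x. (u x)\<^sup>2)}"

definition L2_inner :: "'a measure \<Rightarrow> ('a \<Rightarrow> real) \<Rightarrow> ('a \<Rightarrow> real) \<Rightarrow> real" where
  "L2_inner \<nu> u w = (\<integral>x. u x * w x \<partial>\<nu>)"

definition L2_norm :: "'a measure \<Rightarrow> ('a \<Rightarrow> real) \<Rightarrow> real" where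
  "L2_norm \<nu> u = sqrt (L2_inner \<nu> u u)"

text \<open>The norm of \<open>L\<^sup>q\<close> for an extended exponent; its value may be infinite.\<close>

definition Lq_norm :: "'a measure \<Rightarrow> ennreal \<Rightarrow> ('a \<Rightarrow> real) \<Rightarrow> ennreal" where
  "Lq_norm \<nu> q u =
     (if q = \<infinity> then esssup \<nu> (\<lambda>x. ennreal \<bar>u x\<bar>)
      else let I = (\<integral>\<^sup>+ x. ennreal (\<bar>u x\<bar> powr enn2real q) \<partial>\<nu>)
           in if I = \<infinity> then \<infinity> else ennreal (enn2real I powr (1 / enn2real q)))"


section \<open>The total variation functional and the 1-Laplacian\<close>

definition TV :: "('a \<Rightarrow> 'a measure) \<Rightarrow> 'a measure \<Rightarrow> ('a \<Rightarrow> real) \<Rightarrow> ennreal" where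
  "TV m \<nu> u = ennreal (1/2) * (\<integral>\<^sup>+ x. (\<integral>\<^sup>+ y. ennreal \<bar>u y - u x\<bar> \<partial>m x) \<partial>\<nu>)"

text \<open>
  The subdifferential at \<open>u\<close>, in \<open>L\<^sup>2\<close>, of a functional with values in the extended reals,
  of which only the values on \<open>L\<^sup>2\<close> matter.
\<close>

definition L2_subdifferential ::
    "'a measure \<Rightarrow> (('a \<Rightarrow> real) \<Rightarrow> ereal) \<Rightarrow> ('a \<Rightarrow> real) \<Rightarrow> ('a \<Rightarrow> real) set" where
  "L2_subdifferential \<nu> F u =
     {g \<in> L2_space \<nu>. u \<in> L2_space \<nu> \<and> F u < \<infinity> \<and>
        (\<forall>w\<in>L2_space \<nu>. F u + ereal (L2_inner \<nu> g (\<lambda>x. w x - u x)) \<le> F w)}"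

definition one_Laplacian ::
    "('a \<Rightarrow> 'a measure) \<Rightarrow> 'a measure \<Rightarrow> ('a \<Rightarrow> real) \<Rightarrow> ('a \<Rightarrow> real) set" where
  "one_Laplacian m \<nu> u =
     {g. (\<lambda>x. - g x) \<in> L2_subdifferential \<nu> (\<lambda>w. enn2ereal (TV m \<nu> w)) u}"

definition sign_set :: "'a measure \<Rightarrow> ('a \<Rightarrow> real) \<Rightarrow> ('a \<Rightarrow> real) set" where
  "sign_set \<nu> u =
     {\<xi> \<in> borel_measurable \<nu>. AE x in \<nu>.
        (u x > 0 \<longrightarrow> \<xi> x = 1) \<and> (u x < 0 \<longrightarrow> \<xi> x = -1) \<and> (u x = 0 \<longrightarrow> \<xi> x \<in> {-1..1})}"


section \<open>Bochner integration with values in \<open>L\<^sup>2\<close>\<close>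

text \<open>
  As \<open>L\<^sup>2(\<nu>)\<close> is not a type, the Bochner integral of the library does not apply to functions with
  values in it.  The definitions below follow those of \<open>simple_bochner_integrable\<close>,
  \<open>simple_bochner_integral\<close> and \<open>has_bochner_integral\<close>.
\<close>

definition L2_simple :: "'t measure \<Rightarrow> 'a measure \<Rightarrow> ('t \<Rightarrow> 'a \<Rightarrow> real) \<Rightarrow> bool" where
  "L2_simple M \<nu> s \<longleftrightarrow>
     simple_function M s \<and> (\<forall>t\<in>space M. s t \<in> L2_space \<nu>) \<and>
     emeasure M {t \<in> space M. s t \<noteq> (\<lambda>_. 0)} \<noteq> \<infinity>"

definition L2_simple_integral :: "'t measure \<Rightarrow> ('t \<Rightarrow> 'a \<Rightarrow> real) \<Rightarrow> 'a \<Rightarrow> real" where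
  "L2_simple_integral M s = (\<lambda>x. \<Sum>c\<in>s ` space M. measure M {t \<in> space M. s t = c} * c x)"

definition L2_strongly_measurable ::
    "'t measure \<Rightarrow> 'a measure \<Rightarrow> ('t \<Rightarrow> 'a \<Rightarrow> real) \<Rightarrow> bool" where
  "L2_strongly_measurable M \<nu> g \<longleftrightarrow>
     (\<forall>t\<in>space M. g t \<in> L2_space \<nu>) \<and>
     (\<exists>s. (\<forall>n::nat. L2_simple M \<nu> (s n)) \<and>
          (AE t in M. (\<lambda>n. L2_norm \<nu> (\<lambda>x. g t x - s n t x)) \<longlonglongrightarrow> 0))"

definition has_L2_integral ::
    "'t measure \<Rightarrow> 'a measure \<Rightarrow> ('t \<Rightarrow> 'a \<Rightarrow> real) \<Rightarrow> ('a \<Rightarrow> real) \<Rightarrow> bool" where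
  "has_L2_integral M \<nu> g I \<longleftrightarrow>
     L2_strongly_measurable M \<nu> g \<and> I \<in> L2_space \<nu> \<and>
     (\<exists>s. (\<forall>n::nat. L2_simple M \<nu> (s n)) \<and>
          (\<lambda>n. \<integral>\<^sup>+ t. ennreal (L2_norm \<nu> (\<lambda>x. g t x - s n t x)) \<partial>M) \<longlonglongrightarrow> 0 \<and>
          (\<lambda>n. L2_norm \<nu> (\<lambda>x. L2_simple_integral M (s n) x - I x)) \<longlonglongrightarrow> 0)"


section \<open>Function spaces in time\<close>

definition continuous_L2 :: "'a measure \<Rightarrow> real \<Rightarrow> (real \<Rightarrow> 'a \<Rightarrow> real) \<Rightarrow> bool" where
  "continuous_L2 \<nu> T v \<longleftrightarrow>
     (\<forall>t\<in>{0..T}. v t \<in> L2_space \<nu> \<and>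
        ((\<lambda>s. L2_norm \<nu> (\<lambda>x. v s x - v t x)) \<longlongrightarrow> 0) (at t within {0..T}))"

definition L1_loc_L2 :: "'a measure \<Rightarrow> real \<Rightarrow> (real \<Rightarrow> 'a \<Rightarrow> real) \<Rightarrow> bool" where
  "L1_loc_L2 \<nu> T g \<longleftrightarrow>
     L2_strongly_measurable (lebesgue_on {0<..<T}) \<nu> g \<and>
     (\<forall>K. compact K \<and> K \<subseteq> {0<..<T} \<longrightarrow>
        (\<integral>\<^sup>+ t. ennreal (L2_norm \<nu> (g t)) \<partial>lebesgue_on K) < \<infinity>)"

definition test_function :: "real \<Rightarrow> (real \<Rightarrow> real) \<Rightarrow> bool" where
  "test_function T \<phi> \<longleftrightarrow>
     (\<forall>k t. (deriv ^^ k) \<phi> differentiable at t) \<and>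
     (\<exists>K. compact K \<and> K \<subseteq> {0<..<T} \<and> (\<forall>t. t \<notin> K \<longrightarrow> \<phi> t = 0))"

text \<open>
  \<open>v \<in> W\<^sup>1\<^sup>,\<^sup>1\<^sub>l\<^sub>o\<^sub>c(0,T;L\<^sup>2(\<nu>))\<close> with distributional derivative \<open>v'\<close>, which is determined by \<open>v\<close>
  for almost every time.
\<close>

definition W11_loc_derivative ::
    "'a measure \<Rightarrow> real \<Rightarrow> (real \<Rightarrow> 'a \<Rightarrow> real) \<Rightarrow> (real \<Rightarrow> 'a \<Rightarrow> real) \<Rightarrow> bool" where
  "W11_loc_derivative \<nu> T v v' \<longleftrightarrow>
     L1_loc_L2 \<nu> T v \<and> L1_loc_L2 \<nu> T v' \<and>
     (\<forall>\<phi>. test_function T \<phi> \<longrightarrow>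
        (\<exists>I. has_L2_integral (lebesgue_on {0<..<T}) \<nu> (\<lambda>t x. deriv \<phi> t * v t x) I \<and>
             has_L2_integral (lebesgue_on {0<..<T}) \<nu> (\<lambda>t x. \<phi> t * v' t x) (\<lambda>x. - I x)))"


section \<open>Strong solutions\<close>

definition strong_solution ::
    "('a \<Rightarrow> 'a measure) \<Rightarrow> 'a measure \<Rightarrow> ('a \<Rightarrow> real) \<Rightarrow> real \<Rightarrow> real \<Rightarrow>
     ('a \<Rightarrow> real) \<Rightarrow> (real \<Rightarrow> 'a \<Rightarrow> real) \<Rightarrow> bool" where
  "strong_solution m \<nu> f lam T v0 v \<longleftrightarrow>
     continuous_L2 \<nu> T v \<and>
     (AE x in \<nu>. v 0 x = v0 x) \<and>
     (\<exists>v'. W11_loc_derivative \<nu> T v v' \<and>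
        (AE t in lebesgue_on {0<..<T}.
           \<exists>\<xi>\<in>sign_set \<nu> (\<lambda>x. v t x - f x).
             (\<lambda>x. lam * \<xi> x + v' t x) \<in> one_Laplacian m \<nu> (v t)))"

end

theory Submission
  imports Defs
begin

text \<open>
  As \<open>\<nu>\<close> is finite and invariant, \<open>u \<mapsto> TV u + lam * \<integral>\<bar>u - f\<bar>\<close> is a convex function which is finite and
  Lipschitz on all of \<open>L\<^sup>2\<close>, although it is not differentiable.  The explicit function
  \<open>drift u = TV_grad u + lam * sgn (u - f)\<close>, with
  \<open>TV_grad u x = - \<integral>sgn (u y - u x) dm\<^sub>x(y)\<close>, selects one of its subgradients at every \<open>u\<close>
  (\<open>TV_grad_subgradient\<close>); it is discontinuous, but monotone and bounded by \<open>1 + lam\<close> at every point.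
  The Cauchy problem is the gradient flow of this convex function.

  Existence.  For a monotone and bounded drift the explicit Euler scheme converges: one step of length
  \<open>h\<close> and two steps of length \<open>h / 2\<close> differ by \<open>O(h\<^sup>2)\<close> in the square of the \<open>L\<^sup>2\<close> norm
  (\<open>euler_refinement\<close>), so the schemes with dyadic steps form a Cauchy sequence, uniformly in time, with a
  limit \<open>V\<close>.  The values of \<open>TV_grad\<close> and of the sign along the schemes need not converge.  Being close to
  a subgradient along \<open>V\<close>, to a sign of \<open>V - f\<close>, and to a pair which drives \<open>V\<close>, are however convex
  conditions, and elements of almost minimal norm in a decreasing sequence of convex sets form a Cauchy
  sequence by the parallelogram law (\<open>nested_midpoint_convex_Cauchy\<close>).  Their limit \<open>(\<eta>, \<xi>)\<close>, taken in
  \<open>L\<^sup>2\<close> of the product of time and space, is a subgradient and a sign for almost every time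
  (\<open>limit_pair_exists\<close>), and \<open>v t = v0 - \<integral>\<^sub>0\<^sup>t (\<eta> + lam * \<xi>)\<close> is a strong solution.  The limit is taken for
  the pair, because the equation requires the sign separately from the subgradient of the total variation.

  Contraction.  Subgradients \<open>g\<close>, \<open>h\<close> of the total variation at \<open>u\<close>, \<open>w\<close> satisfy
  \<open>\<integral>(g - h) * P (u - w) \<ge> 0\<close> for every nondecreasing 1-Lipschitz \<open>P\<close>, because exchanging \<open>P (u - w)\<close>
  between \<open>u\<close> and \<open>w\<close> does not increase the sum of their variations (\<open>TVr_exchange\<close>); signs have the
  same property pointwise if \<open>P 0 = 0\<close>.  Hence \<open>\<integral>j (v - w)\<close> decreases for suitable convex \<open>j\<close> with \<open>j' = P\<close>
  (\<open>excess_decreasing\<close>), and multiples of these \<open>j\<close> approximate \<open>r \<mapsto> max 0 (r - k)\<close> for every \<open>k \<ge> 0\<close>;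
  with the roles of \<open>v\<close> and \<open>w\<close> exchanged this gives \<open>r \<mapsto> max 0 (\<bar>r\<bar> - k)\<close> (\<open>excess_contraction\<close>).  Every
  power \<open>\<bar>r\<bar>\<^sup>q\<close> with \<open>q \<ge> 1\<close> is a superposition of such functions, and the essential supremum is governed by a single
  one (\<open>Lq_norm_le_of_excess\<close>).  Uniqueness is the contraction in \<open>L\<^sup>1\<close> for equal initial data.
\<close>

section \<open>The algebra of square integrable functions\<close>

abbreviation L2_dist :: "'a measure \<Rightarrow> ('a \<Rightarrow> real) \<Rightarrow> ('a \<Rightarrow> real) \<Rightarrow> real" where
  "L2_dist N u w \<equiv> L2_norm N (\<lambda>x. u x - w x)"

lemma L2_spaceD: "u \<in> L2_space N \<Longrightarrow> u \<in> borel_measurable N" "u \<in> L2_space N \<Longrightarrow> integrable N (\<lambda>x. (u x)\<^sup>2)"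
  by (auto simp: L2_space_def)

lemma L2_integrable_mult:
  assumes "u \<in> L2_space N" "w \<in> L2_space N"
  shows "integrable N (\<lambda>x. u x * w x)"
proof (rule Bochner_Integration.integrable_bound)
  show "integrable N (\<lambda>x. (u x)\<^sup>2 + (w x)\<^sup>2)" using assms by (auto dest: L2_spaceD)
  show "(\<lambda>x. u x * w x) \<in> borel_measurable N"
    using assms by (auto dest: L2_spaceD intro!: borel_measurable_times)
  have "\<bar>a * b\<bar> \<le> a\<^sup>2 + b\<^sup>2" for a b :: real
    using sum_squares_bound[of a b] sum_squares_bound[of a "-b"] zero_le_power2[of a] zero_le_power2[of b]
    by (simp add: abs_le_iff)
  then show "AE x in N. norm (u x * w x) \<le> norm ((u x)\<^sup>2 + (w x)\<^sup>2)" by simp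
qed

lemma L2_add: "u \<in> L2_space N \<Longrightarrow> w \<in> L2_space N \<Longrightarrow> (\<lambda>x. u x + w x) \<in> L2_space N"
  using L2_integrable_mult[of u N w]
  by (auto simp: L2_space_def power2_sum mult.assoc intro!: Bochner_Integration.integrable_add)

lemma L2_scale: "u \<in> L2_space N \<Longrightarrow> (\<lambda>x. c * u x) \<in> L2_space N"
  by (auto simp: L2_space_def power_mult_distrib)

lemma L2_minus: "u \<in> L2_space N \<Longrightarrow> (\<lambda>x. - u x) \<in> L2_space N"
  using L2_scale[of u N "-1"] by simp

lemma L2_diff: "u \<in> L2_space N \<Longrightarrow> w \<in> L2_space N \<Longrightarrow> (\<lambda>x. u x - w x) \<in> L2_space N"
  using L2_add[of u N "\<lambda>x. - w x"] L2_minus[of w N] by simp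

lemma L2_zero: "(\<lambda>_. 0) \<in> L2_space N"
  by (simp add: L2_space_def)

lemma L2_sum: "(\<And>i. i \<in> I \<Longrightarrow> F i \<in> L2_space N) \<Longrightarrow> (\<lambda>x. \<Sum>i\<in>I. F i x) \<in> L2_space N"
  by (induction I rule: infinite_finite_induct) (auto intro: L2_zero L2_add)

lemma L2_dominated:
  assumes "w \<in> L2_space N" "u \<in> borel_measurable N" "\<And>x. x \<in> space N \<Longrightarrow> \<bar>u x\<bar> \<le> \<bar>w x\<bar>"
  shows "u \<in> L2_space N"
proof -
  have "integrable N (\<lambda>x. (u x)\<^sup>2)"
  proof (rule Bochner_Integration.integrable_bound)
    show "integrable N (\<lambda>x. (w x)\<^sup>2)" using assms by (simp add: L2_space_def)
    show "AE x in N. norm ((u x)\<^sup>2) \<le> norm ((w x)\<^sup>2)"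
      using assms(3) by (auto simp: abs_le_square_iff)
  qed (use assms in measurable)
  then show ?thesis using assms by (simp add: L2_space_def)
qed

lemma L2_bounded:
  assumes "finite_measure N" "u \<in> borel_measurable N" "\<And>x. x \<in> space N \<Longrightarrow> \<bar>u x\<bar> \<le> C"
  shows "u \<in> L2_space N"
proof (rule L2_dominated)
  interpret finite_measure N by fact
  show "(\<lambda>_. \<bar>C\<bar>) \<in> L2_space N" by (simp add: L2_space_def)
qed (use assms in force)+

lemma L2_AE_cong:
  assumes "u \<in> L2_space N" "w \<in> borel_measurable N" "AE x in N. w x = u x"
  shows "w \<in> L2_space N"
proof -
  have "integrable N (\<lambda>x. (w x)\<^sup>2) \<longleftrightarrow> integrable N (\<lambda>x. (u x)\<^sup>2)"
    by (rule Bochner_Integration.integrable_cong_AE) (use assms in \<open>auto dest: L2_spaceD\<close>)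
  then show ?thesis using assms by (simp add: L2_space_def)
qed

lemma L2_inner_add_left:
  assumes "u \<in> L2_space N" "v \<in> L2_space N" "w \<in> L2_space N"
  shows "L2_inner N (\<lambda>x. u x + v x) w = L2_inner N u w + L2_inner N v w"
  by (simp add: L2_inner_def distrib_right L2_integrable_mult assms)

lemma L2_inner_diff_left:
  assumes "u \<in> L2_space N" "v \<in> L2_space N" "w \<in> L2_space N"
  shows "L2_inner N (\<lambda>x. u x - v x) w = L2_inner N u w - L2_inner N v w"
  by (simp add: L2_inner_def left_diff_distrib L2_integrable_mult assms)

lemma L2_inner_scale_left: "L2_inner N (\<lambda>x. c * u x) w = c * L2_inner N u w"
  by (simp add: L2_inner_def mult.assoc)

lemma L2_inner_minus_left: "L2_inner N (\<lambda>x. - u x) w = - L2_inner N u w"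
  by (simp add: L2_inner_def)

lemma L2_inner_commute: "L2_inner N u w = L2_inner N w u"
  by (simp add: L2_inner_def mult.commute)

lemma L2_norm_sq: "(L2_norm N u)\<^sup>2 = (\<integral>x. (u x)\<^sup>2 \<partial>N)"
  by (simp add: L2_norm_def L2_inner_def power2_eq_square[symmetric])

lemma L2_norm_nonneg: "0 \<le> L2_norm N u"
  by (simp add: L2_norm_def L2_inner_def)

lemma L2_norm_zero: "L2_norm N (\<lambda>_. 0) = 0"
  by (simp add: L2_norm_def L2_inner_def)

lemma L2_norm_scale: "L2_norm N (\<lambda>x. c * u x) = \<bar>c\<bar> * L2_norm N u"
proof -
  have "(\<integral>x. (c * u x) * (c * u x) \<partial>N) = c\<^sup>2 * (\<integral>x. u x * u x \<partial>N)"
    by (simp add: power2_eq_square mult_ac flip: Bochner_Integration.integral_mult_right_zero)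
  then show ?thesis by (simp add: L2_norm_def L2_inner_def real_sqrt_mult)
qed

lemma L2_norm_minus: "L2_norm N (\<lambda>x. - u x) = L2_norm N u"
  by (simp add: L2_norm_def L2_inner_def)

lemma L2_norm_minus_commute: "L2_dist N u w = L2_dist N w u"
  using L2_norm_minus[of N "\<lambda>x. u x - w x"] by simp

lemma L2_norm_mono:
  assumes "w \<in> L2_space N" "u \<in> borel_measurable N" "AE x in N. \<bar>u x\<bar> \<le> \<bar>w x\<bar>"
  shows "L2_norm N u \<le> L2_norm N w"
proof -
  have "(\<integral>x. (u x)\<^sup>2 \<partial>N) \<le> (\<integral>x. (w x)\<^sup>2 \<partial>N)"
    by (rule integral_mono_AE') (use assms in \<open>auto simp: L2_space_def abs_le_square_iff\<close>)
  then show ?thesis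
    by (simp add: L2_norm_def L2_inner_def power2_eq_square[symmetric])
qed

lemma L2_norm_cong_AE:
  assumes "u \<in> borel_measurable N" "w \<in> borel_measurable N" "AE x in N. u x = w x"
  shows "L2_norm N u = L2_norm N w"
  unfolding L2_norm_def L2_inner_def
  by (rule arg_cong[where f=sqrt], rule integral_cong_AE) (use assms in auto)

lemma L2_norm_eq_0:
  assumes "u \<in> L2_space N" "L2_norm N u = 0" shows "AE x in N. u x = 0"
proof -
  have "(\<integral>x. (u x)\<^sup>2 \<partial>N) = 0" using assms(2) L2_norm_sq[of N u] by simp
  then show ?thesis
    using integral_nonneg_eq_0_iff_AE[of N "\<lambda>x. (u x)\<^sup>2"] assms(1) by (auto simp: L2_space_def)
qed

lemma L2_Cauchy_Schwarz:
  assumes u: "u \<in> L2_space N" and w: "w \<in> L2_space N"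
  shows "(\<integral>x. \<bar>u x * w x\<bar> \<partial>N) \<le> L2_norm N u * L2_norm N w"
proof (cases "L2_norm N u = 0 \<or> L2_norm N w = 0")
  case True
  then have "AE x in N. u x * w x = 0"
    using L2_norm_eq_0[OF u] L2_norm_eq_0[OF w] by auto
  then have "(\<integral>x. \<bar>u x * w x\<bar> \<partial>N) = (\<integral>x. 0 \<partial>N)"
    by (intro integral_cong_AE) (use L2_integrable_mult[OF u w] in auto)
  then show ?thesis by (simp add: L2_norm_nonneg)
next
  case False
  define a b where "a = L2_norm N u" and "b = L2_norm N w"
  have ab: "a > 0" "b > 0" using False L2_norm_nonneg[of N u] L2_norm_nonneg[of N w] by (auto simp: a_def b_def)
  have "(\<integral>x. \<bar>u x * w x\<bar> \<partial>N) \<le> (\<integral>x. (b / a * (u x)\<^sup>2 + a / b * (w x)\<^sup>2) / 2 \<partial>N)"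
  proof (rule integral_mono)
    show "integrable N (\<lambda>x. \<bar>u x * w x\<bar>)" using L2_integrable_mult[OF u w] by simp
    show "integrable N (\<lambda>x. (b / a * (u x)\<^sup>2 + a / b * (w x)\<^sup>2) / 2)"
      using L2_spaceD[OF u] L2_spaceD[OF w] by auto
    fix x
    have "0 \<le> (b * \<bar>u x\<bar> - a * \<bar>w x\<bar>)\<^sup>2" by simp
    then have "2 * a * b * (\<bar>u x\<bar> * \<bar>w x\<bar>) \<le> b\<^sup>2 * (u x)\<^sup>2 + a\<^sup>2 * (w x)\<^sup>2"
      by (simp add: power2_diff power_mult_distrib algebra_simps)
    then show "\<bar>u x * w x\<bar> \<le> (b / a * (u x)\<^sup>2 + a / b * (w x)\<^sup>2) / 2"
      using ab by (simp add: field_simps abs_mult power2_eq_square)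
  qed
  also have "\<dots> = (b / a * a\<^sup>2 + a / b * b\<^sup>2) / 2"
    using L2_spaceD(2)[OF u] L2_spaceD(2)[OF w] by (simp add: a_def b_def L2_norm_sq)
  also have "\<dots> = a * b" using ab by (simp add: power2_eq_square)
  finally show ?thesis by (simp add: a_def b_def)
qed

lemma L2_inner_le:
  assumes u: "u \<in> L2_space N" and w: "w \<in> L2_space N"
  shows "\<bar>L2_inner N u w\<bar> \<le> L2_norm N u * L2_norm N w"
  using order_trans[OF integral_abs_bound[of N "\<lambda>x. u x * w x"] L2_Cauchy_Schwarz[OF u w]]
  by (simp add: L2_inner_def)

lemma L2_norm_triangle:
  assumes u: "u \<in> L2_space N" and w: "w \<in> L2_space N"
  shows "L2_norm N (\<lambda>x. u x + w x) \<le> L2_norm N u + L2_norm N w"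
proof (rule power2_le_imp_le)
  have "(L2_norm N (\<lambda>x. u x + w x))\<^sup>2 = (L2_norm N u)\<^sup>2 + (L2_norm N w)\<^sup>2 + 2 * L2_inner N u w"
    using L2_spaceD(2)[OF u] L2_spaceD(2)[OF w] L2_integrable_mult[OF u w]
    by (simp add: L2_norm_sq power2_sum L2_inner_def mult.assoc)
  also have "\<dots> \<le> (L2_norm N u + L2_norm N w)\<^sup>2"
    using L2_inner_le[OF u w] by (simp add: power2_sum)
  finally show "(L2_norm N (\<lambda>x. u x + w x))\<^sup>2 \<le> (L2_norm N u + L2_norm N w)\<^sup>2" .
qed (simp add: L2_norm_nonneg)

lemma L2_norm_triangle_diff:
  assumes "u \<in> L2_space N" "v \<in> L2_space N" "w \<in> L2_space N"
  shows "L2_dist N u w \<le> L2_dist N u v + L2_dist N v w"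
  using L2_norm_triangle[OF L2_diff[OF assms(1,2)] L2_diff[OF assms(2,3)]] by simp

lemma L2_norm_diff_le:
  assumes u: "u \<in> L2_space N" and w: "w \<in> L2_space N"
  shows "\<bar>L2_norm N u - L2_norm N w\<bar> \<le> L2_dist N u w"
  using L2_norm_triangle[OF L2_diff[OF u w] w] L2_norm_triangle[OF L2_diff[OF w u] u]
  by (simp add: L2_norm_minus_commute[of N w u])

lemma L2_norm_tendsto:
  assumes lim: "((\<lambda>n. L2_dist N (g n) h) \<longlongrightarrow> 0) F" and g: "\<forall>\<^sub>F n in F. g n \<in> L2_space N" and h: "h \<in> L2_space N"
  shows "((\<lambda>n. L2_norm N (g n)) \<longlongrightarrow> L2_norm N h) F"
proof (rule LIM_zero_cancel, rule Lim_null_comparison[OF _ lim])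
  show "\<forall>\<^sub>F n in F. norm (L2_norm N (g n) - L2_norm N h) \<le> L2_dist N (g n) h"
    using g by eventually_elim (use L2_norm_diff_le[OF _ h] in simp)
qed

lemma L2_inner_tendsto:
  assumes lim: "((\<lambda>n. L2_dist N (g n) h) \<longlongrightarrow> 0) F" and g: "\<forall>\<^sub>F n in F. g n \<in> L2_space N"
    and h: "h \<in> L2_space N" and w: "w \<in> L2_space N"
  shows "((\<lambda>n. L2_inner N (g n) w) \<longlongrightarrow> L2_inner N h w) F"
proof (rule LIM_zero_cancel, rule Lim_null_comparison[OF _ tendsto_mult_left_zero[OF lim]])
  show "\<forall>\<^sub>F n in F. norm (L2_inner N (g n) w - L2_inner N h w) \<le> L2_dist N (g n) h * L2_norm N w"
    using g
  proof eventually_elim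
    case (elim n)
    then show ?case using L2_inner_le[OF L2_diff[OF elim h] w] by (simp add: L2_inner_diff_left[OF elim h w])
  qed
qed

lemma L2_norm_bounded:
  assumes "finite_measure N" "u \<in> borel_measurable N" "\<And>x. x \<in> space N \<Longrightarrow> \<bar>u x\<bar> \<le> C"
  shows "L2_norm N u \<le> \<bar>C\<bar> * sqrt (measure N (space N))"
proof -
  interpret finite_measure N by fact
  have "L2_norm N u \<le> L2_norm N (\<lambda>_. \<bar>C\<bar>)"
    by (rule L2_norm_mono) (use assms order_trans[OF _ abs_ge_self] in \<open>auto simp: L2_space_def intro!: AE_I2\<close>)
  also have "\<dots> = \<bar>C\<bar> * sqrt (measure N (space N))"
    by (simp add: L2_norm_def L2_inner_def real_sqrt_mult)
  finally show ?thesis .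
qed

lemma L2_imp_integrable:
  assumes "finite_measure N" "u \<in> L2_space N" shows "integrable N u"
proof -
  interpret finite_measure N by fact
  have "(\<lambda>_. 1) \<in> L2_space N" by (simp add: L2_space_def)
  from L2_integrable_mult[OF assms(2) this] show ?thesis by simp
qed

lemma L1_norm_le_L2_norm:
  assumes "finite_measure N" "u \<in> L2_space N"
  shows "(\<integral>x. \<bar>u x\<bar> \<partial>N) \<le> sqrt (measure N (space N)) * L2_norm N u"
proof -
  interpret finite_measure N by fact
  have *: "(\<lambda>_. 1) \<in> L2_space N" by (simp add: L2_space_def)
  have "L2_norm N (\<lambda>_. 1) = sqrt (measure N (space N))" by (simp add: L2_norm_def L2_inner_def)
  with L2_Cauchy_Schwarz[OF assms(2) *] show ?thesis by (simp add: mult.commute)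
qed

lemma L2_norm_ennreal:
  assumes "u \<in> L2_space N"
  shows "ennreal ((L2_norm N u)\<^sup>2) = (\<integral>\<^sup>+x. ennreal ((u x)\<^sup>2) \<partial>N)"
  unfolding L2_norm_sq by (rule nn_integral_eq_integral[symmetric]) (use assms in \<open>auto dest: L2_spaceD\<close>)

lemma Lipschitz_L2:
  assumes "finite_measure N" "u \<in> L2_space N" "L-lipschitz_on UNIV P"
  shows "(\<lambda>x. P (u x)) \<in> L2_space N"
proof (rule L2_dominated)
  interpret finite_measure N by fact
  have [measurable]: "P \<in> borel_measurable borel"
    by (rule borel_measurable_continuous_onI) (rule lipschitz_on_continuous_on[OF assms(3)])
  have [measurable]: "u \<in> borel_measurable N" using assms by (auto dest: L2_spaceD)
  show "(\<lambda>x. P (u x)) \<in> borel_measurable N" by measurable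
  have "(\<lambda>_. \<bar>P 0\<bar>) \<in> L2_space N" by (simp add: L2_space_def)
  moreover have "(\<lambda>x. \<bar>u x\<bar>) \<in> L2_space N" using assms by (simp add: L2_space_def)
  ultimately show "(\<lambda>x. L * \<bar>u x\<bar> + \<bar>P 0\<bar>) \<in> L2_space N" by (intro L2_add L2_scale)
  fix x
  have "\<bar>P (u x) - P 0\<bar> \<le> L * \<bar>u x\<bar>"
    using lipschitz_onD[OF assms(3), of "u x" 0] by (simp add: dist_real_def)
  then show "\<bar>P (u x)\<bar> \<le> \<bar>L * \<bar>u x\<bar> + \<bar>P 0\<bar>\<bar>" by linarith
qed

subsection \<open>Completeness\<close>

text \<open>
  The increments are summable in \<open>L\<^sup>1\<close>, hence absolutely summable almost everywhere, which gives a pointwise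
  limit; Fatou's lemma carries the geometric tail estimate in \<open>L\<^sup>2\<close> over to it.
\<close>

lemma Riesz_Fischer_geometric:
  assumes fin: "finite_measure N" and F: "\<And>n::nat. F n \<in> L2_space N"
    and fast: "\<And>n. L2_dist N (F (Suc n)) (F n) \<le> C * r ^ n" and r: "0 \<le> r" "r < 1"
  shows "\<exists>g\<in>L2_space N. \<forall>n. L2_dist N (F n) g \<le> C * r ^ n / (1 - r)"
proof -
  interpret finite_measure N by fact
  have [measurable]: "F n \<in> borel_measurable N" for n using F by (auto dest: L2_spaceD)
  define V where "V = sqrt (measure N (space N))"
  have C0: "0 \<le> C" using order_trans[OF L2_norm_nonneg fast[of 0]] by simp
  have D: "(\<lambda>x. F m x - F n x) \<in> L2_space N" for m n by (intro L2_diff F)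
  have L1: "(\<integral>\<^sup>+x. ennreal \<bar>F (Suc n) x - F n x\<bar> \<partial>N) \<le> ennreal (V * C * r ^ n)" for n
  proof -
    have "(\<integral>\<^sup>+x. ennreal \<bar>F (Suc n) x - F n x\<bar> \<partial>N) = ennreal (\<integral>x. \<bar>F (Suc n) x - F n x\<bar> \<partial>N)"
      by (rule nn_integral_eq_integral) (use L2_imp_integrable[OF fin D] in auto)
    also have "\<dots> \<le> ennreal (V * (C * r ^ n))"
      using L1_norm_le_L2_norm[OF fin D[of "Suc n" n]] mult_left_mono[OF fast[of n], of V]
      by (intro ennreal_leI) (simp add: V_def)
    finally show ?thesis by (simp add: mult.assoc)
  qed
  have "(\<integral>\<^sup>+x. (\<Sum>n. ennreal \<bar>F (Suc n) x - F n x\<bar>) \<partial>N) = (\<Sum>n. \<integral>\<^sup>+x. ennreal \<bar>F (Suc n) x - F n x\<bar> \<partial>N)"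
    by (rule nn_integral_suminf) measurable
  also have "\<dots> \<le> (\<Sum>n. ennreal (V * C * r ^ n))" by (intro suminf_le L1) auto
  also have "\<dots> < \<infinity>"
  proof -
    have "summable (\<lambda>n. V * C * r ^ n)" using r by (intro summable_mult summable_geometric) auto
    then show ?thesis
      using r C0 by (subst suminf_ennreal_eq[OF _ summable_sums]) (auto simp: V_def)
  qed
  finally have "AE x in N. (\<Sum>n. ennreal \<bar>F (Suc n) x - F n x\<bar>) \<noteq> \<infinity>"
    by (intro nn_integral_PInf_AE) auto
  then have conv: "AE x in N. convergent (\<lambda>n. F n x)"
  proof eventually_elim
    case (elim x)
    then have "summable (\<lambda>n. \<bar>F (Suc n) x - F n x\<bar>)"
      by (intro summable_suminf_not_top) (auto simp: top_ennreal_def)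
    then have "summable (\<lambda>n. F (Suc n) x - F n x)" by (rule summable_rabs_cancel)
    then have "convergent (\<lambda>n. \<Sum>i<n. F (Suc i) x - F i x)" by (simp add: summable_iff_convergent)
    moreover have "(\<Sum>i<n. F (Suc i) x - F i x) = F n x - F 0 x" for n
      by (induction n) auto
    ultimately have "convergent (\<lambda>n. F n x - F 0 x)" by simp
    then have "convergent (\<lambda>n. (F n x - F 0 x) + F 0 x)" by (intro convergent_add convergent_const)
    then show ?case by simp
  qed
  define g where "g x = lim (\<lambda>n. F n x)" for x
  have [measurable]: "g \<in> borel_measurable N" unfolding g_def by measurable
  have lim: "AE x in N. (\<lambda>n. F n x) \<longlonglongrightarrow> g x"
    using conv by eventually_elim (simp add: g_def convergent_LIMSEQ_iff)
  have diff: "L2_dist N (F n) (F (n + k)) \<le> C * r ^ n / (1 - r)" for n k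
  proof -
    have "L2_dist N (F n) (F (n + k)) \<le> C * r ^ n * (\<Sum>i<k. r ^ i)"
    proof (induction k)
      case 0 then show ?case by (simp add: L2_norm_zero)
    next
      case (Suc k)
      have "L2_dist N (F n) (F (n + Suc k))
          \<le> L2_dist N (F n) (F (n + k)) + L2_dist N (F (n + k)) (F (n + Suc k))"
        by (rule L2_norm_triangle_diff) (rule F)+
      also have "L2_dist N (F (n + k)) (F (n + Suc k)) \<le> C * r ^ (n + k)"
        using fast[of "n + k"] by (subst L2_norm_minus_commute) simp
      finally show ?case using Suc by (simp add: power_add algebra_simps)
    qed
    also have "\<dots> \<le> C * r ^ n * (1 / (1 - r))"
    proof (rule mult_left_mono)
      have "(\<Sum>i<k. r ^ i) = (1 - r ^ k) / (1 - r)" using r by (simp add: sum_gp_strict)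
      then show "(\<Sum>i<k. r ^ i) \<le> 1 / (1 - r)" using r by (simp add: divide_right_mono)
    qed (use C0 r in simp)
    finally show ?thesis by simp
  qed
  have bound: "(\<integral>\<^sup>+x. ennreal ((F n x - g x)\<^sup>2) \<partial>N) \<le> ennreal ((C * r ^ n / (1 - r))\<^sup>2)" for n
  proof -
    have "(\<integral>\<^sup>+x. ennreal ((F n x - g x)\<^sup>2) \<partial>N)
        = (\<integral>\<^sup>+x. liminf (\<lambda>k. ennreal ((F n x - F (n + k) x)\<^sup>2)) \<partial>N)"
    proof (rule nn_integral_cong_AE)
      show "AE x in N. ennreal ((F n x - g x)\<^sup>2) = liminf (\<lambda>k. ennreal ((F n x - F (n + k) x)\<^sup>2))"
        using lim
      proof eventually_elim
        case (elim x)
        then have "(\<lambda>k. F (k + n) x) \<longlonglongrightarrow> g x" by (rule LIMSEQ_ignore_initial_segment)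
        then have "(\<lambda>k. ennreal ((F n x - F (n + k) x)\<^sup>2)) \<longlonglongrightarrow> ennreal ((F n x - g x)\<^sup>2)"
          by (intro tendsto_intros) (simp_all add: add.commute)
        then show ?case by (rule lim_imp_Liminf[OF trivial_limit_sequentially, symmetric])
      qed
    qed
    also have "\<dots> \<le> liminf (\<lambda>k. \<integral>\<^sup>+x. ennreal ((F n x - F (n + k) x)\<^sup>2) \<partial>N)"
      by (rule nn_integral_liminf) measurable
    also have "\<dots> \<le> ennreal ((C * r ^ n / (1 - r))\<^sup>2)"
    proof (rule Liminf_le)
      show "\<forall>\<^sub>F k in sequentially. (\<integral>\<^sup>+x. ennreal ((F n x - F (n + k) x)\<^sup>2) \<partial>N) \<le> ennreal ((C * r ^ n / (1 - r))\<^sup>2)"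
        using power_mono[OF diff L2_norm_nonneg, of _ _ 2]
        by (auto simp: L2_norm_ennreal[OF D, symmetric] intro!: ennreal_leI)
    qed simp
    finally show ?thesis .
  qed
  have Fg: "(\<lambda>x. F n x - g x) \<in> L2_space N" for n
  proof -
    have "integrable N (\<lambda>x. (F n x - g x)\<^sup>2)"
      by (rule integrableI_nonneg) (use le_less_trans[OF bound[of n]] in auto)
    then show ?thesis by (simp add: L2_space_def)
  qed
  have "g \<in> L2_space N" using L2_diff[OF F[of 0] Fg[of 0]] by simp
  moreover have "L2_dist N (F n) g \<le> C * r ^ n / (1 - r)" for n
  proof (rule power2_le_imp_le)
    show "(L2_dist N (F n) g)\<^sup>2 \<le> (C * r ^ n / (1 - r))\<^sup>2"
      using bound[of n] by (simp add: L2_norm_ennreal[OF Fg, symmetric])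
    show "0 \<le> C * r ^ n / (1 - r)" using C0 r by simp
  qed
  ultimately show ?thesis by blast
qed

section \<open>The total variation of a reversible random walk\<close>

locale reversible_walk =
  fixes m :: "'a::polish_space \<Rightarrow> 'a measure" and \<nu> :: "'a measure"
  assumes walk: "random_walk m"
    and sets_nu: "sets \<nu> = sets borel"
    and finite_nu: "finite_measure \<nu>"
    and rev: "reversible m \<nu>"
begin

lemma space_nu: "space \<nu> = UNIV"
  using sets_eq_imp_space_eq[OF sets_nu] by simp

lemma measurable_nu: "borel_measurable \<nu> = borel_measurable borel"
  by (rule measurable_cong_sets) (simp_all add: sets_nu)

lemma prob_walk: "prob_space (m x)" and sets_walk: "sets (m x) = sets borel"
  using walk by (auto simp: random_walk_def)

lemma measurable_walk: "borel_measurable (m x) = borel_measurable borel"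
  by (rule measurable_cong_sets) (simp_all add: sets_walk)

lemma walk_kernel: "m \<in> borel \<rightarrow>\<^sub>M subprob_algebra borel"
proof (rule measurable_subprob_algebra)
  fix A :: "'a set" assume A: "A \<in> sets borel"
  have "(\<lambda>a. ennreal (measure (m a) A)) \<in> borel_measurable borel"
    using walk A by (intro measurable_compose[OF _ measurable_ennreal]) (auto simp: random_walk_def)
  moreover have "emeasure (m a) A = ennreal (measure (m a) A)" for a
  proof -
    interpret prob_space "m a" by (rule prob_walk)
    show ?thesis by (rule emeasure_eq_measure)
  qed
  ultimately show "(\<lambda>a. emeasure (m a) A) \<in> borel_measurable borel" by simp
qed (auto simp: prob_walk sets_walk prob_space_imp_subprob_space)

text \<open>
  Keeping the starting point in the law of a step makes an integrand which depends on both ends of an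
  edge an integrand for a kernel, to which the theory of \<open>bind\<close> applies.
\<close>

definition edge_kernel :: "'a \<Rightarrow> ('a \<times> 'a) measure" where
  "edge_kernel x = distr (m x) (borel \<Otimes>\<^sub>M borel) (Pair x)"

text \<open>
  The measure \<open>dm\<^sub>x(y) d\<nu>(x)\<close> on the pairs \<open>(x, y)\<close>.
\<close>

definition edge_measure :: "('a \<times> 'a) measure" where
  "edge_measure = \<nu> \<bind> edge_kernel"

lemma edge_kernel_measurable: "edge_kernel \<in> borel \<rightarrow>\<^sub>M subprob_algebra (borel \<Otimes>\<^sub>M borel)"
  unfolding edge_kernel_def by (rule measurable_distr2[OF _ walk_kernel]) simp

lemma edge_kernel_measurable_nu: "edge_kernel \<in> \<nu> \<rightarrow>\<^sub>M subprob_algebra (borel \<Otimes>\<^sub>M borel)"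
  using edge_kernel_measurable by (simp cong: measurable_cong_sets add: sets_nu)

lemma sets_edge: "sets edge_measure = sets (borel \<Otimes>\<^sub>M borel)"
  unfolding edge_measure_def
  by (rule sets_bind[OF sets_kernel[OF edge_kernel_measurable_nu]]) (auto simp: space_nu)

lemma space_edge: "space edge_measure = UNIV"
  using sets_eq_imp_space_eq[OF sets_edge] by (simp add: space_pair_measure)

lemma measurable_edge: "borel_measurable edge_measure = borel_measurable (borel \<Otimes>\<^sub>M borel)"
  by (rule measurable_cong_sets) (simp_all add: sets_edge)

lemma measurable_Pair_walk: "Pair x \<in> m x \<rightarrow>\<^sub>M borel \<Otimes>\<^sub>M borel"
  by (subst measurable_cong_sets[OF sets_walk refl]) measurable

lemma nn_integral_edge:
  assumes [measurable]: "h \<in> borel_measurable (borel \<Otimes>\<^sub>M borel)"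
  shows "(\<integral>\<^sup>+z. h z \<partial>edge_measure) = (\<integral>\<^sup>+x. \<integral>\<^sup>+y. h (x, y) \<partial>m x \<partial>\<nu>)"
  unfolding edge_measure_def nn_integral_bind[OF assms edge_kernel_measurable_nu]
  unfolding edge_kernel_def by (simp add: nn_integral_distr[OF measurable_Pair_walk])

lemma integral_edge_kernel:
  fixes h :: "_ \<Rightarrow> real"
  assumes [measurable]: "h \<in> borel_measurable (borel \<Otimes>\<^sub>M borel)"
  shows "(\<integral>z. h z \<partial>edge_kernel x) = (\<integral>y. h (x, y) \<partial>m x)"
  unfolding edge_kernel_def by (rule integral_distr[OF measurable_Pair_walk]) measurable

lemma borel_measurable_walk_integral:
  fixes h :: "_ \<Rightarrow> real"
  assumes [measurable]: "h \<in> borel_measurable (borel \<Otimes>\<^sub>M borel)"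
  shows "(\<lambda>x. \<integral>y. h (x, y) \<partial>m x) \<in> borel_measurable borel"
  unfolding integral_edge_kernel[OF assms, symmetric]
  by (rule measurable_compose[OF edge_kernel_measurable integral_measurable_subprob_algebra]) measurable

lemma measurable_swap_edge: "prod.swap \<in> edge_measure \<rightarrow>\<^sub>M borel \<Otimes>\<^sub>M borel"
  unfolding prod.swap_def[abs_def] by (subst measurable_cong_sets[OF sets_edge refl]) measurable

text \<open>
  This is reversibility, which from here on is used as the right to exchange the two ends of an edge.
\<close>

lemma edge_symmetric: "distr edge_measure (borel \<Otimes>\<^sub>M borel) prod.swap = edge_measure"
proof (rule measure_eqI)
  fix C assume "C \<in> sets (distr edge_measure (borel \<Otimes>\<^sub>M borel) prod.swap)"
  then have C: "C \<in> sets (borel \<Otimes>\<^sub>M borel)" by simp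
  have swap: "prod.swap \<in> edge_measure \<rightarrow>\<^sub>M borel \<Otimes>\<^sub>M borel"
    by (rule measurable_swap_edge)
  have C': "prod.swap -` C \<in> sets (borel \<Otimes>\<^sub>M borel)"
    using measurable_sets[OF swap C] by (simp add: space_edge sets_edge)
  have *: "emeasure edge_measure D = (\<integral>\<^sup>+x. emeasure (m x) {y. (x, y) \<in> D} \<partial>\<nu>)"
    if D: "D \<in> sets (borel \<Otimes>\<^sub>M borel)" for D
  proof -
    have "emeasure edge_measure D = (\<integral>\<^sup>+x. \<integral>\<^sup>+y. indicator D (x, y) \<partial>m x \<partial>\<nu>)"
      using D by (simp add: nn_integral_edge[symmetric] sets_edge)
    also have "\<dots> = (\<integral>\<^sup>+x. emeasure (m x) {y. (x, y) \<in> D} \<partial>\<nu>)"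
    proof (intro nn_integral_cong)
      fix x
      have "{y. (x, y) \<in> D} \<in> sets (m x)"
        using sets_Pair1[OF D, of x] by (simp add: sets_walk vimage_def)
      then show "(\<integral>\<^sup>+y. indicator D (x, y) \<partial>m x) = emeasure (m x) {y. (x, y) \<in> D}"
        by (subst nn_integral_indicator[symmetric]) (auto intro!: nn_integral_cong simp del: nn_integral_indicator split: split_indicator)
    qed
    finally show ?thesis .
  qed
  have "emeasure (distr edge_measure (borel \<Otimes>\<^sub>M borel) prod.swap) C = emeasure edge_measure (prod.swap -` C)"
    by (simp add: emeasure_distr[OF swap C] space_edge)
  also have "\<dots> = (\<integral>\<^sup>+x. emeasure (m x) {y. (y, x) \<in> C} \<partial>\<nu>)"
    by (simp add: *[OF C'])
  also have "\<dots> = (\<integral>\<^sup>+x. emeasure (m x) {y. (x, y) \<in> C} \<partial>\<nu>)"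
    using rev C unfolding reversible_def borel_prod by (metis (no_types, lifting))
  also have "\<dots> = emeasure edge_measure C" by (simp add: *[OF C])
  finally show "emeasure (distr edge_measure (borel \<Otimes>\<^sub>M borel) prod.swap) C = emeasure edge_measure C" .
qed (simp add: sets_edge)

lemma integral_edge_swap:
  fixes h :: "_ \<Rightarrow> real"
  assumes "h \<in> borel_measurable (borel \<Otimes>\<^sub>M borel)"
  shows "(\<integral>z. h z \<partial>edge_measure) = (\<integral>z. h (snd z, fst z) \<partial>edge_measure)"
  using integral_distr[OF measurable_swap_edge assms]
  by (simp add: edge_symmetric prod.swap_def)

lemma integrable_edge_swap:
  fixes h :: "_ \<Rightarrow> real"
  assumes "h \<in> borel_measurable (borel \<Otimes>\<^sub>M borel)"
  shows "integrable edge_measure h \<longleftrightarrow> integrable edge_measure (\<lambda>z. h (snd z, fst z))"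
  using integrable_distr_eq[OF measurable_swap_edge assms]
  by (simp add: edge_symmetric prod.swap_def)

text \<open>
  Tonelli's theorem is applied to the positive and the negative part.  The inner integrals are required to
  exist at every \<open>x\<close>, so that the two parts can be subtracted pointwise.
\<close>

lemma integral_edge:
  fixes h :: "'a \<times> 'a \<Rightarrow> real"
  assumes h: "integrable edge_measure h"
    and inner: "\<And>x. integrable (m x) (\<lambda>y. h (x, y))"
  shows "integrable \<nu> (\<lambda>x. \<integral>y. h (x, y) \<partial>m x)"
    and "(\<integral>z. h z \<partial>edge_measure) = (\<integral>x. (\<integral>y. h (x, y) \<partial>m x) \<partial>\<nu>)"
proof -
  have hm[measurable]: "h \<in> borel_measurable (borel \<Otimes>\<^sub>M borel)"
    using h by (auto simp flip: measurable_edge)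
  have nonneg: "integrable \<nu> (\<lambda>x. \<integral>y. k (x, y) \<partial>m x) \<and>
      (\<integral>z. k z \<partial>edge_measure) = (\<integral>x. (\<integral>y. k (x, y) \<partial>m x) \<partial>\<nu>)"
    if k: "integrable edge_measure k" and k0: "\<And>z. 0 \<le> k z"
      and inner: "\<And>x. integrable (m x) (\<lambda>y. k (x, y))" for k :: "'a \<times> 'a \<Rightarrow> real"
  proof -
    have km[measurable]: "k \<in> borel_measurable (borel \<Otimes>\<^sub>M borel)"
      using k by (auto simp flip: measurable_edge)
    have Im: "(\<lambda>x. \<integral>y. k (x, y) \<partial>m x) \<in> borel_measurable \<nu>"
      unfolding measurable_nu by (rule borel_measurable_walk_integral[OF km])
    have "ennreal (\<integral>z. k z \<partial>edge_measure) = (\<integral>\<^sup>+z. k z \<partial>edge_measure)"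
      by (rule nn_integral_eq_integral[symmetric]) (use k k0 in auto)
    also have "\<dots> = (\<integral>\<^sup>+x. \<integral>\<^sup>+y. k (x, y) \<partial>m x \<partial>\<nu>)" by (rule nn_integral_edge) measurable
    also have "\<dots> = (\<integral>\<^sup>+x. ennreal (\<integral>y. k (x, y) \<partial>m x) \<partial>\<nu>)"
      by (intro nn_integral_cong nn_integral_eq_integral inner) (use k0 in auto)
    finally have eq: "(\<integral>\<^sup>+x. ennreal (\<integral>y. k (x, y) \<partial>m x) \<partial>\<nu>) = ennreal (\<integral>z. k z \<partial>edge_measure)" ..
    have "has_bochner_integral \<nu> (\<lambda>x. \<integral>y. k (x, y) \<partial>m x) (\<integral>z. k z \<partial>edge_measure)"
      by (rule has_bochner_integral_nn_integral[OF Im _ _ eq]) (use k0 in auto)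
    then show ?thesis by (auto simp: has_bochner_integral_iff)
  qed
  let ?p = "\<lambda>z. max 0 (h z)" and ?n = "\<lambda>z. max 0 (- h z)"
  have p: "integrable \<nu> (\<lambda>x. \<integral>y. ?p (x, y) \<partial>m x) \<and>
      (\<integral>z. ?p z \<partial>edge_measure) = (\<integral>x. (\<integral>y. ?p (x, y) \<partial>m x) \<partial>\<nu>)"
    by (rule nonneg) (use h inner in auto)
  have n: "integrable \<nu> (\<lambda>x. \<integral>y. ?n (x, y) \<partial>m x) \<and>
      (\<integral>z. ?n z \<partial>edge_measure) = (\<integral>x. (\<integral>y. ?n (x, y) \<partial>m x) \<partial>\<nu>)"
    by (rule nonneg) (use h inner in auto)
  have split: "h z = ?p z - ?n z" for z by simp
  have inner_eq: "(\<integral>y. h (x, y) \<partial>m x) = (\<integral>y. ?p (x, y) \<partial>m x) - (\<integral>y. ?n (x, y) \<partial>m x)" for x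
    by (subst split, rule Bochner_Integration.integral_diff) (use inner in auto)
  have outer_eq: "(\<integral>z. h z \<partial>edge_measure) = (\<integral>z. ?p z \<partial>edge_measure) - (\<integral>z. ?n z \<partial>edge_measure)"
    by (subst split, rule Bochner_Integration.integral_diff) (use h in auto)
  show "integrable \<nu> (\<lambda>x. \<integral>y. h (x, y) \<partial>m x)"
    unfolding inner_eq using p n by auto
  show "(\<integral>z. h z \<partial>edge_measure) = (\<integral>x. (\<integral>y. h (x, y) \<partial>m x) \<partial>\<nu>)"
    unfolding inner_eq outer_eq using p n by auto
qed

lemma integrable_edge_fst:
  fixes u :: "'a \<Rightarrow> real"
  assumes u: "integrable \<nu> u"
  shows "integrable edge_measure (\<lambda>z. u (fst z))" and "(\<integral>z. \<bar>u (fst z)\<bar> \<partial>edge_measure) = (\<integral>x. \<bar>u x\<bar> \<partial>\<nu>)"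
proof -
  have [measurable]: "u \<in> borel_measurable borel" using u by (auto simp flip: measurable_nu)
  have "(\<integral>\<^sup>+z. ennreal \<bar>u (fst z)\<bar> \<partial>edge_measure) = (\<integral>\<^sup>+x. (\<integral>\<^sup>+y. ennreal \<bar>u x\<bar> \<partial>m x) \<partial>\<nu>)"
    by (subst nn_integral_edge) auto
  also have "\<dots> = (\<integral>\<^sup>+x. ennreal \<bar>u x\<bar> \<partial>\<nu>)"
    using prob_space.emeasure_space_1[OF prob_walk] by simp
  also have "\<dots> = ennreal (\<integral>x. \<bar>u x\<bar> \<partial>\<nu>)"
    by (rule nn_integral_eq_integral) (use u in auto)
  finally have eq: "(\<integral>\<^sup>+z. ennreal \<bar>u (fst z)\<bar> \<partial>edge_measure) = ennreal (\<integral>x. \<bar>u x\<bar> \<partial>\<nu>)" .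
  have "(\<lambda>z. u (fst z)) \<in> borel_measurable edge_measure" unfolding measurable_edge by measurable
  then show int: "integrable edge_measure (\<lambda>z. u (fst z))"
    using eq by (intro integrableI_bounded) auto
  have "ennreal (\<integral>z. \<bar>u (fst z)\<bar> \<partial>edge_measure) = (\<integral>\<^sup>+z. ennreal \<bar>u (fst z)\<bar> \<partial>edge_measure)"
    by (rule nn_integral_eq_integral[symmetric]) (use int in auto)
  then show "(\<integral>z. \<bar>u (fst z)\<bar> \<partial>edge_measure) = (\<integral>x. \<bar>u x\<bar> \<partial>\<nu>)"
    unfolding eq by (subst (asm) ennreal_inj) auto
qed

lemma integrable_edge_snd:
  fixes u :: "'a \<Rightarrow> real"
  assumes u: "integrable \<nu> u"
  shows "integrable edge_measure (\<lambda>z. u (snd z))" and "(\<integral>z. \<bar>u (snd z)\<bar> \<partial>edge_measure) = (\<integral>x. \<bar>u x\<bar> \<partial>\<nu>)"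
proof -
  have [measurable]: "u \<in> borel_measurable borel" using u by (auto simp flip: measurable_nu)
  show "integrable edge_measure (\<lambda>z. u (snd z))"
    using integrable_edge_fst[OF u] by (subst integrable_edge_swap) auto
  show "(\<integral>z. \<bar>u (snd z)\<bar> \<partial>edge_measure) = (\<integral>x. \<bar>u x\<bar> \<partial>\<nu>)"
    using integrable_edge_fst[OF u] by (subst integral_edge_swap) auto
qed

lemma L2_integrable: "u \<in> L2_space \<nu> \<Longrightarrow> integrable \<nu> u"
  by (rule L2_imp_integrable[OF finite_nu])

lemma L2_measurable_borel: "u \<in> L2_space \<nu> \<Longrightarrow> u \<in> borel_measurable borel"
  using L2_spaceD(1)[of u \<nu>] by (simp add: measurable_nu)

lemma integrable_edge_diff:
  fixes u :: "'a \<Rightarrow> real"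
  shows "integrable \<nu> u \<Longrightarrow> integrable edge_measure (\<lambda>z. u (snd z) - u (fst z))"
  using integrable_edge_snd(1)[of u] integrable_edge_fst(1)[of u] by auto

text \<open>
  The total variation as a real number; it agrees with \<open>TV\<close> on integrable functions (\<open>TV_eq_TVr\<close>).
\<close>

definition TVr :: "('a \<Rightarrow> real) \<Rightarrow> real" where
  "TVr u = 1/2 * (\<integral>z. \<bar>u (snd z) - u (fst z)\<bar> \<partial>edge_measure)"

lemma TV_eq_TVr:
  assumes u: "integrable \<nu> u"
  shows "TV m \<nu> u = ennreal (TVr u)"
proof -
  have [measurable]: "u \<in> borel_measurable borel" using u by (auto simp flip: measurable_nu)
  have "(\<integral>\<^sup>+x. (\<integral>\<^sup>+y. ennreal \<bar>u y - u x\<bar> \<partial>m x) \<partial>\<nu>) = (\<integral>\<^sup>+z. ennreal \<bar>u (snd z) - u (fst z)\<bar> \<partial>edge_measure)"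
    by (subst nn_integral_edge) auto
  also have "\<dots> = ennreal (\<integral>z. \<bar>u (snd z) - u (fst z)\<bar> \<partial>edge_measure)"
    by (rule nn_integral_eq_integral) (use integrable_edge_diff[OF u] in auto)
  finally show ?thesis by (simp add: TV_def TVr_def ennreal_mult'[symmetric] del: ennreal_half)
qed

lemma TVr_nonneg: "0 \<le> TVr u"
  by (simp add: TVr_def)

lemma L2_subdifferential_iff:
  "g \<in> L2_subdifferential \<nu> (\<lambda>w. enn2ereal (TV m \<nu> w)) u \<longleftrightarrow>
     g \<in> L2_space \<nu> \<and> u \<in> L2_space \<nu> \<and>
     (\<forall>w\<in>L2_space \<nu>. TVr u + L2_inner \<nu> g (\<lambda>x. w x - u x) \<le> TVr w)"
proof -
  have *: "enn2ereal (TV m \<nu> w) = ereal (TVr w)" if "w \<in> L2_space \<nu>" for w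
    using TV_eq_TVr[OF L2_integrable[OF that]] TVr_nonneg[of w] by (simp add: enn2ereal_ennreal)
  show ?thesis unfolding L2_subdifferential_def mem_Collect_eq by (auto simp only: * plus_ereal.simps ereal_less_eq less_ereal.simps PInfty_neq_ereal ereal_infty_less)
qed

lemma TVr_Lipschitz:
  assumes u: "u \<in> L2_space \<nu>" and w: "w \<in> L2_space \<nu>"
  shows "\<bar>TVr u - TVr w\<bar> \<le> sqrt (measure \<nu> (space \<nu>)) * L2_dist \<nu> u w"
proof -
  have *: "TVr u - TVr w \<le> (\<integral>x. \<bar>u x - w x\<bar> \<partial>\<nu>)" if u: "u \<in> L2_space \<nu>" and w: "w \<in> L2_space \<nu>" for u w
  proof -
    have d: "integrable \<nu> (\<lambda>x. u x - w x)" using u w by (intro L2_integrable L2_diff)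
    note ie = integrable_edge_diff[OF L2_integrable[OF u]] integrable_edge_diff[OF L2_integrable[OF w]]
      integrable_edge_fst[OF d] integrable_edge_snd[OF d]
    have "2 * (TVr u - TVr w) = (\<integral>z. \<bar>u (snd z) - u (fst z)\<bar> - \<bar>w (snd z) - w (fst z)\<bar> \<partial>edge_measure)"
      using ie by (simp add: TVr_def)
    also have "\<dots> \<le> (\<integral>z. \<bar>u (snd z) - w (snd z)\<bar> + \<bar>u (fst z) - w (fst z)\<bar> \<partial>edge_measure)"
      by (rule integral_mono) (use ie in auto)
    also have "\<dots> = 2 * (\<integral>x. \<bar>u x - w x\<bar> \<partial>\<nu>)" using ie by simp
    finally show ?thesis by simp
  qed
  have "\<bar>TVr u - TVr w\<bar> \<le> (\<integral>x. \<bar>u x - w x\<bar> \<partial>\<nu>)"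
    using *[OF u w] *[OF w u] by (simp add: abs_minus_commute)
  also have "\<dots> \<le> sqrt (measure \<nu> (space \<nu>)) * L2_dist \<nu> u w"
    by (rule L1_norm_le_L2_norm[OF finite_nu L2_diff[OF u w]])
  finally show ?thesis .
qed

text \<open>
  Any measurable antisymmetric choice of signs for the differences \<open>u y - u x\<close> would yield a subgradient;
  the choice \<open>sgn 0 = 0\<close> makes it an explicit function of \<open>u\<close>.
\<close>

definition TV_grad :: "('a \<Rightarrow> real) \<Rightarrow> 'a \<Rightarrow> real" where
  "TV_grad u x = - (\<integral>y. sgn (u y - u x) \<partial>m x)"

lemma TV_grad_measurable:
  assumes [measurable]: "u \<in> borel_measurable borel"
  shows "TV_grad u \<in> borel_measurable borel"
proof -
  have "(\<lambda>x. \<integral>y. (\<lambda>z. sgn (u (snd z) - u (fst z))) (x, y) \<partial>m x) \<in> borel_measurable borel"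
    by (rule borel_measurable_walk_integral) measurable
  then show ?thesis unfolding TV_grad_def by simp
qed

lemma abs_sgn_le_1: "\<bar>sgn (a::real)\<bar> \<le> 1"
  by (simp add: sgn_if)

lemma integrable_walk_bounded:
  fixes g :: "'a \<Rightarrow> real"
  assumes "g \<in> borel_measurable borel" "\<And>y. \<bar>g y\<bar> \<le> C"
  shows "integrable (m x) g"
proof -
  interpret prob_space "m x" by (rule prob_walk)
  show ?thesis by (rule integrable_const_bound[where B=C]) (use assms in \<open>auto simp: measurable_walk\<close>)
qed

lemma TV_grad_bounded:
  assumes [measurable]: "u \<in> borel_measurable borel"
  shows "\<bar>TV_grad u x\<bar> \<le> 1"
proof -
  interpret prob_space "m x" by (rule prob_walk)
  have i: "integrable (m x) (\<lambda>y. sgn (u y - u x))"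
    by (rule integrable_walk_bounded[where C=1]) (auto simp: abs_sgn_le_1)
  have "\<bar>\<integral>y. sgn (u y - u x) \<partial>m x\<bar> \<le> (\<integral>y. \<bar>sgn (u y - u x)\<bar> \<partial>m x)" by (rule integral_abs_bound)
  also have "\<dots> \<le> (\<integral>y. 1 \<partial>m x)"
    by (rule integral_mono[OF integrable_abs[OF i]]) (auto simp: abs_sgn_le_1)
  finally show ?thesis by (simp add: TV_grad_def prob_space)
qed

text \<open>
  Integration by parts on the edges: the sign is antisymmetric, so by symmetry of the edge measure the terms
  with \<open>w\<close> at the end and at the start of an edge contribute equally.
\<close>

lemma TV_grad_inner:
  assumes [measurable]: "u \<in> borel_measurable borel" and w: "integrable \<nu> w"
  shows "(\<integral>x. TV_grad u x * w x \<partial>\<nu>)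
    = 1/2 * (\<integral>z. sgn (u (snd z) - u (fst z)) * (w (snd z) - w (fst z)) \<partial>edge_measure)"
proof -
  have [measurable]: "w \<in> borel_measurable borel" using w by (auto simp flip: measurable_nu)
  let ?s = "\<lambda>z. sgn (u (snd z) - u (fst z))"
  have sm: "?s \<in> borel_measurable edge_measure" unfolding measurable_edge by measurable
  have i1: "integrable edge_measure (\<lambda>z. ?s z * w (fst z))"
    by (rule Bochner_Integration.integrable_bound[OF integrable_edge_fst(1)[OF w]])
       (use sm integrable_edge_fst(1)[OF w] in \<open>auto simp: abs_mult intro!: mult_left_le_one_le simp: abs_sgn_le_1\<close>)
  have i2: "integrable edge_measure (\<lambda>z. ?s z * w (snd z))"
    by (rule Bochner_Integration.integrable_bound[OF integrable_edge_snd(1)[OF w]])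
       (use sm integrable_edge_snd(1)[OF w] in \<open>auto simp: abs_mult intro!: mult_left_le_one_le simp: abs_sgn_le_1\<close>)
  have "(\<integral>z. ?s z * w (snd z) \<partial>edge_measure) = (\<integral>z. sgn (u (fst z) - u (snd z)) * w (fst z) \<partial>edge_measure)"
    by (subst integral_edge_swap) auto
  also have "\<dots> = (\<integral>z. - (?s z * w (fst z)) \<partial>edge_measure)"
    by (rule Bochner_Integration.integral_cong) (auto simp: sgn_if)
  finally have anti: "(\<integral>z. ?s z * w (snd z) \<partial>edge_measure) = - (\<integral>z. ?s z * w (fst z) \<partial>edge_measure)" by simp
  have "(\<integral>z. ?s z * (w (snd z) - w (fst z)) \<partial>edge_measure) = - 2 * (\<integral>z. ?s z * w (fst z) \<partial>edge_measure)"
    using i1 i2 anti by (simp add: right_diff_distrib)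
  also have "(\<integral>z. ?s z * w (fst z) \<partial>edge_measure) = (\<integral>x. (\<integral>y. sgn (u y - u x) * w x \<partial>m x) \<partial>\<nu>)"
  proof (subst integral_edge(2)[OF i1])
    fix x show "integrable (m x) (\<lambda>y. ?s (x, y) * w (fst (x, y)))"
      by (simp, intro disjI2 integrable_walk_bounded[where C=1]) (auto simp: abs_sgn_le_1)
  qed simp
  also have "\<dots> = (\<integral>x. - (TV_grad u x * w x) \<partial>\<nu>)"
    by (simp add: TV_grad_def)
  finally show ?thesis by simp
qed

text \<open>
  On every edge, \<open>\<bar>b\<bar> \<ge> \<bar>a\<bar> + sgn a * (b - a)\<close>.
\<close>

lemma TV_grad_subgradient:
  assumes u: "u \<in> L2_space \<nu>" and w: "w \<in> L2_space \<nu>"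
  shows "TVr u + L2_inner \<nu> (TV_grad u) (\<lambda>x. w x - u x) \<le> TVr w"
proof -
  have [measurable]: "u \<in> borel_measurable borel" "w \<in> borel_measurable borel"
    using u w by (auto intro: L2_measurable_borel)
  note iu = integrable_edge_diff[OF L2_integrable[OF u]] and iw = integrable_edge_diff[OF L2_integrable[OF w]]
  have d: "integrable \<nu> (\<lambda>x. w x - u x)" using u w by (intro L2_integrable L2_diff)
  let ?s = "\<lambda>z. sgn (u (snd z) - u (fst z))"
  have sm: "?s \<in> borel_measurable edge_measure" unfolding measurable_edge by measurable
  have i: "integrable edge_measure (\<lambda>z. ?s z * ((w (snd z) - u (snd z)) - (w (fst z) - u (fst z))))"
    by (rule Bochner_Integration.integrable_bound[OF integrable_edge_diff[OF d]])
       (use sm integrable_edge_diff[OF d] in \<open>auto simp: abs_mult intro!: mult_left_le_one_le simp: abs_sgn_le_1\<close>)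
  have "2 * (TVr u + L2_inner \<nu> (TV_grad u) (\<lambda>x. w x - u x))
      = (\<integral>z. \<bar>u (snd z) - u (fst z)\<bar> + ?s z * ((w (snd z) - u (snd z)) - (w (fst z) - u (fst z))) \<partial>edge_measure)"
    unfolding L2_inner_def TV_grad_inner[OF \<open>u \<in> borel_measurable borel\<close> d] TVr_def using iu i by simp
  also have "\<dots> \<le> (\<integral>z. \<bar>w (snd z) - w (fst z)\<bar> \<partial>edge_measure)"
    by (rule integral_mono) (use iu i iw in \<open>auto simp: sgn_if\<close>)
  finally show ?thesis by (simp add: TVr_def)
qed

text \<open>
  If \<open>a\<close> and \<open>b\<close> are the differences of \<open>u\<close> and \<open>w\<close> along an edge, then the difference of \<open>P (u - w)\<close> is
  \<open>\<theta> * (a - b)\<close> for some \<open>0 \<le> \<theta> \<le> 1\<close>.  The new differences \<open>a - \<theta> * (a - b)\<close> and \<open>b + \<theta> * (a - b)\<close> are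
  complementary convex combinations of \<open>a\<close> and \<open>b\<close>.
\<close>

lemma TVr_exchange:
  assumes u: "u \<in> L2_space \<nu>" and w: "w \<in> L2_space \<nu>"
    and P: "1-lipschitz_on UNIV P" and mono: "mono P"
  shows "TVr (\<lambda>x. u x - P (u x - w x)) + TVr (\<lambda>x. w x + P (u x - w x)) \<le> TVr u + TVr w"
proof -
  have p: "(\<lambda>x. P (u x - w x)) \<in> L2_space \<nu>" by (rule Lipschitz_L2[OF finite_nu L2_diff[OF u w] P])
  note ii = integrable_edge_diff[OF L2_integrable[OF u]] integrable_edge_diff[OF L2_integrable[OF w]]
    integrable_edge_diff[OF L2_integrable[OF L2_diff[OF u p]]] integrable_edge_diff[OF L2_integrable[OF L2_add[OF w p]]]
  have key: "\<bar>(a - P (a - b)) - (a' - P (a' - b'))\<bar> + \<bar>(b + P (a - b)) - (b' + P (a' - b'))\<bar> \<le> \<bar>a - a'\<bar> + \<bar>b - b'\<bar>"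
    for a b a' b' :: real
  proof -
    have "\<bar>P (a - b) - P (a' - b')\<bar> \<le> \<bar>(a - b) - (a' - b')\<bar>"
      using lipschitz_onD[OF P, of "a - b" "a' - b'"] by (simp add: dist_real_def)
    then show ?thesis
      using monoD[OF mono, of "a - b" "a' - b'"] monoD[OF mono, of "a' - b'" "a - b"] by linarith
  qed
  have "2 * (TVr (\<lambda>x. u x - P (u x - w x)) + TVr (\<lambda>x. w x + P (u x - w x)))
     = (\<integral>z. \<bar>(u (snd z) - P (u (snd z) - w (snd z))) - (u (fst z) - P (u (fst z) - w (fst z)))\<bar>
            + \<bar>(w (snd z) + P (u (snd z) - w (snd z))) - (w (fst z) + P (u (fst z) - w (fst z)))\<bar> \<partial>edge_measure)"
    using ii by (simp add: TVr_def)
  also have "\<dots> \<le> (\<integral>z. \<bar>u (snd z) - u (fst z)\<bar> + \<bar>w (snd z) - w (fst z)\<bar> \<partial>edge_measure)"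
    by (rule integral_mono) (use ii key in auto)
  also have "\<dots> = 2 * (TVr u + TVr w)" using ii by (simp add: TVr_def)
  finally show ?thesis by simp
qed

text \<open>
  The two subgradient inequalities are tested with the pair of functions from \<open>TVr_exchange\<close> and added.
\<close>

lemma subdifferential_TV_completely_accretive:
  assumes g: "g \<in> L2_subdifferential \<nu> (\<lambda>w. enn2ereal (TV m \<nu> w)) u"
    and h: "h \<in> L2_subdifferential \<nu> (\<lambda>w. enn2ereal (TV m \<nu> w)) w"
    and P: "1-lipschitz_on UNIV P" and mono: "mono P"
  shows "0 \<le> L2_inner \<nu> (\<lambda>x. g x - h x) (\<lambda>x. P (u x - w x))"
proof -
  have L: "g \<in> L2_space \<nu>" "u \<in> L2_space \<nu>" "h \<in> L2_space \<nu>" "w \<in> L2_space \<nu>"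
    using g h by (auto simp: L2_subdifferential_iff)
  have p: "(\<lambda>x. P (u x - w x)) \<in> L2_space \<nu>" by (rule Lipschitz_L2[OF finite_nu L2_diff[OF L(2,4)] P])
  have "TVr u + L2_inner \<nu> g (\<lambda>x. (u x - P (u x - w x)) - u x) \<le> TVr (\<lambda>x. u x - P (u x - w x))"
    using g L2_diff[OF L(2) p] by (auto simp: L2_subdifferential_iff)
  moreover have "TVr w + L2_inner \<nu> h (\<lambda>x. (w x + P (u x - w x)) - w x) \<le> TVr (\<lambda>x. w x + P (u x - w x))"
    using h L2_add[OF L(4) p] by (auto simp: L2_subdifferential_iff)
  moreover have "L2_inner \<nu> g (\<lambda>x. (u x - P (u x - w x)) - u x) = - L2_inner \<nu> g (\<lambda>x. P (u x - w x))"
    by (simp add: L2_inner_def)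
  ultimately have "0 \<le> L2_inner \<nu> g (\<lambda>x. P (u x - w x)) - L2_inner \<nu> h (\<lambda>x. P (u x - w x))"
    using TVr_exchange[OF L(2,4) P mono] by simp
  then show ?thesis using L2_inner_diff_left[OF L(1,3) p] by simp
qed

end

section \<open>Integration of square integrable functions over time\<close>

lemma (in complete_measure) borel_measurable_AE_limit:
  fixes h :: "'a \<Rightarrow> real"
  assumes H: "\<And>n::nat. H n \<in> borel_measurable M" and lim: "AE t in M. (\<lambda>n. H n t) \<longlonglongrightarrow> h t"
  shows "h \<in> borel_measurable M"
proof (rule measurableI)
  fix A :: "real set" assume A: "A \<in> sets borel"
  let ?k = "\<lambda>t. lim (\<lambda>n. H n t)"
  have "?k \<in> borel_measurable M" using H by measurable
  then have "?k -` A \<inter> space M \<in> sets M" using A by (rule measurable_sets)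
  then show "h -` A \<inter> space M \<in> sets M"
  proof (rule in_sets_AE[rotated])
    show "AE t in M. t \<in> ?k -` A \<inter> space M \<longleftrightarrow> t \<in> h -` A \<inter> space M"
      using lim by eventually_elim (auto dest: limI)
  qed auto
qed simp

locale L2_valued =
  fixes M :: "'t measure" and N :: "'a measure"
  assumes finite_M: "finite_measure M" and complete_M: "complete_measure M"
    and finite_N: "finite_measure N"
begin

sublocale M: finite_measure M by (rule finite_M)
sublocale N: finite_measure N by (rule finite_N)
sublocale pair_sigma_finite M N ..
sublocale P: finite_measure "M \<Otimes>\<^sub>M N"
proof
  have "emeasure (M \<Otimes>\<^sub>M N) (space M \<times> space N) = emeasure M (space M) * emeasure N (space N)"
    by (rule N.emeasure_pair_measure_Times) auto
  then show "emeasure (M \<Otimes>\<^sub>M N) (space (M \<Otimes>\<^sub>M N)) \<noteq> \<infinity>"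
    using M.emeasure_finite N.emeasure_finite by (simp add: space_pair_measure ennreal_mult_eq_top_iff)
qed

lemma nn_integral_const_finite: "(\<integral>\<^sup>+t. ennreal K \<partial>M) < \<infinity>"
  using M.emeasure_finite[of "space M"] by (auto simp: ennreal_mult_eq_top_iff simp flip: top.not_eq_extremum)

lemma L2_simpleI:
  assumes "simple_function M s" "\<And>t. t \<in> space M \<Longrightarrow> s t \<in> L2_space N"
  shows "L2_simple M N s"
  using assms M.emeasure_finite by (auto simp: L2_simple_def)

lemma L2_simpleD:
  assumes "L2_simple M N s"
  shows "simple_function M s" "\<And>t. t \<in> space M \<Longrightarrow> s t \<in> L2_space N"
  using assms by (auto simp: L2_simple_def)

lemma L2_simple_lincomb:
  assumes "L2_simple M N s" "L2_simple M N r" "simple_function M a" "simple_function M b"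
  shows "L2_simple M N (\<lambda>t x. a t * s t x + b t * r t x)"
proof (rule L2_simpleI)
  have "simple_function M (\<lambda>t. (\<lambda>p q x. fst p * snd p x + fst q * snd q x) (a t, s t) (b t, r t))"
    by (rule simple_function_compose2[OF simple_function_Pair[OF assms(3) L2_simpleD(1)[OF assms(1)]]
          simple_function_Pair[OF assms(4) L2_simpleD(1)[OF assms(2)]]])
  then show "simple_function M (\<lambda>t x. a t * s t x + b t * r t x)" by simp
  show "(\<lambda>x. a t * s t x + b t * r t x) \<in> L2_space N" if "t \<in> space M" for t
    by (intro L2_add L2_scale L2_simpleD(2)[OF _ that] assms)
qed

lemma L2_simple_diff:
  assumes "L2_simple M N s" "L2_simple M N r"
  shows "L2_simple M N (\<lambda>t x. s t x - r t x)"
  using L2_simple_lincomb[OF assms, of "\<lambda>_. 1" "\<lambda>_. -1"] by simp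

lemma L2_simple_scale:
  assumes "L2_simple M N s" "simple_function M a"
  shows "L2_simple M N (\<lambda>t x. a t * s t x)"
  using L2_simple_lincomb[OF assms(1,1,2), of "\<lambda>_. 0"] by simp

lemma L2_simple_functional:
  assumes "L2_simple M N s" shows "(\<lambda>t. \<Phi> (s t) :: real) \<in> borel_measurable M"
  using simple_function_compose1[OF L2_simpleD(1)[OF assms], of \<Phi>] by (rule borel_measurable_simple_function)

lemma L2_simple_jointly_measurable:
  assumes s: "L2_simple M N s" shows "case_prod s \<in> borel_measurable (M \<Otimes>\<^sub>M N)"
proof -
  note sf = L2_simpleD(1)[OF s]
  have *: "case_prod s z = (\<Sum>c\<in>s ` space M. indicator (s -` {c} \<inter> space M) (fst z) * c (snd z))"
    if "z \<in> space (M \<Otimes>\<^sub>M N)" for z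
  proof -
    have "fst z \<in> space M" using that by (auto simp: space_pair_measure)
    then have "(\<Sum>c\<in>s ` space M. indicator (s -` {c} \<inter> space M) (fst z) * c (snd z))
      = (\<Sum>c\<in>s ` space M. if c = s (fst z) then c (snd z) else 0)"
      by (intro sum.cong) (auto simp: indicator_def)
    also have "\<dots> = s (fst z) (snd z)" using \<open>fst z \<in> space M\<close> simple_functionD(1)[OF sf] by simp
    finally show ?thesis by (simp add: case_prod_beta)
  qed
  have [measurable]: "c \<in> borel_measurable N" if "c \<in> s ` space M" for c
    using that L2_simpleD(2)[OF s] by (auto dest: L2_spaceD)
  have [measurable]: "s -` {c} \<inter> space M \<in> sets M" for c by (rule simple_functionD(2)[OF sf])
  show ?thesis
    by (subst measurable_cong[OF *]) (auto intro!: borel_measurable_sum borel_measurable_times)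
qed

lemma L2_strongly_measurableD:
  assumes "L2_strongly_measurable M N g"
  shows "\<And>t. t \<in> space M \<Longrightarrow> g t \<in> L2_space N"
    and "\<exists>s. (\<forall>n::nat. L2_simple M N (s n)) \<and> (AE t in M. (\<lambda>n. L2_dist N (g t) (s n t)) \<longlonglongrightarrow> 0)"
  using assms by (auto simp: L2_strongly_measurable_def)

lemma L2_strongly_measurable_simple: "L2_simple M N s \<Longrightarrow> L2_strongly_measurable M N s"
  unfolding L2_strongly_measurable_def
  by (auto dest: L2_simpleD intro!: exI[of _ "\<lambda>_::nat. s"] simp: L2_norm_zero)

lemma L2_strongly_measurable_diff:
  assumes g: "L2_strongly_measurable M N g" and h: "L2_strongly_measurable M N h"
  shows "L2_strongly_measurable M N (\<lambda>t x. g t x - h t x)"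
proof -
  obtain s r where s: "\<And>n::nat. L2_simple M N (s n)" "AE t in M. (\<lambda>n. L2_dist N (g t) (s n t)) \<longlonglongrightarrow> 0"
    and r: "\<And>n::nat. L2_simple M N (r n)" "AE t in M. (\<lambda>n. L2_dist N (h t) (r n t)) \<longlonglongrightarrow> 0"
    using L2_strongly_measurableD(2)[OF g] L2_strongly_measurableD(2)[OF h] by auto
  have "AE t in M. (\<lambda>n. L2_norm N (\<lambda>x. (g t x - h t x) - (s n t x - r n t x))) \<longlonglongrightarrow> 0"
    using s(2) r(2) AE_space
  proof eventually_elim
    case (elim t)
    have L: "(\<lambda>x. g t x - s n t x) \<in> L2_space N" "(\<lambda>x. h t x - r n t x) \<in> L2_space N" for n
      using elim L2_simpleD(2)[OF s(1)] L2_simpleD(2)[OF r(1)]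
        L2_strongly_measurableD(1)[OF g] L2_strongly_measurableD(1)[OF h] by (auto intro: L2_diff)
    show ?case
    proof (rule tendsto_sandwich[OF _ _ tendsto_const])
      show "(\<lambda>n. L2_dist N (g t) (s n t) + L2_dist N (h t) (r n t)) \<longlonglongrightarrow> 0"
        using tendsto_add[OF elim(1,2)] by simp
      show "\<forall>\<^sub>F n in sequentially. L2_norm N (\<lambda>x. (g t x - h t x) - (s n t x - r n t x))
          \<le> L2_dist N (g t) (s n t) + L2_dist N (h t) (r n t)"
      proof (intro always_eventually allI)
        fix n
        have "(\<lambda>x. (g t x - s n t x) + - (h t x - r n t x)) = (\<lambda>x. (g t x - h t x) - (s n t x - r n t x))"
          by (simp add: fun_eq_iff)
        then show "L2_norm N (\<lambda>x. (g t x - h t x) - (s n t x - r n t x))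
          \<le> L2_dist N (g t) (s n t) + L2_dist N (h t) (r n t)"
          using L2_norm_triangle[OF L(1)[of n] L2_minus[OF L(2)[of n]]]
          by (simp only: L2_norm_minus)
      qed
    qed (auto simp: L2_norm_nonneg)
  qed
  then show ?thesis
    unfolding L2_strongly_measurable_def
    using L2_strongly_measurableD(1)[OF g] L2_strongly_measurableD(1)[OF h] s(1) r(1)
    by (intro conjI ballI L2_diff exI[of _ "\<lambda>n t x. s n t x - r n t x"] allI L2_simple_diff) blast+
qed

lemma L2_strongly_measurable_cmult:
  assumes g: "L2_strongly_measurable M N g" and \<phi>: "\<phi> \<in> borel_measurable M"
  shows "L2_strongly_measurable M N (\<lambda>t x. \<phi> t * g t x :: real)"
proof -
  obtain s where s: "\<And>n::nat. L2_simple M N (s n)" "AE t in M. (\<lambda>n. L2_dist N (g t) (s n t)) \<longlonglongrightarrow> 0"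
    using L2_strongly_measurableD(2)[OF g] by auto
  obtain a where a: "\<And>i. simple_function M (a i)" "\<And>t. t \<in> space M \<Longrightarrow> (\<lambda>i. a i t) \<longlonglongrightarrow> \<phi> t"
    using borel_measurable_implies_sequence_metric[OF \<phi>, of 0] by blast
  have "AE t in M. (\<lambda>n. L2_norm N (\<lambda>x. \<phi> t * g t x - a n t * s n t x)) \<longlonglongrightarrow> 0"
    using s(2) AE_space
  proof eventually_elim
    case (elim t)
    have gt: "g t \<in> L2_space N" and st: "\<And>n. s n t \<in> L2_space N"
      using elim L2_simpleD(2)[OF s(1)] L2_strongly_measurableD(1)[OF g] by auto
    have at: "(\<lambda>n. a n t) \<longlonglongrightarrow> \<phi> t" using a(2) elim by simp
    show ?case
    proof (rule tendsto_sandwich[OF _ _ tendsto_const])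
      have "(\<lambda>n. \<bar>\<phi> t - a n t\<bar> * L2_norm N (g t) + \<bar>a n t\<bar> * L2_dist N (g t) (s n t)) \<longlonglongrightarrow> \<bar>\<phi> t - \<phi> t\<bar> * L2_norm N (g t) + \<bar>\<phi> t\<bar> * 0"
        by (intro tendsto_intros at elim(1))
      then show "(\<lambda>n. \<bar>\<phi> t - a n t\<bar> * L2_norm N (g t) + \<bar>a n t\<bar> * L2_dist N (g t) (s n t)) \<longlonglongrightarrow> 0"
        by simp
      have "L2_norm N (\<lambda>x. \<phi> t * g t x - a n t * s n t x)
          \<le> \<bar>\<phi> t - a n t\<bar> * L2_norm N (g t) + \<bar>a n t\<bar> * L2_dist N (g t) (s n t)" for n
      proof -
        have "L2_norm N (\<lambda>x. \<phi> t * g t x - a n t * s n t x)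
            = L2_norm N (\<lambda>x. (\<phi> t - a n t) * g t x + a n t * (g t x - s n t x))"
          by (simp add: algebra_simps)
        also have "\<dots> \<le> L2_norm N (\<lambda>x. (\<phi> t - a n t) * g t x) + L2_norm N (\<lambda>x. a n t * (g t x - s n t x))"
          by (intro L2_norm_triangle L2_scale L2_diff gt st)
        finally show ?thesis by (simp add: L2_norm_scale)
      qed
      then show "\<forall>\<^sub>F n in sequentially. L2_norm N (\<lambda>x. \<phi> t * g t x - a n t * s n t x)
          \<le> \<bar>\<phi> t - a n t\<bar> * L2_norm N (g t) + \<bar>a n t\<bar> * L2_dist N (g t) (s n t)" by simp
    qed (auto simp: L2_norm_nonneg)
  qed
  then show ?thesis
    unfolding L2_strongly_measurable_def
    using L2_strongly_measurableD(1)[OF g] s(1) a(1)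
    by (intro conjI ballI L2_scale exI[of _ "\<lambda>n t x. a n t * s n t x"] allI L2_simple_scale) blast+
qed

text \<open>
  The composition of a functional with a simple function is simple, and by completeness of \<open>M\<close> a limit
  which exists almost everywhere is measurable.
\<close>

lemma L2_functional_measurable:
  assumes g: "L2_strongly_measurable M N g"
    and \<Phi>: "\<And>(F :: nat \<Rightarrow> 'a \<Rightarrow> real) h. (\<lambda>n. L2_dist N (F n) h) \<longlonglongrightarrow> 0 \<Longrightarrow> (\<And>n. F n \<in> L2_space N) \<Longrightarrow>
      h \<in> L2_space N \<Longrightarrow> (\<lambda>n. \<Phi> (F n)) \<longlonglongrightarrow> (\<Phi> h :: real)"
  shows "(\<lambda>t. \<Phi> (g t)) \<in> borel_measurable M"
proof -
  obtain s where s: "\<And>n::nat. L2_simple M N (s n)" "AE t in M. (\<lambda>n. L2_dist N (g t) (s n t)) \<longlonglongrightarrow> 0"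
    using L2_strongly_measurableD(2)[OF g] by auto
  show ?thesis
  proof (rule complete_measure.borel_measurable_AE_limit[OF complete_M])
    show "(\<lambda>t. \<Phi> (s n t)) \<in> borel_measurable M" for n by (rule L2_simple_functional[OF s(1)])
    show "AE t in M. (\<lambda>n. \<Phi> (s n t)) \<longlonglongrightarrow> \<Phi> (g t)"
      using s(2) AE_space
    proof eventually_elim
      case (elim t)
      then show ?case
        by (intro \<Phi> L2_simpleD(2)[OF s(1)] L2_strongly_measurableD(1)[OF g]) (simp_all only: L2_norm_minus_commute[of N "g t"])
    qed
  qed
qed

lemma L2_norm_measurable:
  "L2_strongly_measurable M N g \<Longrightarrow> (\<lambda>t. L2_norm N (g t)) \<in> borel_measurable M"
  by (rule L2_functional_measurable) (auto intro: L2_norm_tendsto)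

lemma L2_inner_measurable:
  "L2_strongly_measurable M N g \<Longrightarrow> w \<in> L2_space N \<Longrightarrow> (\<lambda>t. L2_inner N (g t) w) \<in> borel_measurable M"
  by (rule L2_functional_measurable) (auto intro: L2_inner_tendsto)

lemma L2_simple_integral_functional:
  assumes s: "L2_simple M N s"
  shows "integrable M (\<lambda>t. \<Phi> (s t) :: real)"
    and "(\<integral>t. \<Phi> (s t) \<partial>M) = (\<Sum>c\<in>s ` space M. measure M {t \<in> space M. s t = c} * \<Phi> c)"
proof -
  note sf = L2_simpleD(1)[OF s]
  let ?A = "\<lambda>c. {t \<in> space M. s t = c}"
  have eq: "\<Phi> (s t) = (\<Sum>c\<in>s ` space M. indicator (?A c) t * \<Phi> c)" if "t \<in> space M" for t
  proof -
    have "(\<Sum>c\<in>s ` space M. indicator (?A c) t * \<Phi> c) = (\<Sum>c\<in>s ` space M. if c = s t then \<Phi> c else 0)"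
      using that by (intro sum.cong) (auto simp: indicator_def)
    then show ?thesis using that simple_functionD(1)[OF sf] by simp
  qed
  have meas: "?A c \<in> sets M" for c
  proof -
    have "?A c = s -` {c} \<inter> space M" by auto
    then show ?thesis using simple_functionD(2)[OF sf, of "{c}"] by simp
  qed
  have measI: "(\<integral>t. indicator (?A c) t * b \<partial>M) = measure M (?A c) * b" for c and b :: real
    using meas[of c] by (simp add: Int_def conj_ac)
  have int: "integrable M (\<lambda>t. indicator (?A c) t * \<Phi> c)" for c
    by (rule integrable_mult_left) (intro impI integrable_real_indicator meas, simp add: M.emeasure_finite flip: top.not_eq_extremum)
  show "integrable M (\<lambda>t. \<Phi> (s t))"
    by (subst Bochner_Integration.integrable_cong[OF refl eq]) (auto intro: int)
  show "(\<integral>t. \<Phi> (s t) \<partial>M) = (\<Sum>c\<in>s ` space M. measure M (?A c) * \<Phi> c)"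
    by (subst Bochner_Integration.integral_cong[OF refl eq], simp, subst Bochner_Integration.integral_sum, rule int)
       (simp only: measI)
qed

lemma L2_simple_integral_inner:
  assumes s: "L2_simple M N s" and w: "w \<in> L2_space N"
  shows "(\<integral>t. L2_inner N (s t) w \<partial>M) = L2_inner N (L2_simple_integral M s) w"
proof -
  have "(\<integral>t. L2_inner N (s t) w \<partial>M) = (\<Sum>c\<in>s ` space M. measure M {t \<in> space M. s t = c} * L2_inner N c w)"
    by (rule L2_simple_integral_functional(2)[OF s])
  also have "\<dots> = (\<integral>x. (\<Sum>c\<in>s ` space M. measure M {t \<in> space M. s t = c} * (c x * w x)) \<partial>N)"
    using L2_simpleD(2)[OF s] w
    by (subst Bochner_Integration.integral_sum) (auto intro: L2_integrable_mult simp: L2_inner_def)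
  also have "\<dots> = L2_inner N (L2_simple_integral M s) w"
    by (simp add: L2_inner_def L2_simple_integral_def sum_distrib_right mult.assoc)
  finally show ?thesis .
qed

lemma L2_simple_integral_L2:
  assumes s: "L2_simple M N s"
  shows "L2_simple_integral M s \<in> L2_space N"
  unfolding L2_simple_integral_def using L2_simpleD(2)[OF s] by (intro L2_sum L2_scale) auto

lemma L2_simple_integral_eq:
  assumes s: "L2_simple M N s"
  shows "L2_simple_integral M s x = (\<integral>t. s t x \<partial>M)"
  unfolding L2_simple_integral_def by (rule L2_simple_integral_functional(2)[OF s, symmetric])

text \<open>
  Pairing with a fixed \<open>w\<close> turns the convergence of the simple functions that defines the Bochner integral
  into convergence in \<open>L\<^sup>1\<close> of scalar functions; the identity is passed to the limit from simple functions.
\<close>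

lemma has_L2_integral_inner:
  assumes g: "has_L2_integral M N g I" and w: "w \<in> L2_space N"
  shows "integrable M (\<lambda>t. L2_inner N (g t) w)" and "(\<integral>t. L2_inner N (g t) w \<partial>M) = L2_inner N I w"
proof -
  have sm: "L2_strongly_measurable M N g" and I: "I \<in> L2_space N"
    using g by (auto simp: has_L2_integral_def)
  obtain s where s: "\<And>n::nat. L2_simple M N (s n)"
    and lim: "(\<lambda>n. \<integral>\<^sup>+t. ennreal (L2_dist N (g t) (s n t)) \<partial>M) \<longlonglongrightarrow> 0"
    and limI: "(\<lambda>n. L2_dist N (L2_simple_integral M (s n)) I) \<longlonglongrightarrow> 0"
    using g by (auto simp: has_L2_integral_def)
  have bound: "(\<integral>\<^sup>+t. ennreal \<bar>L2_inner N (s n t) w - L2_inner N (g t) w\<bar> \<partial>M)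
      \<le> (\<integral>\<^sup>+t. ennreal (L2_dist N (g t) (s n t)) \<partial>M) * ennreal (L2_norm N w)" for n
  proof -
    have "(\<integral>\<^sup>+t. ennreal \<bar>L2_inner N (s n t) w - L2_inner N (g t) w\<bar> \<partial>M)
        \<le> (\<integral>\<^sup>+t. ennreal (L2_dist N (g t) (s n t)) * ennreal (L2_norm N w) \<partial>M)"
    proof (rule nn_integral_mono)
      fix t assume t: "t \<in> space M"
      have L: "s n t \<in> L2_space N" "g t \<in> L2_space N"
        using L2_simpleD(2)[OF s t] L2_strongly_measurableD(1)[OF sm t] by auto
      have "\<bar>L2_inner N (s n t) w - L2_inner N (g t) w\<bar> \<le> L2_dist N (g t) (s n t) * L2_norm N w"
        using L2_inner_le[OF L2_diff[OF L] w] by (simp add: L2_inner_diff_left[OF L w] L2_norm_minus_commute[of N "g t"])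
      then show "ennreal \<bar>L2_inner N (s n t) w - L2_inner N (g t) w\<bar>
          \<le> ennreal (L2_dist N (g t) (s n t)) * ennreal (L2_norm N w)"
        by (simp add: ennreal_mult[symmetric] L2_norm_nonneg ennreal_leI)
    qed
    also have "\<dots> = (\<integral>\<^sup>+t. ennreal (L2_dist N (g t) (s n t)) \<partial>M) * ennreal (L2_norm N w)"
      by (intro nn_integral_multc measurable_compose[OF _ measurable_ennreal] L2_norm_measurable
          L2_strongly_measurable_diff sm L2_strongly_measurable_simple s)
    finally show ?thesis .
  qed
  have lim0: "(\<lambda>n. \<integral>\<^sup>+t. ennreal \<bar>L2_inner N (s n t) w - L2_inner N (g t) w\<bar> \<partial>M) \<longlonglongrightarrow> 0"
  proof (rule tendsto_sandwich[OF _ _ tendsto_const])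
    show "(\<lambda>n. (\<integral>\<^sup>+t. ennreal (L2_dist N (g t) (s n t)) \<partial>M) * ennreal (L2_norm N w)) \<longlonglongrightarrow> 0"
      using ennreal_tendsto_cmult[OF _ lim, of "ennreal (L2_norm N w)"] by (simp add: mult.commute)
  qed (use bound in auto)
  then have "\<forall>\<^sub>F n in sequentially. (\<integral>\<^sup>+t. ennreal \<bar>L2_inner N (s n t) w - L2_inner N (g t) w\<bar> \<partial>M) < 1"
    by (rule order_tendstoD) simp
  then obtain n where n: "(\<integral>\<^sup>+t. ennreal \<bar>L2_inner N (s n t) w - L2_inner N (g t) w\<bar> \<partial>M) < 1"
    by (auto simp: eventually_sequentially)
  have gm: "(\<lambda>t. L2_inner N (g t) w) \<in> borel_measurable M" by (rule L2_inner_measurable[OF sm w])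
  have sm': "(\<lambda>t. L2_inner N (s n t) w) \<in> borel_measurable M" for n by (rule L2_simple_functional[OF s])
  have "integrable M (\<lambda>t. L2_inner N (s n t) w - L2_inner N (g t) w)"
    by (rule integrableI_bounded) (use gm sm' n in \<open>auto intro: less_trans\<close>)
  then have "integrable M (\<lambda>t. L2_inner N (s n t) w - (L2_inner N (s n t) w - L2_inner N (g t) w))"
    by (rule Bochner_Integration.integrable_diff[OF L2_simple_integral_functional(1)[OF s]])
  then show int: "integrable M (\<lambda>t. L2_inner N (g t) w)" by simp
  have "(\<lambda>n. \<integral>t. L2_inner N (s n t) w \<partial>M) \<longlonglongrightarrow> (\<integral>t. L2_inner N (g t) w \<partial>M)"
    by (rule tendsto_L1_int[OF L2_simple_integral_functional(1)[OF s] int]) (use lim0 in simp)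
  moreover have "(\<lambda>n. \<integral>t. L2_inner N (s n t) w \<partial>M) \<longlonglongrightarrow> L2_inner N I w"
    unfolding L2_simple_integral_inner[OF s w]
    by (rule L2_inner_tendsto[OF limI _ I w]) (simp add: L2_simple_integral_L2[OF s])
  ultimately show "(\<integral>t. L2_inner N (g t) w \<partial>M) = L2_inner N I w" by (rule LIMSEQ_unique)
qed

lemma nn_integral_L2_norm_sq:
  assumes D: "case_prod D \<in> borel_measurable (M \<Otimes>\<^sub>M N)" and L: "\<And>t. t \<in> space M \<Longrightarrow> D t \<in> L2_space N"
  shows "(\<integral>\<^sup>+t. ennreal ((L2_norm N (D t))\<^sup>2) \<partial>M) = (\<integral>\<^sup>+z. ennreal ((case_prod D z)\<^sup>2) \<partial>(M \<Otimes>\<^sub>M N))"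
proof -
  have "(\<integral>\<^sup>+z. ennreal ((case_prod D z)\<^sup>2) \<partial>(M \<Otimes>\<^sub>M N)) = (\<integral>\<^sup>+t. \<integral>\<^sup>+x. ennreal ((D t x)\<^sup>2) \<partial>N \<partial>M)"
    using D by (subst N.nn_integral_fst[symmetric]) auto
  also have "\<dots> = (\<integral>\<^sup>+t. ennreal ((L2_norm N (D t))\<^sup>2) \<partial>M)"
    by (intro nn_integral_cong) (simp add: L2_norm_ennreal L)
  finally show ?thesis ..
qed

text \<open>
  The Cauchy-Schwarz inequality in time is applied on almost every section and then integrated in space.
\<close>

lemma time_integral_L2:
  assumes D: "case_prod D \<in> L2_space (M \<Otimes>\<^sub>M N)"
  shows "(\<lambda>x. \<integral>t. D t x \<partial>M) \<in> L2_space N"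
    and "L2_norm N (\<lambda>x. \<integral>t. D t x \<partial>M) \<le> sqrt (measure M (space M)) * L2_norm (M \<Otimes>\<^sub>M N) (case_prod D)"
proof -
  have Dm[measurable]: "case_prod D \<in> borel_measurable (M \<Otimes>\<^sub>M N)" using D by (auto dest: L2_spaceD)
  have int: "integrable (M \<Otimes>\<^sub>M N) (case_prod (\<lambda>t x. (D t x)\<^sup>2))"
    using L2_spaceD(2)[OF D] by (simp add: case_prod_unfold)
  have Jm: "(\<lambda>x. \<integral>t. D t x \<partial>M) \<in> borel_measurable N"
    by (rule M.borel_measurable_lebesgue_integral) measurable
  let ?c = "measure M (space M)"
  have bound: "AE x in N. (\<integral>t. D t x \<partial>M)\<^sup>2 \<le> ?c * (\<integral>t. (D t x)\<^sup>2 \<partial>M)"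
    using AE_integrable_snd[OF int] AE_space
  proof eventually_elim
    case (elim x)
    have "(\<lambda>t. D t x) \<in> L2_space M"
      using elim measurable_Pair1[OF Dm elim(2)] by (simp add: L2_space_def)
    note L1 = L1_norm_le_L2_norm[OF finite_M this]
    have "\<bar>\<integral>t. D t x \<partial>M\<bar> \<le> (\<integral>t. \<bar>D t x\<bar> \<partial>M)" by (rule integral_abs_bound)
    also note L1
    finally have "\<bar>\<integral>t. D t x \<partial>M\<bar>\<^sup>2 \<le> (sqrt ?c * L2_norm M (\<lambda>t. D t x))\<^sup>2"
      by (rule power_mono) simp
    then show ?case by (simp add: power_mult_distrib L2_norm_sq)
  qed
  have int2: "integrable N (\<lambda>x. ?c * (\<integral>t. (D t x)\<^sup>2 \<partial>M))"
    using integrable_snd[OF int] by simp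
  have "integrable N (\<lambda>x. (\<integral>t. D t x \<partial>M)\<^sup>2)"
    by (rule Bochner_Integration.integrable_bound[OF int2]) (use Jm bound in auto)
  then show L: "(\<lambda>x. \<integral>t. D t x \<partial>M) \<in> L2_space N" using Jm by (simp add: L2_space_def)
  have "(L2_norm N (\<lambda>x. \<integral>t. D t x \<partial>M))\<^sup>2 \<le> (\<integral>x. ?c * (\<integral>t. (D t x)\<^sup>2 \<partial>M) \<partial>N)"
    unfolding L2_norm_sq by (rule integral_mono_AE[OF L2_spaceD(2)[OF L] int2 bound])
  also have "\<dots> = ?c * (L2_norm (M \<Otimes>\<^sub>M N) (case_prod D))\<^sup>2"
    using integral_snd[OF int] by (simp add: L2_norm_sq case_prod_unfold)
  also have "\<dots> = (sqrt ?c * L2_norm (M \<Otimes>\<^sub>M N) (case_prod D))\<^sup>2" by (simp add: power_mult_distrib)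
  finally show "L2_norm N (\<lambda>x. \<integral>t. D t x \<partial>M) \<le> sqrt ?c * L2_norm (M \<Otimes>\<^sub>M N) (case_prod D)"
    by (rule power2_le_imp_le) (simp add: L2_norm_nonneg)
qed

text \<open>
  The simple functions which approximate \<open>G\<close> are truncated at a bound for the norm of \<open>G\<close>.  Dominated
  convergence in time then applies to the norms of the differences and to their squares; the latter
  control the pointwise integrals through \<open>time_integral_L2\<close>.
\<close>

lemma has_L2_integral_pointwise:
  assumes sm: "L2_strongly_measurable M N G"
    and joint: "case_prod G \<in> borel_measurable (M \<Otimes>\<^sub>M N)"
    and bound: "\<And>t. t \<in> space M \<Longrightarrow> L2_norm N (G t) \<le> C"
  shows "has_L2_integral M N G (\<lambda>x. \<integral>t. G t x \<partial>M)"
proof -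
  obtain s where s: "\<And>n::nat. L2_simple M N (s n)" "AE t in M. (\<lambda>n. L2_dist N (G t) (s n t)) \<longlonglongrightarrow> 0"
    using L2_strongly_measurableD(2)[OF sm] by auto
  have GL: "\<And>t. t \<in> space M \<Longrightarrow> G t \<in> L2_space N" by (rule L2_strongly_measurableD(1)[OF sm])
  \<comment> \<open>The margin \<open>1\<close> leaves the approximating values eventually untouched by the truncation.\<close>
  define B where "B = \<bar>C\<bar> + 1"
  have GB: "L2_norm N (G t) \<le> B" if "t \<in> space M" for t using bound[OF that] by (simp add: B_def)
  define r where "r n t = (if L2_norm N (s n t) \<le> B then s n t else (\<lambda>_. 0))" for n t
  have r: "L2_simple M N (r n)" for n
  proof (rule L2_simpleI)
    have "simple_function M (\<lambda>t. (\<lambda>u. if L2_norm N u \<le> B then u else (\<lambda>_. 0)) (s n t))"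
      by (rule simple_function_compose1[OF L2_simpleD(1)[OF s(1)]])
    then show "simple_function M (r n)" by (simp add: r_def[abs_def])
  qed (use L2_simpleD(2)[OF s(1)] in \<open>auto simp: r_def L2_zero\<close>)
  have rB: "L2_norm N (r n t) \<le> B" for n t by (simp add: r_def L2_norm_zero B_def)
  have DL: "(\<lambda>x. G t x - r n t x) \<in> L2_space N" if "t \<in> space M" for n t
    by (intro L2_diff GL L2_simpleD(2)[OF r] that)
  have DB: "L2_dist N (G t) (r n t) \<le> 2 * B" if "t \<in> space M" for n t
    using L2_norm_triangle[OF GL[OF that] L2_minus[OF L2_simpleD(2)[OF r[of n] that]]] GB[OF that] rB[of n t]
    by (simp add: L2_norm_minus)
  have Dlim: "AE t in M. (\<lambda>n. L2_dist N (G t) (r n t)) \<longlonglongrightarrow> 0"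
    using s(2) AE_space
  proof eventually_elim
    case (elim t)
    have "\<forall>\<^sub>F n in sequentially. L2_dist N (G t) (s n t) < 1"
      using elim(1) by (rule order_tendstoD) simp
    then have "\<forall>\<^sub>F n in sequentially. L2_dist N (G t) (s n t) = L2_dist N (G t) (r n t)"
    proof eventually_elim
      case (elim n)
      have "L2_norm N (s n t) \<le> B"
        using L2_norm_diff_le[OF GL L2_simpleD(2)[OF s(1)], of t t n] elim bound[of t] \<open>t \<in> space M\<close>
        by (simp add: B_def)
      then show ?case by (simp add: r_def)
    qed
    then show ?case using elim(1) by (rule Lim_transform_eventually[rotated])
  qed
  have Dsm: "(\<lambda>t. L2_dist N (G t) (r n t)) \<in> borel_measurable M" for n
    by (intro L2_norm_measurable L2_strongly_measurable_diff sm L2_strongly_measurable_simple r)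
  have lim1: "(\<lambda>n. \<integral>\<^sup>+t. ennreal (L2_dist N (G t) (r n t)) \<partial>M) \<longlonglongrightarrow> (\<integral>\<^sup>+t. 0 \<partial>M)"
  proof (rule nn_integral_dominated_convergence[where w="\<lambda>_. ennreal (2 * B)"])
    show "AE t in M. (\<lambda>n. ennreal (L2_dist N (G t) (r n t))) \<longlonglongrightarrow> 0"
      using Dlim by eventually_elim (auto dest: tendsto_ennrealI)
    show "(\<integral>\<^sup>+t. ennreal (2 * B) \<partial>M) < \<infinity>"
      by (rule nn_integral_const_finite)
  qed (use Dsm DB in \<open>auto intro!: AE_I2 ennreal_leI\<close>)
  have lim2: "(\<lambda>n. \<integral>\<^sup>+t. ennreal ((L2_dist N (G t) (r n t))\<^sup>2) \<partial>M) \<longlonglongrightarrow> (\<integral>\<^sup>+t. 0 \<partial>M)"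
  proof (rule nn_integral_dominated_convergence[where w="\<lambda>_. ennreal ((2 * B)\<^sup>2)"])
    show "AE t in M. (\<lambda>n. ennreal ((L2_dist N (G t) (r n t))\<^sup>2)) \<longlonglongrightarrow> 0"
      using Dlim
    proof eventually_elim
      case (elim t)
      then have "(\<lambda>n. ennreal ((L2_dist N (G t) (r n t))\<^sup>2)) \<longlonglongrightarrow> ennreal (0\<^sup>2)"
        by (intro tendsto_ennrealI tendsto_power)
      then show ?case by simp
    qed
    show "(\<integral>\<^sup>+t. ennreal ((2 * B)\<^sup>2) \<partial>M) < \<infinity>"
      by (rule nn_integral_const_finite)
    show "AE t in M. ennreal ((L2_dist N (G t) (r j t))\<^sup>2) \<le> ennreal ((2 * B)\<^sup>2)" for j
      by (intro AE_I2 ennreal_leI power_mono DB L2_norm_nonneg)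
  qed (use Dsm in auto)
  have Dm: "case_prod (\<lambda>t x. G t x - r n t x) \<in> borel_measurable (M \<Otimes>\<^sub>M N)" for n
    using joint L2_simple_jointly_measurable[OF r[of n]] by (simp add: case_prod_unfold)
  have Dsq: "(\<integral>\<^sup>+z. ennreal ((case_prod (\<lambda>t x. G t x - r n t x) z)\<^sup>2) \<partial>(M \<Otimes>\<^sub>M N))
      = (\<integral>\<^sup>+t. ennreal ((L2_dist N (G t) (r n t))\<^sup>2) \<partial>M)" for n
    using nn_integral_L2_norm_sq[OF Dm DL] by simp
  have DP: "case_prod (\<lambda>t x. G t x - r n t x) \<in> L2_space (M \<Otimes>\<^sub>M N)" for n
  proof -
    have "(\<integral>\<^sup>+t. ennreal ((L2_dist N (G t) (r n t))\<^sup>2) \<partial>M) \<le> (\<integral>\<^sup>+t. ennreal ((2 * B)\<^sup>2) \<partial>M)"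
      by (intro nn_integral_mono ennreal_leI power_mono DB L2_norm_nonneg)
    also have "\<dots> < \<infinity>" by (rule nn_integral_const_finite)
    finally show ?thesis
      unfolding Dsq[symmetric] L2_space_def using Dm[of n] by (auto intro!: integrableI_nonneg)
  qed
  have rP: "case_prod (r n) \<in> L2_space (M \<Otimes>\<^sub>M N)" for n
  proof -
    have "(\<integral>\<^sup>+t. ennreal ((L2_norm N (r n t))\<^sup>2) \<partial>M) \<le> (\<integral>\<^sup>+t. ennreal (B\<^sup>2) \<partial>M)"
      by (intro nn_integral_mono ennreal_leI power_mono rB L2_norm_nonneg)
    also have "\<dots> < \<infinity>" by (rule nn_integral_const_finite)
    finally have "(\<integral>\<^sup>+z. ennreal ((case_prod (r n) z)\<^sup>2) \<partial>(M \<Otimes>\<^sub>M N)) < \<infinity>"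
      using nn_integral_L2_norm_sq[OF L2_simple_jointly_measurable[OF r[of n]] L2_simpleD(2)[OF r[of n]]] by simp
    then show ?thesis
      unfolding L2_space_def
      using L2_simple_jointly_measurable[OF r[of n]] by (auto intro!: integrableI_nonneg)
  qed
  have GP: "case_prod G \<in> L2_space (M \<Otimes>\<^sub>M N)"
    using L2_add[OF DP[of 0] rP[of 0]] by (simp add: case_prod_unfold)
  note I = time_integral_L2(1)[OF GP]
  have diff: "L2_norm N (\<lambda>x. L2_simple_integral M (r n) x - (\<integral>t. G t x \<partial>M))
      \<le> sqrt (measure M (space M)) * L2_norm (M \<Otimes>\<^sub>M N) (case_prod (\<lambda>t x. G t x - r n t x))" for n
  proof -
    have "AE x in N. integrable M (\<lambda>t. G t x)" "AE x in N. integrable M (\<lambda>t. r n t x)"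
      using AE_integrable_snd[OF L2_imp_integrable[OF P.finite_measure_axioms GP]]
        AE_integrable_snd[OF L2_imp_integrable[OF P.finite_measure_axioms rP]] by auto
    then have "AE x in N. (\<integral>t. G t x - r n t x \<partial>M) = (\<integral>t. G t x \<partial>M) - L2_simple_integral M (r n) x"
      by eventually_elim (simp add: L2_simple_integral_eq[OF r])
    then have "L2_norm N (\<lambda>x. (\<integral>t. G t x \<partial>M) - L2_simple_integral M (r n) x) = L2_norm N (\<lambda>x. \<integral>t. G t x - r n t x \<partial>M)"
      using L2_spaceD(1)[OF time_integral_L2(1)[OF DP[of n]]] L2_spaceD(1)[OF I]
        L2_spaceD(1)[OF L2_simple_integral_L2[OF r[of n]]]
      by (intro L2_norm_cong_AE) auto
    then show ?thesis using time_integral_L2(2)[OF DP[of n]] by (simp add: L2_norm_minus_commute[of N "L2_simple_integral M (r n)"])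
  qed
  have limP: "(\<lambda>n. L2_norm (M \<Otimes>\<^sub>M N) (case_prod (\<lambda>t x. G t x - r n t x))) \<longlonglongrightarrow> 0"
  proof -
    have "(\<lambda>n. ennreal ((L2_norm (M \<Otimes>\<^sub>M N) (case_prod (\<lambda>t x. G t x - r n t x)))\<^sup>2)) \<longlonglongrightarrow> ennreal 0"
      using lim2 by (simp add: L2_norm_ennreal[OF DP] Dsq)
    then have "(\<lambda>n. (L2_norm (M \<Otimes>\<^sub>M N) (case_prod (\<lambda>t x. G t x - r n t x)))\<^sup>2) \<longlonglongrightarrow> 0"
      by (subst (asm) tendsto_ennreal_iff) auto
    then have "(\<lambda>n. sqrt ((L2_norm (M \<Otimes>\<^sub>M N) (case_prod (\<lambda>t x. G t x - r n t x)))\<^sup>2)) \<longlonglongrightarrow> sqrt 0"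
      by (rule tendsto_real_sqrt)
    then show ?thesis by (simp add: L2_norm_nonneg)
  qed
  have "(\<lambda>n. L2_norm N (\<lambda>x. L2_simple_integral M (r n) x - (\<integral>t. G t x \<partial>M))) \<longlonglongrightarrow> 0"
  proof (rule tendsto_sandwich[OF _ _ tendsto_const])
    show "(\<lambda>n. sqrt (measure M (space M)) * L2_norm (M \<Otimes>\<^sub>M N) (case_prod (\<lambda>t x. G t x - r n t x))) \<longlonglongrightarrow> 0"
      using tendsto_mult_right_zero[OF limP] .
  qed (use diff in \<open>auto simp: L2_norm_nonneg\<close>)
  then show ?thesis
    unfolding has_L2_integral_def using sm I r lim1 by auto
qed

end

section \<open>Smooth functions of time and weak derivatives\<close>

definition smooth :: "(real \<Rightarrow> real) \<Rightarrow> bool" where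
  "smooth f \<longleftrightarrow> (\<forall>k t. (deriv ^^ k) f differentiable at t)"

text \<open>
  A set of functions which contains a derivative of each of its elements contains all iterated
  derivatives.  Smoothness is thus proved from a description of the shape of all the derivatives together.
\<close>

lemma smooth_coinduct:
  assumes f: "f \<in> S"
    and S: "\<And>h. h \<in> S \<Longrightarrow> \<exists>h'\<in>S. \<forall>x. (h has_real_derivative h' x) (at x)"
  shows "smooth f"
proof -
  have "(deriv ^^ k) f \<in> S" for k
  proof (induction k)
    case (Suc k)
    then obtain h' where h': "h' \<in> S" "\<forall>x. ((deriv ^^ k) f has_real_derivative h' x) (at x)"
      using S by blast
    then have "deriv ((deriv ^^ k) f) = h'" by (auto intro: DERIV_imp_deriv)
    then show ?case using h' by simp
  qed (simp add: f)
  then show ?thesis unfolding smooth_def real_differentiable_def using S by blast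
qed

lemma smooth_deriv: "smooth f \<Longrightarrow> smooth (deriv f)"
  unfolding smooth_def by (metis comp_apply funpow_Suc_right)

lemma smooth_DERIV: "smooth f \<Longrightarrow> (f has_real_derivative deriv f x) (at x)"
  unfolding smooth_def using DERIV_deriv_iff_real_differentiable by (metis funpow_0)

lemma smooth_isCont: "smooth f \<Longrightarrow> isCont f x"
  using smooth_DERIV DERIV_isCont by blast

lemma smooth_antiderivative:
  assumes "smooth g" "\<And>x. (F has_real_derivative g x) (at x)"
  shows "smooth F"
proof (rule smooth_coinduct[of _ "insert F {h. smooth h}"])
  fix h assume "h \<in> insert F {h. smooth h}"
  then show "\<exists>h'\<in>insert F {h. smooth h}. \<forall>x. (h has_real_derivative h' x) (at x)"
    using assms smooth_deriv smooth_DERIV by blast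
qed simp

lemma smooth_affine_DERIV:
  assumes "smooth h"
  shows "((\<lambda>x. c * h (a * x + b)) has_real_derivative (c * a) * deriv h (a * x + b)) (at x)"
proof -
  have "((\<lambda>x. a * x + b) has_real_derivative a) (at x)" by (auto intro!: derivative_eq_intros)
  from DERIV_cmult[OF DERIV_chain2[OF smooth_DERIV[OF assms] this], of c] show ?thesis
    by (simp add: mult_ac)
qed

lemma smooth_affine:
  assumes "smooth f" shows "smooth (\<lambda>x. c * f (a * x + b))"
proof (rule smooth_coinduct[of _ "{\<lambda>x. c * h (a * x + b) | c h. smooth h}"])
  show "(\<lambda>x. c * f (a * x + b)) \<in> {\<lambda>x. c * h (a * x + b) | c h. smooth h}" using assms by blast
next
  fix u assume "u \<in> {\<lambda>x. c * h (a * x + b) | c h. smooth h}"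
  then obtain c h where u: "u = (\<lambda>x. c * h (a * x + b))" "smooth h" by blast
  have "(u has_real_derivative (c * a) * deriv h (a * x + b)) (at x)" for x
    unfolding u(1) by (rule smooth_affine_DERIV[OF u(2)])
  then show "\<exists>h'\<in>{\<lambda>x. c * h (a * x + b) | c h. smooth h}. \<forall>x. (u has_real_derivative h' x) (at x)"
    using smooth_deriv[OF u(2)] by (intro bexI[of _ "\<lambda>x. (c * a) * deriv h (a * x + b)"]) auto
qed

lemma smooth_diff:
  assumes "smooth f" "smooth g" shows "smooth (\<lambda>x. f x - g x)"
proof (rule smooth_coinduct[of _ "{\<lambda>x. f x - g x | f g. smooth f \<and> smooth g}"])
  show "(\<lambda>x. f x - g x) \<in> {\<lambda>x. f x - g x | f g. smooth f \<and> smooth g}" using assms by blast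
next
  fix u assume "u \<in> {\<lambda>x. f x - g x | f g. smooth f \<and> smooth g}"
  then obtain f g where u: "u = (\<lambda>x. f x - g x)" "smooth f" "smooth g" by blast
  have "(u has_real_derivative deriv f x - deriv g x) (at x)" for x
    unfolding u(1) by (rule DERIV_diff[OF smooth_DERIV[OF u(2)] smooth_DERIV[OF u(3)]])
  then show "\<exists>h'\<in>{\<lambda>x. f x - g x | f g. smooth f \<and> smooth g}. \<forall>x. (u has_real_derivative h' x) (at x)"
    using u smooth_deriv by (intro bexI[of _ "\<lambda>x. deriv f x - deriv g x"]) auto
qed

text \<open>
  By the Leibniz rule, sums of products of smooth functions are stable under differentiation.
\<close>

inductive_set product_sums :: "(real \<Rightarrow> real) set" where
  prod: "smooth f \<Longrightarrow> smooth g \<Longrightarrow> (\<lambda>x. f x * g x) \<in> product_sums"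
| sum: "u \<in> product_sums \<Longrightarrow> w \<in> product_sums \<Longrightarrow> (\<lambda>x. u x + w x) \<in> product_sums"

lemma smooth_mult:
  assumes "smooth f" "smooth g" shows "smooth (\<lambda>x. f x * g x)"
proof (rule smooth_coinduct[of _ product_sums])
  fix u assume "u \<in> product_sums"
  then show "\<exists>h'\<in>product_sums. \<forall>x. (u has_real_derivative h' x) (at x)"
  proof induction
    case (prod f g)
    have "((\<lambda>x. f x * g x) has_real_derivative f x * deriv g x + deriv f x * g x) (at x)" for x
      by (rule DERIV_mult'[OF smooth_DERIV[OF prod(1)] smooth_DERIV[OF prod(2)]])
    moreover have "(\<lambda>x. f x * deriv g x + deriv f x * g x) \<in> product_sums"
      by (intro product_sums.sum product_sums.prod smooth_deriv prod)
    ultimately show ?case by (intro bexI[of _ "\<lambda>x. f x * deriv g x + deriv f x * g x"] allI)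
  next
    case (sum u w)
    then obtain u' w' where "u' \<in> product_sums" "w' \<in> product_sums"
      "\<And>x. (u has_real_derivative u' x) (at x)" "\<And>x. (w has_real_derivative w' x) (at x)" by blast
    then show ?case by (intro bexI[of _ "\<lambda>x. u' x + w' x"] allI product_sums.sum DERIV_add)
  qed
qed (use assms in \<open>auto intro: product_sums.intros\<close>)

text \<open>
  Every derivative of the flat function \<open>exp (- 1 / x)\<close>, extended by zero, has this form for some
  polynomial.
\<close>

definition flat_exp :: "real poly \<Rightarrow> real \<Rightarrow> real" where
  "flat_exp P x = (if x > 0 then poly P (1 / x) * exp (- 1 / x) else 0)"

lemma poly_exp_tendsto_0: "((\<lambda>y::real. poly Q y * exp (- y)) \<longlongrightarrow> 0) at_top"
proof -
  have "((\<lambda>y. \<Sum>i\<le>degree Q. coeff Q i * (y ^ i / exp y)) \<longlongrightarrow> (\<Sum>i\<le>degree Q. coeff Q i * 0)) at_top"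
    by (intro tendsto_sum tendsto_mult tendsto_const tendsto_power_div_exp_0)
  moreover have "(\<Sum>i\<le>degree Q. coeff Q i * (y ^ i / exp y)) = poly Q y * exp (- y)" for y :: real
    by (simp add: poly_altdef sum_distrib_right exp_minus divide_inverse mult.assoc)
  ultimately show ?thesis by simp
qed

lemma flat_exp_DERIV:
  "(flat_exp P has_real_derivative flat_exp (monom 1 2 * (P - pderiv P)) x) (at x)"
proof -
  consider "x > 0" | "x < 0" | "x = 0" by linarith
  then show ?thesis
  proof cases
    case 1
    have "((\<lambda>x. poly P (1 / x) * exp (- 1 / x)) has_real_derivative
        flat_exp (monom 1 2 * (P - pderiv P)) x) (at x)"
      using 1 by (auto intro!: derivative_eq_intros simp: flat_exp_def poly_monom field_simps power2_eq_square)
    moreover have "\<forall>\<^sub>F y in nhds x. flat_exp P y = poly P (1 / y) * exp (- 1 / y)"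
      using eventually_nhds_in_open[of "{0<..}" x] 1 by (auto elim!: eventually_mono simp: flat_exp_def)
    ultimately show ?thesis by (subst DERIV_cong_ev[OF refl _ refl])
  next
    case 2
    have "\<forall>\<^sub>F y in nhds x. flat_exp P y = 0"
      using eventually_nhds_in_open[of "{..<0}" x] 2 by (auto elim!: eventually_mono simp: flat_exp_def)
    then show ?thesis using 2 by (subst DERIV_cong_ev[OF refl _ refl]) (auto simp: flat_exp_def)
  next
    case 3
    have "((\<lambda>h. poly (pCons 0 P) (inverse h) * exp (- inverse h)) \<longlongrightarrow> 0) (at_right (0::real))"
      by (rule filterlim_compose[OF poly_exp_tendsto_0 filterlim_inverse_at_top_right])
    then have "((\<lambda>h. (flat_exp P (0 + h) - flat_exp P 0) / h) \<longlongrightarrow> 0) (at_right 0)"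
      by (rule Lim_transform_eventually)
         (auto simp: eventually_at_filter flat_exp_def field_simps)
    moreover have "((\<lambda>h. (flat_exp P (0 + h) - flat_exp P 0) / h) \<longlongrightarrow> 0) (at_left 0)"
      by (rule tendsto_eventually) (auto simp: eventually_at_filter flat_exp_def)
    ultimately have "((\<lambda>h. (flat_exp P (0 + h) - flat_exp P 0) / h) \<longlongrightarrow> 0) (at 0)"
      by (simp add: filterlim_at_split)
    then show ?thesis using 3 by (simp add: DERIV_def flat_exp_def)
  qed
qed

lemma smooth_flat_exp: "smooth (flat_exp P)"
  by (rule smooth_coinduct[of _ "range flat_exp"]) (use flat_exp_DERIV in blast)+

text \<open>
  The product of two flat functions that face each other is positive exactly on the open unit interval; the step is its
  normalised primitive.
\<close>

lemma smooth_step_exists: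
  "\<exists>R. smooth R \<and> (\<forall>x\<le>0. R x = 0) \<and> (\<forall>x\<ge>1. R x = 1) \<and> (\<forall>x. 0 \<le> R x \<and> R x \<le> 1) \<and>
    (\<forall>x. 0 \<le> deriv R x) \<and> (\<forall>x. x < 0 \<or> x > 1 \<longrightarrow> deriv R x = 0)"
proof -
  define \<beta> where "\<beta> x = flat_exp 1 x * flat_exp 1 (1 - x)" for x
  have smooth_\<beta>: "smooth \<beta>"
    using smooth_mult[OF smooth_flat_exp smooth_affine[OF smooth_flat_exp, of 1 1 "-1" 1]]
    by (simp add: \<beta>_def[abs_def])
  have \<beta>: "0 \<le> \<beta> x" "x \<le> 0 \<or> x \<ge> 1 \<Longrightarrow> \<beta> x = 0" "0 < x \<Longrightarrow> x < 1 \<Longrightarrow> 0 < \<beta> x" for x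
    by (auto simp: \<beta>_def flat_exp_def)
  define F where "F x = integral {-1..x} \<beta>" for x
  have F0: "F x = 0" if "x \<le> 0" for x
  proof -
    have "F x = integral {-1..x} (\<lambda>_. 0)"
      unfolding F_def by (rule integral_cong) (use \<beta>(2) that in auto)
    then show ?thesis by simp
  qed
  have F: "(F has_real_derivative \<beta> x) (at x)" for x
  proof (cases "x < 0")
    case True
    have "\<forall>\<^sub>F y in nhds x. F y = 0"
      using eventually_nhds_in_open[of "{..<0}" x] True by (auto elim!: eventually_mono simp: F0)
    then show ?thesis using True \<beta>(2)[of x] by (subst DERIV_cong_ev[OF refl _ refl]) auto
  next
    case False
    have "(F has_real_derivative \<beta> x) (at x within {-1..x + 1})"
      unfolding F_def[abs_def]
      by (rule integral_has_real_derivative)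
         (use False in \<open>auto intro!: continuous_at_imp_continuous_on smooth_isCont smooth_\<beta>\<close>)
    moreover have "at x within {-1..x + 1} = at x"
      by (rule at_within_interior) (use False in auto)
    ultimately show ?thesis by simp
  qed
  have mono: "F x \<le> F y" if "x \<le> y" for x y
    by (rule DERIV_nonneg_imp_nondecreasing[OF that]) (use F \<beta> in blast)
  have F1: "F x = F 1" if "x \<ge> 1" for x
  proof (cases "x = 1")
    case False
    then have "1 < x" using that by simp
    from MVT2[OF this F] obtain z where "1 < z" "F x - F 1 = (x - 1) * \<beta> z" by blast
    then show ?thesis using \<beta>(2)[of z] by simp
  qed simp
  have pos: "0 < F 1"
  proof -
    obtain z where "0 < z" "z < 1" "F 1 - F 0 = (1 - 0) * \<beta> z"
      using MVT2[OF zero_less_one F] by blast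
    then show ?thesis using \<beta>(3)[of z] F0[of 0] by simp
  qed
  have F_le: "F x \<le> F 1" for x using mono[of x 1] F1[of x] by (cases "x \<le> 1") auto
  have F_ge: "0 \<le> F x" for x using mono[of 0 x] F0[of 0] F0[of x] by (cases "0 \<le> x") auto
  define R where "R x = F x / F 1" for x
  have R: "(R has_real_derivative \<beta> x / F 1) (at x)" for x
    unfolding R_def[abs_def] by (rule DERIV_cdivide[OF F])
  have dR: "deriv R x = \<beta> x / F 1" for x by (rule DERIV_imp_deriv[OF R])
  have "smooth (\<lambda>x. \<beta> x / F 1)" using smooth_affine[OF smooth_\<beta>, of "1 / F 1" 1 0] by simp
  then have "smooth R" using R by (rule smooth_antiderivative)
  moreover have "R x = 0" if "x \<le> 0" for x using F0[OF that] by (simp add: R_def)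
  moreover have "R x = 1" if "x \<ge> 1" for x using F1[OF that] pos by (simp add: R_def)
  moreover have "0 \<le> R x \<and> R x \<le> 1" for x using F_le[of x] F_ge[of x] pos by (simp add: R_def)
  moreover have "0 \<le> deriv R x" for x unfolding dR using pos \<beta>(1)[of x] by simp
  moreover have "deriv R x = 0" if "x < 0 \<or> x > 1" for x unfolding dR using \<beta>(2)[of x] that by auto
  ultimately show ?thesis by blast
qed

text \<open>
  The rescaled slopes of a smooth step are an approximate identity, concentrated immediately to the right of \<open>c\<close>.
\<close>

lemma kernel_tendsto:
  assumes R: "smooth R" "\<And>x. x \<le> 0 \<Longrightarrow> R x = 0" "\<And>x. x \<ge> 1 \<Longrightarrow> R x = 1"
    "\<And>x. 0 \<le> deriv R x" "\<And>x. x < 0 \<or> x > 1 \<Longrightarrow> deriv R x = 0"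
    and cont: "continuous_on {0<..<T} \<zeta>" and c: "0 < c" "c < T"
  shows "\<forall>\<^sub>F n in sequentially. integrable (lebesgue_on {0<..<T}) (\<lambda>t. real n * deriv R (real n * (t - c)) * \<zeta> t)"
    and "(\<lambda>n. \<integral>t. real n * deriv R (real n * (t - c)) * \<zeta> t \<partial>lebesgue_on {0<..<T}) \<longlonglongrightarrow> \<zeta> c"
proof -
  let ?L = "lebesgue_on {0<..<T}"
  define k where "k n t = real n * deriv R (real n * (t - c))" for n t
  have "smooth (k n)" for n
    using smooth_affine[OF smooth_deriv[OF R(1)], of "real n" "real n" "- real n * c"]
    by (simp add: k_def[abs_def] right_diff_distrib)
  then have cont_k: "continuous_on UNIV (k n)" for n
    by (intro continuous_at_imp_continuous_on ballI smooth_isCont)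
  have [measurable]: "k n \<in> borel_measurable ?L" for n
    using borel_measurable_continuous_onI[OF cont_k] by (simp add: measurable_restrict_space1 measurable_completion)
  have [measurable]: "\<zeta> \<in> borel_measurable ?L"
    by (rule continuous_imp_measurable_on_sets_lebesgue[OF cont]) auto
  have k0: "0 \<le> k n t" for n t using R(4) by (simp add: k_def)
  have supp: "k n t = 0" if "t \<notin> {c..c + 1 / real n}" for n t
  proof (cases "n = 0")
    case False
    then have "real n * (t - c) < 0 \<or> real n * (t - c) > 1"
      using that by (auto simp: mult_less_0_iff field_simps not_le)
    then show ?thesis by (simp add: k_def R(5))
  qed (simp add: k_def)
  have int: "has_bochner_integral ?L (k n) 1" if n: "n > 0" "c + 1 / real n < T" for n
  proof -
    have "has_bochner_integral lborel (\<lambda>t. k n t * indicator {c..c + 1 / real n} t)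
        (R (real n * (c + 1 / real n - c)) - R (real n * (c - c)))"
    proof (rule has_bochner_integral_FTC_Icc_real)
      fix t
      show "((\<lambda>t. R (real n * (t - c))) has_real_derivative k n t) (at t)"
        using smooth_affine_DERIV[OF R(1), of 1 "real n" "- real n * c" t] by (simp add: k_def algebra_simps)
      show "isCont (k n) t" using cont_k by (auto simp: continuous_on_eq_continuous_at)
    qed simp
    moreover have "(\<lambda>t. k n t * indicator {c..c + 1 / real n} t) = k n"
      using supp by (auto simp: indicator_def fun_eq_iff)
    moreover have "R (real n * (c + 1 / real n - c)) - R (real n * (c - c)) = 1" using n R(2,3) by simp
    ultimately have "has_bochner_integral lborel (k n) 1" by metis
    then have "has_bochner_integral lebesgue (k n) 1"
      using borel_measurable_continuous_onI[OF cont_k[of n]]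
      by (auto simp: has_bochner_integral_iff integrable_completion integral_completion)
    moreover have "(\<lambda>t. indicator {0<..<T} t * k n t) = k n"
    proof
      fix t
      show "indicator {0<..<T} t * k n t = k n t"
        using supp[of t n] n c by (cases "t \<in> {c..c + 1 / real n}") (auto simp: indicator_def)
    qed
    ultimately show ?thesis
      by (simp add: has_bochner_integral_iff integrable_restrict_space integral_restrict_space)
  qed
  have close: "\<forall>\<^sub>F n in sequentially. integrable ?L (\<lambda>t. k n t * \<zeta> t) \<and> \<bar>(\<integral>t. k n t * \<zeta> t \<partial>?L) - \<zeta> c\<bar> \<le> e"
    if e: "e > 0" for e
  proof -
    have "isCont \<zeta> c" using cont c by (simp add: continuous_on_eq_continuous_at)
    then obtain d where d: "d > 0" "\<And>t. \<bar>t - c\<bar> < d \<Longrightarrow> \<bar>\<zeta> t - \<zeta> c\<bar> < e"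
      using e unfolding continuous_at_eps_delta dist_real_def by blast
    have "(\<lambda>n. 1 / real n) \<longlonglongrightarrow> 0" by (rule lim_1_over_n)
    then have "\<forall>\<^sub>F n in sequentially. 1 / real n < min d (T - c)"
      by (rule order_tendstoD) (use d c in simp)
    with eventually_gt_at_top[of 0] show ?thesis
    proof eventually_elim
      case (elim n)
      then have "has_bochner_integral ?L (k n) 1" by (intro int) auto
      then have ik: "integrable ?L (k n)" "(\<integral>t. k n t \<partial>?L) = 1" by (auto simp: has_bochner_integral_iff)
      have b: "\<bar>k n t * (\<zeta> t - \<zeta> c)\<bar> \<le> k n t * e" for t
      proof (cases "t \<in> {c..c + 1 / real n}")
        case True
        then have "\<bar>\<zeta> t - \<zeta> c\<bar> \<le> e" using elim by (intro less_imp_le d) auto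
        then show ?thesis using k0 by (simp add: abs_mult mult_left_mono)
      qed (simp add: supp)
      have i1: "integrable ?L (\<lambda>t. k n t * (\<zeta> t - \<zeta> c))"
        by (rule Bochner_Integration.integrable_bound[of _ "\<lambda>t. k n t * e"])
           (use ik b k0 e in \<open>auto intro!: AE_I2\<close>)
      have i2: "integrable ?L (\<lambda>t. k n t * (\<zeta> t - \<zeta> c) + k n t * \<zeta> c)"
        using i1 ik by auto
      then have i3: "integrable ?L (\<lambda>t. k n t * \<zeta> t)" by (simp add: algebra_simps)
      have "(\<integral>t. k n t * \<zeta> t \<partial>?L) - \<zeta> c = (\<integral>t. k n t * (\<zeta> t - \<zeta> c) \<partial>?L)"
        using i3 ik by (simp add: right_diff_distrib)
      also have "\<bar>\<dots>\<bar> \<le> (\<integral>t. \<bar>k n t * (\<zeta> t - \<zeta> c)\<bar> \<partial>?L)" by (rule integral_abs_bound)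
      also have "\<dots> \<le> (\<integral>t. k n t * e \<partial>?L)"
        by (rule integral_mono) (use i1 ik b in auto)
      finally show ?case using i3 ik by simp
    qed
  qed
  show "\<forall>\<^sub>F n in sequentially. integrable ?L (\<lambda>t. real n * deriv R (real n * (t - c)) * \<zeta> t)"
    using close[of 1] by (auto elim!: eventually_mono simp: k_def)
  show "(\<lambda>n. \<integral>t. real n * deriv R (real n * (t - c)) * \<zeta> t \<partial>?L) \<longlonglongrightarrow> \<zeta> c"
  proof (rule tendstoI)
    fix e :: real assume "0 < e"
    then show "\<forall>\<^sub>F n in sequentially. dist (\<integral>t. real n * deriv R (real n * (t - c)) * \<zeta> t \<partial>?L) (\<zeta> c) < e"
      using close[of "e / 2"] by (auto elim!: eventually_mono simp: k_def dist_real_def)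
  qed
qed

text \<open>
  The lemma of du Bois-Reymond: the difference of a step at \<open>a\<close> and a step at \<open>b\<close>, both of width
  \<open>1 / n\<close>, is a test function which approximates the indicator of the interval and whose derivative
  samples \<open>\<zeta>\<close> at the two ends.
\<close>

lemma weak_derivative_increment:
  fixes \<zeta> g :: "real \<Rightarrow> real"
  assumes cont: "continuous_on {0<..<T} \<zeta>"
    and g: "\<And>a b. 0 < a \<Longrightarrow> b < T \<Longrightarrow> integrable (lebesgue_on {a..b}) g"
    and weak: "\<And>\<phi>. test_function T \<phi> \<Longrightarrow>
      (\<integral>t. deriv \<phi> t * \<zeta> t \<partial>lebesgue_on {0<..<T}) = - (\<integral>t. \<phi> t * g t \<partial>lebesgue_on {0<..<T})"
    and ab: "0 < a" "a \<le> b" "b < T"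
  shows "\<zeta> b - \<zeta> a = (\<integral>t. g t \<partial>lebesgue_on {a..b})"
proof -
  let ?L = "lebesgue_on {0<..<T}"
  obtain R where R: "smooth R" "\<And>x. x \<le> 0 \<Longrightarrow> R x = 0" "\<And>x. x \<ge> 1 \<Longrightarrow> R x = 1"
    "\<And>x. 0 \<le> deriv R x" "\<And>x. x < 0 \<or> x > 1 \<Longrightarrow> deriv R x = 0" and R01: "\<And>x. 0 \<le> R x \<and> R x \<le> 1"
    using smooth_step_exists by metis
  define \<phi> where "\<phi> n t = R (real n * (t - a)) - R (real n * (t - b))" for n t
  define c where "c = (b + T) / 2"
  have c: "b < c" "c < T" using ab by (auto simp: c_def)
  have d\<phi>: "deriv (\<phi> n) t = real n * deriv R (real n * (t - a)) - real n * deriv R (real n * (t - b))" for n t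
    using DERIV_imp_deriv[OF DERIV_diff[OF smooth_affine_DERIV[OF R(1), of 1 "real n" "- real n * a" t]
          smooth_affine_DERIV[OF R(1), of 1 "real n" "- real n * b" t]]]
    by (simp add: \<phi>_def[abs_def] right_diff_distrib)
  have smooth_\<phi>: "smooth (\<phi> n)" for n
    using smooth_diff[OF smooth_affine[OF R(1), of 1 "real n" "- real n * a"] smooth_affine[OF R(1), of 1 "real n" "- real n * b"]]
    by (simp add: \<phi>_def[abs_def] right_diff_distrib)
  have big: "\<forall>\<^sub>F n in sequentially. n > 0 \<and> b + 1 / real n < c"
  proof -
    have "\<forall>\<^sub>F n in sequentially. 1 / real n < c - b"
      using lim_1_over_n by (rule order_tendstoD) (use c in simp)
    then show ?thesis using eventually_gt_at_top[of 0] by eventually_elim auto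
  qed
  have supp: "\<phi> n t = 0" if "n > 0" "b + 1 / real n < c" "t \<notin> {a..c}" for n t
  proof (cases "t < a")
    case True
    then show ?thesis using ab R(2) by (simp add: \<phi>_def mult_nonneg_nonpos)
  next
    case False
    then have "1 / real n \<le> t - b" using that by simp
    then have "real n * (t - b) \<ge> 1" using \<open>n > 0\<close> by (simp add: field_simps)
    moreover have "real n * (t - a) \<ge> real n * (t - b)" using ab by (intro mult_left_mono) auto
    ultimately show ?thesis using R(3) by (simp add: \<phi>_def)
  qed
  have test: "\<forall>\<^sub>F n in sequentially. test_function T (\<phi> n)"
    using big
  proof eventually_elim
    case (elim n)
    then have "\<exists>K. compact K \<and> K \<subseteq> {0<..<T} \<and> (\<forall>t. t \<notin> K \<longrightarrow> \<phi> n t = 0)"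
      using supp[of n] ab c by (intro exI[of _ "{a..c}"]) auto
    then show ?case using smooth_\<phi>[of n] by (auto simp: test_function_def smooth_def)
  qed
  have lim1: "(\<lambda>n. \<integral>t. deriv (\<phi> n) t * \<zeta> t \<partial>?L) \<longlonglongrightarrow> \<zeta> a - \<zeta> b"
  proof (rule Lim_transform_eventually)
    show "(\<lambda>n. (\<integral>t. real n * deriv R (real n * (t - a)) * \<zeta> t \<partial>?L)
      - (\<integral>t. real n * deriv R (real n * (t - b)) * \<zeta> t \<partial>?L)) \<longlonglongrightarrow> \<zeta> a - \<zeta> b"
      using ab by (intro tendsto_diff kernel_tendsto R cont) auto
    show "\<forall>\<^sub>F n in sequentially. (\<integral>t. real n * deriv R (real n * (t - a)) * \<zeta> t \<partial>?L)
      - (\<integral>t. real n * deriv R (real n * (t - b)) * \<zeta> t \<partial>?L) = (\<integral>t. deriv (\<phi> n) t * \<zeta> t \<partial>?L)"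
    proof -
      have "\<forall>\<^sub>F n in sequentially. integrable ?L (\<lambda>t. real n * deriv R (real n * (t - a)) * \<zeta> t)"
        "\<forall>\<^sub>F n in sequentially. integrable ?L (\<lambda>t. real n * deriv R (real n * (t - b)) * \<zeta> t)"
        using ab by (intro kernel_tendsto(1) R cont; simp)+
      then show ?thesis by eventually_elim (simp add: d\<phi> left_diff_distrib)
    qed
  qed
  have gi: "integrable lebesgue (\<lambda>t. indicator {a..c} t * g t)"
    using g[OF ab(1) c(2)] by (simp add: integrable_restrict_space)
  have lim2: "(\<lambda>n. \<integral>t. \<phi> n t * (indicator {a..c} t * g t) \<partial>lebesgue) \<longlonglongrightarrow> (\<integral>t. indicator {a..b} t * (indicator {a..c} t * g t) \<partial>lebesgue)"
  proof (rule integral_dominated_convergence[where w="\<lambda>t. \<bar>indicator {a..c} t * g t\<bar>"])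
    have [measurable]: "\<phi> n \<in> borel_measurable lebesgue" for n
    proof -
      have "\<phi> n \<in> borel_measurable borel"
        by (rule borel_measurable_continuous_onI) (auto intro!: continuous_at_imp_continuous_on smooth_isCont smooth_\<phi>)
      then show ?thesis by (simp add: measurable_completion)
    qed
    have gm[measurable]: "(\<lambda>t. indicator {a..c} t * g t) \<in> borel_measurable lebesgue" using gi by auto
    show "(\<lambda>t. \<phi> n t * (indicator {a..c} t * g t)) \<in> borel_measurable lebesgue" for n by measurable
    show "(\<lambda>t. indicator {a..b} t * (indicator {a..c} t * g t)) \<in> borel_measurable lebesgue"
      by (intro borel_measurable_times gm borel_measurable_indicator) auto
    show "AE t in lebesgue. norm (\<phi> n t * (indicator {a..c} t * g t)) \<le> \<bar>indicator {a..c} t * g t\<bar>" for n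
    proof (rule AE_I2)
      fix t
      have "\<bar>\<phi> n t\<bar> \<le> 1" using R01[of "real n * (t - a)"] R01[of "real n * (t - b)"] by (auto simp: \<phi>_def)
      then show "norm (\<phi> n t * (indicator {a..c} t * g t)) \<le> \<bar>indicator {a..c} t * g t\<bar>"
        by (simp add: abs_mult mult_left_le_one_le)
    qed
    have "AE t in lborel. t \<noteq> a" by (rule AE_lborel_singleton)
    then have "AE t in lebesgue. t \<noteq> a" by (rule AE_completion)
    then show "AE t in lebesgue. (\<lambda>n. \<phi> n t * (indicator {a..c} t * g t)) \<longlonglongrightarrow> indicator {a..b} t * (indicator {a..c} t * g t)"
    proof eventually_elim
      case (elim t)
      have step: "\<forall>\<^sub>F n in sequentially. R (real n * s) = 1" if "s > 0" for s
      proof -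
        have "\<forall>\<^sub>F n in sequentially. 1 / real n < s"
          using lim_1_over_n by (rule order_tendstoD) (use that in simp)
        then show ?thesis using eventually_gt_at_top[of 0]
        proof eventually_elim
          case (elim n) then show ?case by (intro R(3)) (simp add: field_simps)
        qed
      qed
      have zero: "R (real n * s) = 0" if "s \<le> 0" for s n
        using that by (intro R(2)) (simp add: mult_nonneg_nonpos)
      have "\<forall>\<^sub>F n in sequentially. \<phi> n t = indicator {a..b} t"
      proof -
        consider "t < a" | "a < t" "t \<le> b" | "b < t" using elim by linarith
        then show ?thesis
        proof cases
          case 1 then show ?thesis using ab zero by (auto simp: \<phi>_def)
        next
          case 2 then show ?thesis using step[of "t - a"] zero[of "t - b"] by (auto elim!: eventually_mono simp: \<phi>_def)
        next
          case 3
          then have "\<forall>\<^sub>F n in sequentially. R (real n * (t - a)) = 1" "\<forall>\<^sub>F n in sequentially. R (real n * (t - b)) = 1"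
            using ab by (auto intro: step)
          then show ?thesis by eventually_elim (use 3 in \<open>simp add: \<phi>_def\<close>)
        qed
      qed
      then have "(\<lambda>n. \<phi> n t) \<longlonglongrightarrow> indicator {a..b} t" by (rule tendsto_eventually)
      then show ?case by (intro tendsto_mult tendsto_const)
    qed
    show "integrable lebesgue (\<lambda>t. \<bar>indicator {a..c} t * g t\<bar>)" using gi by (rule integrable_abs)
  qed
  have "\<forall>\<^sub>F n in sequentially. - (\<integral>t. \<phi> n t * (indicator {a..c} t * g t) \<partial>lebesgue) = (\<integral>t. deriv (\<phi> n) t * \<zeta> t \<partial>?L)"
    using big test
  proof eventually_elim
    case (elim n)
    have "(\<integral>t. \<phi> n t * g t \<partial>?L) = (\<integral>t. indicator {0<..<T} t * (\<phi> n t * g t) \<partial>lebesgue)"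
      by (simp add: integral_restrict_space)
    also have "\<dots> = (\<integral>t. \<phi> n t * (indicator {a..c} t * g t) \<partial>lebesgue)"
      by (intro Bochner_Integration.integral_cong refl)
         (use supp[of n] elim ab c in \<open>auto simp: indicator_def\<close>)
    finally show ?case using weak[OF elim(2)] by simp
  qed
  then have "(\<lambda>n. \<integral>t. deriv (\<phi> n) t * \<zeta> t \<partial>?L) \<longlonglongrightarrow> - (\<integral>t. indicator {a..b} t * (indicator {a..c} t * g t) \<partial>lebesgue)"
    by (rule Lim_transform_eventually[OF tendsto_minus[OF lim2]])
  then have "\<zeta> a - \<zeta> b = - (\<integral>t. indicator {a..b} t * (indicator {a..c} t * g t) \<partial>lebesgue)"
    using lim1 LIMSEQ_unique by blast
  also have "(\<integral>t. indicator {a..b} t * (indicator {a..c} t * g t) \<partial>lebesgue) = (\<integral>t. indicator {a..b} t * g t \<partial>lebesgue)"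
    by (intro Bochner_Integration.integral_cong refl) (use c in \<open>auto simp: indicator_def\<close>)
  also have "\<dots> = (\<integral>t. g t \<partial>lebesgue_on {a..b})" by (simp add: integral_restrict_space)
  finally show ?thesis by simp
qed

section \<open>Strong solutions contract\<close>

lemma complete_lebesgue_on:
  assumes S: "S \<in> sets lebesgue" shows "complete_measure (lebesgue_on S)"
proof
  fix A B assume "B \<subseteq> A" "A \<in> null_sets (lebesgue_on S)"
  then have "A \<in> null_sets lebesgue" "B \<subseteq> S" using S by (auto simp: null_sets_restrict_space)
  then have "B \<in> sets lebesgue" using completion.complete \<open>B \<subseteq> A\<close> by blast
  then show "B \<in> sets (lebesgue_on S)" using S \<open>B \<subseteq> S\<close> by (simp add: sets_restrict_space_iff)
qed

lemma sets_lebesgue_greaterThanLessThan: "{a<..<b::real} \<in> sets lebesgue"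
  by (rule sets_completionI_sets) simp

lemma finite_lebesgue_on: "finite_measure (lebesgue_on {0<..<T::real})"
  by (intro finite_measure_lebesgue_on bounded_set_imp_lmeasurable sets_lebesgue_greaterThanLessThan) simp

subsection \<open>Truncated excess functions\<close>

text \<open>
  \<open>excess k d\<close> is the primitive of \<open>excess_slope k d\<close>, written as the maximum of the affine functions
  \<open>r \<mapsto> \<theta> * (r - k) - \<theta>\<^sup>2 / 2\<close> over \<open>0 \<le> \<theta> \<le> d\<close>, which makes it convex at once.  Divided by
  \<open>d\<close> it approximates \<open>r \<mapsto> max 0 (r - k)\<close>, while its slope is monotone and Lipschitz and can
  therefore be used to test subgradients.
\<close>

definition excess_slope :: "real \<Rightarrow> real \<Rightarrow> real \<Rightarrow> real" where
  "excess_slope k d r = min d (max 0 (r - k))"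

definition excess :: "real \<Rightarrow> real \<Rightarrow> real \<Rightarrow> real" where
  "excess k d r = excess_slope k d r * (r - k) - (excess_slope k d r)\<^sup>2 / 2"

lemma excess_slope_Lipschitz: "1-lipschitz_on UNIV (excess_slope k d)"
  by (rule lipschitz_onI) (auto simp: excess_slope_def dist_real_def)

lemma excess_slope_mono: "mono (excess_slope k d)"
  by (rule monoI) (auto simp: excess_slope_def)

lemma excess_slope_bounds: "d > 0 \<Longrightarrow> 0 \<le> excess_slope k d r \<and> excess_slope k d r \<le> d"
  by (auto simp: excess_slope_def)

lemma excess_ge_affine:
  assumes "0 \<le> \<theta>" "\<theta> \<le> d"
  shows "\<theta> * (r - k) - \<theta>\<^sup>2 / 2 \<le> excess k d r"
proof -
  define P where "P = excess_slope k d r"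
  have "0 \<le> (P - \<theta>) * ((r - k) - (P + \<theta>) / 2)"
  proof (cases P \<theta> rule: linorder_cases)
    case less
    then have "(r - k) - (P + \<theta>) / 2 \<le> 0" using assms by (auto simp: P_def excess_slope_def min_def max_def split: if_splits)
    then show ?thesis using less by (simp add: mult_nonpos_nonpos)
  next
    case greater
    then have "0 \<le> (r - k) - (P + \<theta>) / 2" using assms by (auto simp: P_def excess_slope_def min_def max_def split: if_splits)
    then show ?thesis using greater by simp
  qed simp
  then show ?thesis unfolding excess_def P_def[symmetric] by (simp add: power2_eq_square field_simps)
qed

lemma excess_convex:
  assumes "d > 0"
  shows "excess k d b - excess k d a \<le> excess_slope k d b * (b - a)"
  using excess_ge_affine[of "excess_slope k d b" d a k] excess_slope_bounds[OF assms, of k b]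
  by (simp add: excess_def[of k d b] algebra_simps)

lemma excess_Lipschitz:
  assumes "d > 0"
  shows "d-lipschitz_on UNIV (excess k d)"
proof (rule lipschitz_onI)
  fix a b :: real
  have "excess_slope k d r * x \<le> d * \<bar>x\<bar>" for r x
    using excess_slope_bounds[OF assms, of k r] mult_mono[of "excess_slope k d r" d "\<bar>x\<bar>" "\<bar>x\<bar>"]
      mult_left_mono[OF abs_ge_self[of x], of "excess_slope k d r"] by linarith
  from this[of a "a - b"] this[of b "b - a"] show "dist (excess k d a) (excess k d b) \<le> d * dist a b"
    using excess_convex[OF assms, of k a b] excess_convex[OF assms, of k b a]
    by (simp add: dist_real_def abs_minus_commute)
qed (use assms in simp)

lemma excess_approx:
  assumes "d > 0"
  shows "excess k d r \<le> d * max 0 (r - k)" "d * max 0 (r - k) - d\<^sup>2 / 2 \<le> excess k d r"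
proof -
  have "excess_slope k d r * (r - k) \<le> d * max 0 (r - k)"
    using excess_slope_bounds[OF assms, of k r]
    by (intro order_trans[OF mult_left_mono[OF max.cobounded2] mult_right_mono]) auto
  moreover have "0 \<le> (excess_slope k d r)\<^sup>2" by simp
  ultimately show "excess k d r \<le> d * max 0 (r - k)" unfolding excess_def by linarith
  show "d * max 0 (r - k) - d\<^sup>2 / 2 \<le> excess k d r"
  proof (cases "k \<le> r")
    case True
    then show ?thesis using excess_ge_affine[of d d r k] assms by (simp add: max_absorb2)
  next
    case False
    then have m: "max 0 (r - k) = 0" by simp
    have "0 \<le> d\<^sup>2 / 2" by simp
    moreover have "0 \<le> excess k d r" using excess_ge_affine[of 0 d r k] assms by simp
    ultimately show ?thesis unfolding m by linarith
  qed
qed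

subsection \<open>Decay of the excess\<close>

context reversible_walk
begin

lemma L2_valued_lebesgue: "L2_valued (lebesgue_on {0<..<T::real}) \<nu>"
  by (intro L2_valued.intro finite_lebesgue_on complete_lebesgue_on finite_nu sets_lebesgue_greaterThanLessThan)

lemma measurable_subinterval:
  assumes h: "h \<in> borel_measurable (lebesgue_on {0<..<T::real})" and ab: "0 < a" "b < T"
  shows "h \<in> borel_measurable (lebesgue_on {a..b})"
proof -
  have "restrict_space (lebesgue_on {0<..<T}) {a..b} = lebesgue_on {a..b}"
    using ab by (subst restrict_restrict_space) (auto intro!: arg_cong[where f="restrict_space lebesgue"])
  then show ?thesis using measurable_restrict_space1[OF h, of "{a..b}"] by simp
qed

lemma L1_loc_norm_integrable:
  assumes g: "L1_loc_L2 \<nu> T g" and ab: "0 < a" "b < T"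
  shows "integrable (lebesgue_on {a..b}) (\<lambda>t. L2_norm \<nu> (g t))"
proof -
  interpret L2_valued "lebesgue_on {0<..<T}" \<nu> by (rule L2_valued_lebesgue)
  have "(\<lambda>t. L2_norm \<nu> (g t)) \<in> borel_measurable (lebesgue_on {a..b})"
    by (intro measurable_subinterval[OF _ ab] L2_norm_measurable) (use g in \<open>simp add: L1_loc_L2_def\<close>)
  moreover have "(\<integral>\<^sup>+t. ennreal (L2_norm \<nu> (g t)) \<partial>lebesgue_on {a..b}) < \<infinity>"
  proof -
    have "compact {a..b}" "{a..b} \<subseteq> {0<..<T}" using ab by auto
    then show ?thesis using g unfolding L1_loc_L2_def by blast
  qed
  ultimately show ?thesis by (intro integrableI_nonneg) (auto simp: L2_norm_nonneg)
qed

lemma L1_loc_inner_integrable: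
  assumes g: "L1_loc_L2 \<nu> T g" and w: "w \<in> L2_space \<nu>" and ab: "0 < a" "b < T"
  shows "integrable (lebesgue_on {a..b}) (\<lambda>t. L2_inner \<nu> (g t) w)"
proof -
  interpret L2_valued "lebesgue_on {0<..<T}" \<nu> by (rule L2_valued_lebesgue)
  have sm: "L2_strongly_measurable (lebesgue_on {0<..<T}) \<nu> g" using g by (simp add: L1_loc_L2_def)
  show ?thesis
  proof (rule Bochner_Integration.integrable_bound)
    show "(\<lambda>t. L2_inner \<nu> (g t) w) \<in> borel_measurable (lebesgue_on {a..b})"
      by (rule measurable_subinterval[OF L2_inner_measurable[OF sm w] ab])
    show "integrable (lebesgue_on {a..b}) (\<lambda>t. L2_norm \<nu> (g t) * L2_norm \<nu> w)"
      using L1_loc_norm_integrable[OF g ab] by simp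
    show "AE t in lebesgue_on {a..b}. norm (L2_inner \<nu> (g t) w) \<le> norm (L2_norm \<nu> (g t) * L2_norm \<nu> w)"
    proof (rule AE_I2)
      fix t assume "t \<in> space (lebesgue_on {a..b})"
      then have "g t \<in> L2_space \<nu>" using ab by (intro L2_strongly_measurableD(1)[OF sm]) auto
      then show "norm (L2_inner \<nu> (g t) w) \<le> norm (L2_norm \<nu> (g t) * L2_norm \<nu> w)"
        using L2_inner_le[OF _ w] by (simp add: abs_mult L2_norm_nonneg)
    qed
  qed
qed

text \<open>
  Pairing with a fixed \<open>w\<close> reduces the weak derivative in \<open>L\<^sup>2\<close> to the scalar one.
\<close>

lemma W11_increment:
  assumes c: "continuous_L2 \<nu> T v" and W: "W11_loc_derivative \<nu> T v v'" and w: "w \<in> L2_space \<nu>"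
    and ab: "0 < a" "a \<le> b" "b < T"
  shows "L2_inner \<nu> (\<lambda>x. v b x - v a x) w = (\<integral>t. L2_inner \<nu> (v' t) w \<partial>lebesgue_on {a..b})"
proof -
  interpret L2_valued "lebesgue_on {0<..<T}" \<nu> by (rule L2_valued_lebesgue)
  have vL: "v t \<in> L2_space \<nu>" if "t \<in> {0..T}" for t using c that by (auto simp: continuous_L2_def)
  have L1: "L1_loc_L2 \<nu> T v'" using W by (auto simp: W11_loc_derivative_def)
  have "L2_inner \<nu> (v b) w - L2_inner \<nu> (v a) w = (\<integral>t. L2_inner \<nu> (v' t) w \<partial>lebesgue_on {a..b})"
  proof (rule weak_derivative_increment[OF _ _ _ ab])
    show "continuous_on {0<..<T} (\<lambda>t. L2_inner \<nu> (v t) w)"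
      unfolding continuous_on_def
    proof
      fix t assume t: "t \<in> {0<..<T}"
      have "((\<lambda>s. L2_dist \<nu> (v s) (v t)) \<longlongrightarrow> 0) (at t within {0..T})"
        using c t by (auto simp: continuous_L2_def)
      then have lim: "((\<lambda>s. L2_dist \<nu> (v s) (v t)) \<longlongrightarrow> 0) (at t within {0<..<T})"
        by (rule tendsto_within_subset) auto
      show "((\<lambda>t. L2_inner \<nu> (v t) w) \<longlongrightarrow> L2_inner \<nu> (v t) w) (at t within {0<..<T})"
        by (rule L2_inner_tendsto[OF lim _ vL w]) (use t vL in \<open>auto simp: eventually_at_filter intro!: always_eventually\<close>)
    qed
    show "integrable (lebesgue_on {a..b}) (\<lambda>t. L2_inner \<nu> (v' t) w)" if "0 < a" "b < T" for a b
      by (rule L1_loc_inner_integrable[OF L1 w that])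
    fix \<phi> assume "test_function T \<phi>"
    then obtain I where I: "has_L2_integral (lebesgue_on {0<..<T}) \<nu> (\<lambda>t x. deriv \<phi> t * v t x) I"
      "has_L2_integral (lebesgue_on {0<..<T}) \<nu> (\<lambda>t x. \<phi> t * v' t x) (\<lambda>x. - I x)"
      using W by (auto simp: W11_loc_derivative_def)
    show "(\<integral>t. deriv \<phi> t * L2_inner \<nu> (v t) w \<partial>lebesgue_on {0<..<T}) = - (\<integral>t. \<phi> t * L2_inner \<nu> (v' t) w \<partial>lebesgue_on {0<..<T})"
      using has_L2_integral_inner(2)[OF I(1) w] has_L2_integral_inner(2)[OF I(2) w]
      by (simp add: L2_inner_scale_left L2_inner_minus_left)
  qed
  moreover have "L2_inner \<nu> (\<lambda>x. v b x - v a x) w = L2_inner \<nu> (v b) w - L2_inner \<nu> (v a) w"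
    using ab by (intro L2_inner_diff_left vL w) auto
  ultimately show ?thesis by simp
qed

text \<open>
  The slope of the excess vanishes unless \<open>u > w\<close>, and there every sign of \<open>u\<close> is at least every sign of
  \<open>w\<close>.
\<close>

lemma sign_set_monotone:
  assumes \<xi>: "\<xi> \<in> sign_set \<nu> u" and \<eta>: "\<eta> \<in> sign_set \<nu> w" and k: "k \<ge> 0" and d: "d > 0"
  shows "AE x in \<nu>. 0 \<le> (\<xi> x - \<eta> x) * excess_slope k d (u x - w x)"
proof -
  have "AE x in \<nu>. (u x > 0 \<longrightarrow> \<xi> x = 1) \<and> (u x < 0 \<longrightarrow> \<xi> x = -1) \<and> (u x = 0 \<longrightarrow> \<xi> x \<in> {-1..1})"
    "AE x in \<nu>. (w x > 0 \<longrightarrow> \<eta> x = 1) \<and> (w x < 0 \<longrightarrow> \<eta> x = -1) \<and> (w x = 0 \<longrightarrow> \<eta> x \<in> {-1..1})"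
    using \<xi> \<eta> by (auto simp: sign_set_def)
  then show ?thesis
  proof eventually_elim
    case (elim x)
    show ?case
    proof (cases "u x \<le> w x")
      case True
      then have "excess_slope k d (u x - w x) = 0" using k d by (simp add: excess_slope_def max_absorb1)
      then show ?thesis by simp
    next
      case False
      then have "\<eta> x \<le> \<xi> x" using elim by (cases "u x > 0"; cases "u x = 0"; cases "w x < 0"; cases "w x = 0") auto
      then show ?thesis using excess_slope_bounds[OF d, of k "u x - w x"] by simp
    qed
  qed
qed

lemma sign_set_L2: assumes "\<xi> \<in> sign_set \<nu> u" shows "\<xi> \<in> L2_space \<nu>"
proof -
  have [measurable]: "\<xi> \<in> borel_measurable \<nu>" using assms by (simp add: sign_set_def)
  have "(\<lambda>x. max (-1) (min 1 (\<xi> x))) \<in> L2_space \<nu>"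
    by (rule L2_bounded[OF finite_nu, where C=1]) auto
  moreover have "AE x in \<nu>. \<xi> x = max (-1) (min 1 (\<xi> x))"
  proof -
    have "AE x in \<nu>. (u x > 0 \<longrightarrow> \<xi> x = 1) \<and> (u x < 0 \<longrightarrow> \<xi> x = -1) \<and> (u x = 0 \<longrightarrow> \<xi> x \<in> {-1..1})"
      using assms by (simp add: sign_set_def)
    then show ?thesis
    proof eventually_elim
      case (elim x)
      then have "-1 \<le> \<xi> x \<and> \<xi> x \<le> 1" by (cases "u x" "0::real" rule: linorder_cases) auto
      then show ?case by simp
    qed
  qed
  ultimately show ?thesis by (rule L2_AE_cong[OF _ \<open>\<xi> \<in> borel_measurable \<nu>\<close>])
qed

text \<open>
  Subgradients and signs are both monotone against the slope, and the velocities are minus their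
  combinations.  Formally this says that the integral of the excess of \<open>u - w\<close> decreases in time.
\<close>

lemma velocity_accretive:
  assumes lam: "lam > 0" and k: "k \<ge> 0" and d: "d > 0"
    and \<xi>: "\<xi> \<in> sign_set \<nu> (\<lambda>x. u x - f x)" and \<eta>: "\<eta> \<in> sign_set \<nu> (\<lambda>x. w x - f x)"
    and A: "(\<lambda>x. lam * \<xi> x + u' x) \<in> one_Laplacian m \<nu> u" and B: "(\<lambda>x. lam * \<eta> x + w' x) \<in> one_Laplacian m \<nu> w"
    and L: "u' \<in> L2_space \<nu>" "w' \<in> L2_space \<nu>"
  shows "L2_inner \<nu> (\<lambda>x. u' x - w' x) (\<lambda>x. excess_slope k d (u x - w x)) \<le> 0"
proof -
  let ?P = "\<lambda>x. excess_slope k d (u x - w x)"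
  have uL: "u \<in> L2_space \<nu>" "w \<in> L2_space \<nu>"
    using A B by (auto simp: one_Laplacian_def L2_subdifferential_iff)
  have P: "?P \<in> L2_space \<nu>" by (rule Lipschitz_L2[OF finite_nu L2_diff[OF uL] excess_slope_Lipschitz])
  note S = sign_set_L2[OF \<xi>] sign_set_L2[OF \<eta>]
  have "0 \<le> L2_inner \<nu> (\<lambda>x. - (lam * \<xi> x + u' x) - - (lam * \<eta> x + w' x)) ?P"
    by (rule subdifferential_TV_completely_accretive[OF _ _ excess_slope_Lipschitz excess_slope_mono])
       (use A B in \<open>auto simp: one_Laplacian_def\<close>)
  also have "\<dots> = - lam * L2_inner \<nu> (\<lambda>x. \<xi> x - \<eta> x) ?P - L2_inner \<nu> (\<lambda>x. u' x - w' x) ?P"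
  proof -
    have "L2_inner \<nu> (\<lambda>x. - (lam * \<xi> x + u' x) - - (lam * \<eta> x + w' x)) ?P
      = L2_inner \<nu> (\<lambda>x. (- lam) * (\<xi> x - \<eta> x) - (u' x - w' x)) ?P"
      by (simp add: L2_inner_def algebra_simps)
    also have "\<dots> = L2_inner \<nu> (\<lambda>x. (- lam) * (\<xi> x - \<eta> x)) ?P - L2_inner \<nu> (\<lambda>x. u' x - w' x) ?P"
      by (intro L2_inner_diff_left L2_scale L2_diff S L P)
    finally show ?thesis by (simp only: L2_inner_scale_left)
  qed
  finally have "L2_inner \<nu> (\<lambda>x. u' x - w' x) ?P \<le> - lam * L2_inner \<nu> (\<lambda>x. \<xi> x - \<eta> x) ?P" by simp
  moreover have "0 \<le> L2_inner \<nu> (\<lambda>x. \<xi> x - \<eta> x) ?P"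
    unfolding L2_inner_def
    by (rule integral_nonneg_AE) (use sign_set_monotone[OF \<xi> \<eta> k d] in simp)
  ultimately show ?thesis using lam mult_nonneg_nonneg[of lam "L2_inner \<nu> (\<lambda>x. \<xi> x - \<eta> x) ?P"] by linarith
qed

text \<open>
  The argument works with increments instead of derivatives.  Convexity bounds the increment from \<open>s\<close> to \<open>t\<close> by the pairing
  of \<open>z t - z s\<close> with the slope at time \<open>t\<close>, a fixed function, for which \<open>W11_increment\<close> is
  available.  At an intermediate time the velocity pairs nonpositively with the slope at that time
  (\<open>velocity_accretive\<close>), and the change of slope is controlled by the oscillation of \<open>z\<close>.  On short intervals the increment is thus at most
  a small multiple of the integral of the speed, and the Bolzano principle adds up these local estimates.
\<close>

lemma excess_decreasing:
  assumes v: "strong_solution m \<nu> f lam T v0 v" and w: "strong_solution m \<nu> f lam T w0 w"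
    and lam: "lam > 0" and k: "k \<ge> 0" and d: "d > 0" and ab: "0 < a" "a \<le> b" "b < T"
  shows "(\<integral>x. excess k d (v b x - w b x) \<partial>\<nu>) \<le> (\<integral>x. excess k d (v a x - w a x) \<partial>\<nu>)"
proof -
  obtain v' where cv: "continuous_L2 \<nu> T v" and Wv: "W11_loc_derivative \<nu> T v v'"
    and Ev: "AE t in lebesgue_on {0<..<T}. \<exists>\<xi>\<in>sign_set \<nu> (\<lambda>x. v t x - f x). (\<lambda>x. lam * \<xi> x + v' t x) \<in> one_Laplacian m \<nu> (v t)"
    using v by (auto simp: strong_solution_def)
  obtain w' where cw: "continuous_L2 \<nu> T w" and Ww: "W11_loc_derivative \<nu> T w w'"
    and Ew: "AE t in lebesgue_on {0<..<T}. \<exists>\<xi>\<in>sign_set \<nu> (\<lambda>x. w t x - f x). (\<lambda>x. lam * \<xi> x + w' t x) \<in> one_Laplacian m \<nu> (w t)"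
    using w by (auto simp: strong_solution_def)
  interpret L2_valued "lebesgue_on {0<..<T}" \<nu> by (rule L2_valued_lebesgue)
  define z where "z t x = v t x - w t x" for t x
  define \<Phi> where "\<Phi> t = (\<integral>x. excess k d (z t x) \<partial>\<nu>)" for t
  define Z where "Z t = L2_norm \<nu> (v' t) + L2_norm \<nu> (w' t)" for t
  have vL: "v t \<in> L2_space \<nu>" and wL: "w t \<in> L2_space \<nu>" if "t \<in> {0..T}" for t
    using cv cw that by (auto simp: continuous_L2_def)
  have zL: "z t \<in> L2_space \<nu>" if "t \<in> {0..T}" for t
    unfolding z_def[abs_def] by (intro L2_diff vL wL that)
  have L1: "L1_loc_L2 \<nu> T v'" "L1_loc_L2 \<nu> T w'" using Wv Ww by (auto simp: W11_loc_derivative_def)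
  have v'L: "v' t \<in> L2_space \<nu>" "w' t \<in> L2_space \<nu>" if "t \<in> {0<..<T}" for t
    using L1 that by (auto simp: L1_loc_L2_def L2_strongly_measurable_def)
  have Zi: "integrable (lebesgue_on {s..t}) Z" if "0 < s" "t < T" for s t
    unfolding Z_def[abs_def]
    by (intro Bochner_Integration.integrable_add L1_loc_norm_integrable[where T=T] L1 that)
  have P: "(\<lambda>x. excess_slope k d (z t x)) \<in> L2_space \<nu>" if "t \<in> {0..T}" for t
    by (rule Lipschitz_L2[OF finite_nu zL[OF that] excess_slope_Lipschitz])
  have J: "integrable \<nu> (\<lambda>x. excess k d (z t x))" if "t \<in> {0..T}" for t
    by (rule L2_integrable[OF Lipschitz_L2[OF finite_nu zL[OF that] excess_Lipschitz[OF d]]])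
  have acc: "AE t in lebesgue_on {0<..<T}. L2_inner \<nu> (\<lambda>x. v' t x - w' t x) (\<lambda>x. excess_slope k d (z t x)) \<le> 0"
    using Ev Ew AE_space
  proof eventually_elim
    case (elim t)
    then have t: "t \<in> {0<..<T}" by simp
    from elim(1,2) show ?case
      unfolding z_def by (auto intro!: velocity_accretive[OF lam k d] v'L[OF t])
  qed
  have local_bound: "\<Phi> t - \<Phi> s \<le> e * integral {s..t} Z"
    if st: "0 < s" "s \<le> t" "t < T" and e: "e \<ge> 0"
      and close: "\<And>r. r \<in> {s..t} \<Longrightarrow> L2_dist \<nu> (z t) (z r) \<le> e" for s t e
  proof -
    let ?Pt = "\<lambda>x. excess_slope k d (z t x)"
    have inT: "t \<in> {0..T}" "s \<in> {0..T}" using st by auto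
    have "\<Phi> t - \<Phi> s = (\<integral>x. excess k d (z t x) - excess k d (z s x) \<partial>\<nu>)"
      using J[OF inT(1)] J[OF inT(2)] by (simp add: \<Phi>_def)
    also have "\<dots> \<le> (\<integral>x. (z t x - z s x) * ?Pt x \<partial>\<nu>)"
    proof (rule integral_mono)
      show "excess k d (z t x) - excess k d (z s x) \<le> (z t x - z s x) * ?Pt x" for x
        using excess_convex[OF d, of k "z t x" "z s x"] by (simp only: mult.commute)
    qed (use J[OF inT(1)] J[OF inT(2)] L2_integrable_mult[OF L2_diff[OF zL[OF inT(1)] zL[OF inT(2)]] P[OF inT(1)]] in auto)
    also have "\<dots> = L2_inner \<nu> (\<lambda>x. (v t x - v s x) - (w t x - w s x)) ?Pt"
      by (simp add: L2_inner_def z_def algebra_simps)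
    also have "\<dots> = L2_inner \<nu> (\<lambda>x. v t x - v s x) ?Pt - L2_inner \<nu> (\<lambda>x. w t x - w s x) ?Pt"
      by (intro L2_inner_diff_left L2_diff vL wL P inT)
    also have "\<dots> = (\<integral>r. L2_inner \<nu> (v' r) ?Pt \<partial>lebesgue_on {s..t}) - (\<integral>r. L2_inner \<nu> (w' r) ?Pt \<partial>lebesgue_on {s..t})"
      using W11_increment[OF cv Wv P[OF inT(1)] st] W11_increment[OF cw Ww P[OF inT(1)] st] by simp
    also have "\<dots> = (\<integral>r. L2_inner \<nu> (v' r) ?Pt - L2_inner \<nu> (w' r) ?Pt \<partial>lebesgue_on {s..t})"
      using L1_loc_inner_integrable[OF L1(1) P[OF inT(1)] st(1,3)] L1_loc_inner_integrable[OF L1(2) P[OF inT(1)] st(1,3)]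
      by simp
    also have "\<dots> \<le> (\<integral>r. e * Z r \<partial>lebesgue_on {s..t})"
    proof (rule integral_mono_AE)
      show "integrable (lebesgue_on {s..t}) (\<lambda>r. L2_inner \<nu> (v' r) ?Pt - L2_inner \<nu> (w' r) ?Pt)"
        by (intro Bochner_Integration.integrable_diff L1_loc_inner_integrable[OF _ P[OF inT(1)] st(1,3)] L1)
      show "integrable (lebesgue_on {s..t}) (\<lambda>r. e * Z r)" using Zi[OF st(1,3)] by simp
      have "AE r in lebesgue. r \<in> {0<..<T} \<longrightarrow> L2_inner \<nu> (\<lambda>x. v' r x - w' r x) (\<lambda>x. excess_slope k d (z r x)) \<le> 0"
        using acc by (simp add: AE_restrict_space_iff)
      then have "AE r in lebesgue. r \<in> {s..t} \<longrightarrow> L2_inner \<nu> (v' r) ?Pt - L2_inner \<nu> (w' r) ?Pt \<le> e * Z r"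
      proof eventually_elim
        case (elim r)
        show ?case
        proof
          assume r: "r \<in> {s..t}"
          then have rT: "r \<in> {0<..<T}" "r \<in> {0..T}" using st by auto
          let ?Pr = "\<lambda>x. excess_slope k d (z r x)"
          let ?D = "\<lambda>x. v' r x - w' r x"
          have D: "?D \<in> L2_space \<nu>" by (intro L2_diff v'L rT)
          have "L2_dist \<nu> ?Pt ?Pr \<le> L2_dist \<nu> (z t) (z r)"
          proof (rule L2_norm_mono[OF L2_diff[OF zL[OF inT(1)] zL[OF rT(2)]]])
            show "(\<lambda>x. ?Pt x - ?Pr x) \<in> borel_measurable \<nu>"
              using L2_spaceD(1)[OF L2_diff[OF P[OF inT(1)] P[OF rT(2)]]] .
            show "AE x in \<nu>. \<bar>?Pt x - ?Pr x\<bar> \<le> \<bar>z t x - z r x\<bar>"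
              using lipschitz_onD[OF excess_slope_Lipschitz] by (auto simp: dist_real_def)
          qed
          also have "\<dots> \<le> e" by (rule close[OF r])
          finally have Pe: "L2_dist \<nu> ?Pt ?Pr \<le> e" .
          have Dn: "L2_norm \<nu> ?D \<le> Z r"
            using L2_norm_triangle[OF v'L(1)[OF rT(1)] L2_minus[OF v'L(2)[OF rT(1)]]]
            by (simp add: Z_def L2_norm_minus)
          \<comment> \<open>The slope at time \<open>t\<close> is replaced by the one at time \<open>r\<close>, against which the velocity is accretive.\<close>
          have "L2_inner \<nu> (v' r) ?Pt - L2_inner \<nu> (w' r) ?Pt = L2_inner \<nu> ?D ?Pt"
            by (rule L2_inner_diff_left[symmetric]) (intro v'L rT P inT)+
          also have "\<dots> = L2_inner \<nu> ?D ?Pr + L2_inner \<nu> (\<lambda>x. ?Pt x - ?Pr x) ?D"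
            using L2_inner_diff_left[OF P[OF inT(1)] P[OF rT(2)] D] by (simp add: L2_inner_commute)
          also have "\<dots> \<le> L2_inner \<nu> (\<lambda>x. ?Pt x - ?Pr x) ?D"
            using elim rT by simp
          also have "\<dots> \<le> L2_dist \<nu> ?Pt ?Pr * L2_norm \<nu> ?D"
            using L2_inner_le[OF L2_diff[OF P[OF inT(1)] P[OF rT(2)]] D] by simp
          also have "\<dots> \<le> e * Z r"
            by (rule mult_mono[OF Pe Dn e L2_norm_nonneg])
          finally show "L2_inner \<nu> (v' r) ?Pt - L2_inner \<nu> (w' r) ?Pt \<le> e * Z r" .
        qed
      qed
      then show "AE r in lebesgue_on {s..t}. L2_inner \<nu> (v' r) ?Pt - L2_inner \<nu> (w' r) ?Pt \<le> e * Z r"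
        by (simp add: AE_restrict_space_iff)
    qed
    also have "\<dots> = e * integral {s..t} Z"
      using lebesgue_integral_eq_integral[OF Zi[OF st(1,3)]] by simp
    finally show ?thesis .
  qed
  have global: "\<Phi> b - \<Phi> a \<le> e * integral {a..b} Z" if e: "e > 0" for e
  proof -
    define Q where "Q s t \<longleftrightarrow> (a \<le> s \<and> s \<le> t \<and> t \<le> b \<longrightarrow> \<Phi> t - \<Phi> s \<le> e * integral {s..t} Z)" for s t
    have "Q a b"
      using ab(2)
    proof (rule Bolzano)
      fix r s t assume trans: "Q r s" "Q s t" "r \<le> s" "s \<le> t"
      show "Q r t"
        unfolding Q_def
      proof
        assume rt: "a \<le> r \<and> r \<le> t \<and> t \<le> b"
        have "integral {r..s} Z + integral {s..t} Z = integral {r..t} Z"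
          by (rule Henstock_Kurzweil_Integration.integral_combine)
             (use trans rt ab in \<open>auto intro!: integrable_on_lebesgue_on Zi\<close>)
        then have "e * integral {r..s} Z + e * integral {s..t} Z = e * integral {r..t} Z"
          by (simp flip: distrib_left)
        then show "\<Phi> t - \<Phi> r \<le> e * integral {r..t} Z" using trans rt by (auto simp: Q_def)
      qed
    next
      fix r assume r_in: "a \<le> r" "r \<le> b"
      have rT: "r \<in> {0..T}" using r_in ab by auto
      have "((\<lambda>s. L2_dist \<nu> (v s) (v r) + L2_dist \<nu> (w s) (w r)) \<longlongrightarrow> 0 + 0) (at r within {0..T})"
        using cv cw rT by (intro tendsto_add) (auto simp: continuous_L2_def)
      then have "\<forall>\<^sub>F s in at r within {0..T}. L2_dist \<nu> (v s) (v r) + L2_dist \<nu> (w s) (w r) < e / 2"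
        by (rule order_tendstoD) (use e in simp)
      then obtain \<delta> where \<delta>: "\<delta> > 0" "\<And>s. s \<in> {0..T} \<Longrightarrow> s \<noteq> r \<Longrightarrow> dist s r < \<delta> \<Longrightarrow>
          L2_dist \<nu> (v s) (v r) + L2_dist \<nu> (w s) (w r) < e / 2"
        unfolding eventually_at by blast
      have near: "L2_dist \<nu> (z s) (z r) \<le> e / 2" if s: "s \<in> {0..T}" "dist s r < \<delta>" for s
      proof (cases "s = r")
        case True then show ?thesis using e by (simp add: L2_norm_zero)
      next
        case False
        have "L2_dist \<nu> (z s) (z r) = L2_norm \<nu> (\<lambda>x. (v s x - v r x) + - (w s x - w r x))"
          by (simp add: z_def algebra_simps)
        also have "\<dots> \<le> L2_dist \<nu> (v s) (v r) + L2_norm \<nu> (\<lambda>x. - (w s x - w r x))"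
          by (intro L2_norm_triangle L2_minus L2_diff vL wL s rT)
        finally show ?thesis using \<delta>(2)[OF s(1) False s(2)] by (simp only: L2_norm_minus)
      qed
      show "\<exists>d>0. \<forall>s t. s \<le> r \<and> r \<le> t \<and> t - s < d \<longrightarrow> Q s t"
        unfolding Q_def
      proof (intro exI[of _ \<delta>] conjI allI impI \<delta>(1))
        fix s t assume st: "s \<le> r \<and> r \<le> t \<and> t - s < \<delta>" "a \<le> s \<and> s \<le> t \<and> t \<le> b"
        show "\<Phi> t - \<Phi> s \<le> e * integral {s..t} Z"
        proof (rule local_bound)
          fix q assume q: "q \<in> {s..t}"
          then have inT: "q \<in> {0..T}" "t \<in> {0..T}" using st ab by auto
          have "L2_dist \<nu> (z t) (z q) \<le> L2_dist \<nu> (z t) (z r) + L2_dist \<nu> (z r) (z q)"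
            by (intro L2_norm_triangle_diff zL inT rT)
          also have "\<dots> \<le> e / 2 + e / 2"
            unfolding L2_norm_minus_commute[of \<nu> "z r" "z q"]
            by (intro add_mono near inT) (use q st in \<open>auto simp: dist_real_def\<close>)
          finally show "L2_dist \<nu> (z t) (z q) \<le> e" by simp
        qed (use st ab e in auto)
      qed
    qed
    then show ?thesis using ab by (simp add: Q_def)
  qed
  have "\<Phi> b - \<Phi> a \<le> 0"
  proof (rule field_le_epsilon)
    fix e :: real assume e: "e > 0"
    have I0: "0 \<le> integral {a..b} Z"
      by (rule Henstock_Kurzweil_Integration.integral_nonneg)
         (use Zi ab in \<open>auto intro!: integrable_on_lebesgue_on simp: Z_def L2_norm_nonneg\<close>)
    define B where "B = integral {a..b} Z"
    have "\<Phi> b - \<Phi> a \<le> e / (B + 1) * B" using global[of "e / (B + 1)"] e I0 by (simp add: B_def)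
    also have "\<dots> \<le> e" using e I0 by (simp add: B_def field_simps)
    finally show "\<Phi> b - \<Phi> a \<le> 0 + e" by simp
  qed
  then show ?thesis by (simp add: \<Phi>_def z_def)
qed

text \<open>
  The weak derivative says nothing about time \<open>0\<close>, which is reached by continuity in \<open>L\<^sup>2\<close>.
\<close>

lemma excess_le_initial:
  assumes v: "strong_solution m \<nu> f lam T v0 v" and w: "strong_solution m \<nu> f lam T w0 w"
    and lam: "lam > 0" and k: "k \<ge> 0" and d: "d > 0" and t: "0 < t" "t < T"
  shows "(\<integral>x. excess k d (v t x - w t x) \<partial>\<nu>) \<le> (\<integral>x. excess k d (v 0 x - w 0 x) \<partial>\<nu>)"
proof -
  have cv: "continuous_L2 \<nu> T v" and cw: "continuous_L2 \<nu> T w"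
    using v w by (auto simp: strong_solution_def)
  have vL: "v t \<in> L2_space \<nu>" and wL: "w t \<in> L2_space \<nu>" if "t \<in> {0..T}" for t
    using cv cw that by (auto simp: continuous_L2_def)
  define \<Phi> where "\<Phi> t = (\<integral>x. excess k d (v t x - w t x) \<partial>\<nu>)" for t
  have J: "integrable \<nu> (\<lambda>x. excess k d (v t x - w t x))" if "t \<in> {0..T}" for t
    by (rule L2_integrable[OF Lipschitz_L2[OF finite_nu L2_diff[OF vL[OF that] wL[OF that]] excess_Lipschitz[OF d]]])
  have "((\<lambda>s. L2_dist \<nu> (v s) (v 0) + L2_dist \<nu> (w s) (w 0)) \<longlongrightarrow> 0 + 0) (at 0 within {0..T})"
    using cv cw t by (intro tendsto_add) (auto simp: continuous_L2_def)
  then have lim: "((\<lambda>s. d * sqrt (measure \<nu> (space \<nu>)) * (L2_dist \<nu> (v s) (v 0) + L2_dist \<nu> (w s) (w 0))) \<longlongrightarrow> 0) (at 0 within {0..T})"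
    by (intro tendsto_mult_right_zero) simp
  have "((\<lambda>s. \<Phi> s - \<Phi> 0) \<longlongrightarrow> 0) (at 0 within {0..T})"
  proof (rule Lim_null_comparison[OF _ lim])
    show "\<forall>\<^sub>F s in at 0 within {0..T}. norm (\<Phi> s - \<Phi> 0)
      \<le> d * sqrt (measure \<nu> (space \<nu>)) * (L2_dist \<nu> (v s) (v 0) + L2_dist \<nu> (w s) (w 0))"
      unfolding eventually_at_filter
    proof (intro always_eventually allI impI)
      fix s assume s: "s \<in> {0..T}"
      have 0: "0 \<in> {0..T}" using t by simp
      have D: "(\<lambda>x. (v s x - v 0 x) + - (w s x - w 0 x)) \<in> L2_space \<nu>"
        by (intro L2_add L2_minus L2_diff vL wL s 0)
      have "norm (\<Phi> s - \<Phi> 0) = \<bar>\<integral>x. excess k d (v s x - w s x) - excess k d (v 0 x - w 0 x) \<partial>\<nu>\<bar>"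
        using J[OF s] J[OF 0] by (simp add: \<Phi>_def)
      also have "\<dots> \<le> (\<integral>x. \<bar>excess k d (v s x - w s x) - excess k d (v 0 x - w 0 x)\<bar> \<partial>\<nu>)"
        by (rule integral_abs_bound)
      also have "\<dots> \<le> (\<integral>x. d * \<bar>(v s x - v 0 x) + - (w s x - w 0 x)\<bar> \<partial>\<nu>)"
      proof (rule integral_mono)
        show "integrable \<nu> (\<lambda>x. \<bar>excess k d (v s x - w s x) - excess k d (v 0 x - w 0 x)\<bar>)"
          using J[OF s] J[OF 0] by (intro integrable_abs Bochner_Integration.integrable_diff)
        show "integrable \<nu> (\<lambda>x. d * \<bar>(v s x - v 0 x) + - (w s x - w 0 x)\<bar>)"
          by (intro integrable_mult_right integrable_abs L2_integrable D)
        fix x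
        show "\<bar>excess k d (v s x - w s x) - excess k d (v 0 x - w 0 x)\<bar> \<le> d * \<bar>(v s x - v 0 x) + - (w s x - w 0 x)\<bar>"
          using lipschitz_onD[OF excess_Lipschitz[OF d], of "v s x - w s x" "v 0 x - w 0 x"]
          by (simp add: dist_real_def algebra_simps)
      qed
      also have "\<dots> = d * (\<integral>x. \<bar>(v s x - v 0 x) + - (w s x - w 0 x)\<bar> \<partial>\<nu>)" by (rule integral_mult_right_zero)
      also have "\<dots> \<le> d * (sqrt (measure \<nu> (space \<nu>)) * L2_norm \<nu> (\<lambda>x. (v s x - v 0 x) + - (w s x - w 0 x)))"
        by (intro mult_left_mono L1_norm_le_L2_norm[OF finite_nu D]) (use d in simp)
      also have "\<dots> \<le> d * (sqrt (measure \<nu> (space \<nu>)) * (L2_dist \<nu> (v s) (v 0) + L2_norm \<nu> (\<lambda>x. - (w s x - w 0 x))))"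
        by (intro mult_left_mono L2_norm_triangle L2_minus L2_diff vL wL s 0) (use d in auto)
      finally show "norm (\<Phi> s - \<Phi> 0)
        \<le> d * sqrt (measure \<nu> (space \<nu>)) * (L2_dist \<nu> (v s) (v 0) + L2_dist \<nu> (w s) (w 0))"
        by (simp only: L2_norm_minus mult.assoc)
    qed
  qed
  then have "(\<Phi> \<longlongrightarrow> \<Phi> 0) (at 0 within {0..T})" by (rule LIM_zero_cancel)
  then have "(\<Phi> \<longlongrightarrow> \<Phi> 0) (at 0 within {0<..<t})"
    by (rule tendsto_within_subset) (use t in auto)
  moreover have "\<forall>\<^sub>F s in at 0 within {0<..<t}. \<Phi> t \<le> \<Phi> s"
    unfolding eventually_at_filter
    using excess_decreasing[OF v w lam k d] t by (auto intro!: always_eventually simp: \<Phi>_def)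
  moreover have "at 0 within {0<..<t} \<noteq> bot"
    using t by (simp add: at_within_eq_bot_iff islimpt_greaterThanLessThan1 flip: trivial_limit_within)
  ultimately have "\<Phi> t \<le> \<Phi> 0" by (intro tendsto_lowerbound)
  then show ?thesis by (simp add: \<Phi>_def)
qed

text \<open>
  Divided by \<open>d\<close>, the excess deviates from the positive part by at most \<open>d / 2\<close>; now \<open>d\<close> tends to zero.
\<close>

lemma positive_part_contraction:
  assumes v: "strong_solution m \<nu> f lam T v0 v" and w: "strong_solution m \<nu> f lam T w0 w"
    and lam: "lam > 0" and k: "k \<ge> 0" and t: "0 < t" "t < T"
  shows "(\<integral>x. max 0 (v t x - w t x - k) \<partial>\<nu>) \<le> (\<integral>x. max 0 (v 0 x - w 0 x - k) \<partial>\<nu>)"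
proof -
  interpret N: finite_measure \<nu> by (rule finite_nu)
  have cv: "continuous_L2 \<nu> T v" and cw: "continuous_L2 \<nu> T w"
    using v w by (auto simp: strong_solution_def)
  have zL: "(\<lambda>x. v t x - w t x) \<in> L2_space \<nu>" if "t \<in> {0..T}" for t
    using cv cw that by (intro L2_diff) (auto simp: continuous_L2_def)
  have zI: "integrable \<nu> (\<lambda>x. max 0 (v t x - w t x - k))" if "t \<in> {0..T}" for t
    using L2_integrable[OF zL[OF that]] by auto
  have J: "integrable \<nu> (\<lambda>x. excess k d (v t x - w t x))" if "t \<in> {0..T}" "d > 0" for t d
    by (rule L2_integrable[OF Lipschitz_L2[OF finite_nu zL[OF that(1)] excess_Lipschitz[OF that(2)]]])
  let ?V = "measure \<nu> (space \<nu>)"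
  have tT: "t \<in> {0..T}" "0 \<in> {0..T}" using t by auto
  have step: "(\<integral>x. max 0 (v t x - w t x - k) \<partial>\<nu>) \<le> (\<integral>x. max 0 (v 0 x - w 0 x - k) \<partial>\<nu>) + d / 2 * ?V" if d: "d > 0" for d
  proof -
    have "d * (\<integral>x. max 0 (v t x - w t x - k) \<partial>\<nu>) - d\<^sup>2 / 2 * ?V = (\<integral>x. d * max 0 (v t x - w t x - k) - d\<^sup>2 / 2 \<partial>\<nu>)"
      using zI[OF tT(1)] by simp
    also have "\<dots> \<le> (\<integral>x. excess k d (v t x - w t x) \<partial>\<nu>)"
      by (rule integral_mono) (use zI[OF tT(1)] J[OF tT(1) d] excess_approx(2)[OF d] in auto)
    also have "\<dots> \<le> (\<integral>x. excess k d (v 0 x - w 0 x) \<partial>\<nu>)" by (rule excess_le_initial[OF v w lam k d t])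
    also have "\<dots> \<le> (\<integral>x. d * max 0 (v 0 x - w 0 x - k) \<partial>\<nu>)"
      by (rule integral_mono) (use zI[OF tT(2)] J[OF tT(2) d] excess_approx(1)[OF d] in auto)
    finally have "d * (\<integral>x. max 0 (v t x - w t x - k) \<partial>\<nu>) \<le> d * ((\<integral>x. max 0 (v 0 x - w 0 x - k) \<partial>\<nu>) + d / 2 * ?V)"
      by (simp add: power2_eq_square algebra_simps)
    then show ?thesis using d by simp
  qed
  show ?thesis
  proof (rule field_le_epsilon)
    fix e :: real assume e: "e > 0"
    define d where "d = e / (?V + 1)"
    have V: "0 < ?V + 1" by (simp add: add_nonneg_pos)
    have "d > 0" using e V by (simp add: d_def)
    have "d * ?V \<le> d * (?V + 1)" using \<open>d > 0\<close> by simp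
    also have "\<dots> = e" using V by (simp add: d_def)
    finally have "d / 2 * ?V \<le> e"
      using mult_nonneg_nonneg[OF less_imp_le[OF \<open>d > 0\<close>] measure_nonneg[of \<nu> "space \<nu>"]] by simp
    then show "(\<integral>x. max 0 (v t x - w t x - k) \<partial>\<nu>) \<le> (\<integral>x. max 0 (v 0 x - w 0 x - k) \<partial>\<nu>) + e"
      using step[OF \<open>d > 0\<close>] by linarith
  qed
qed

lemma excess_contraction:
  assumes v: "strong_solution m \<nu> f lam T v0 v" and w: "strong_solution m \<nu> f lam T w0 w"
    and lam: "lam > 0" and k: "k \<ge> 0" and t: "0 < t" "t < T"
  shows "(\<integral>x. max 0 (\<bar>v t x - w t x\<bar> - k) \<partial>\<nu>) \<le> (\<integral>x. max 0 (\<bar>v 0 x - w 0 x\<bar> - k) \<partial>\<nu>)"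
proof -
  interpret N: finite_measure \<nu> by (rule finite_nu)
  have cv: "continuous_L2 \<nu> T v" and cw: "continuous_L2 \<nu> T w"
    using v w by (auto simp: strong_solution_def)
  have zI: "integrable \<nu> (\<lambda>x. v t x - w t x)" if "t \<in> {0..T}" for t
    using cv cw that by (intro L2_integrable L2_diff) (auto simp: continuous_L2_def)
  have zI': "integrable \<nu> (\<lambda>x. w t x - v t x)" if "t \<in> {0..T}" for t
    using cv cw that by (intro L2_integrable L2_diff) (auto simp: continuous_L2_def)
  have split: "max 0 (\<bar>r - s\<bar> - k) = max 0 (r - s - k) + max 0 (s - r - k)" for r s
    using k by (simp add: max_def abs_if)
  have eq: "(\<integral>x. max 0 (\<bar>v t x - w t x\<bar> - k) \<partial>\<nu>) = (\<integral>x. max 0 (v t x - w t x - k) \<partial>\<nu>) + (\<integral>x. max 0 (w t x - v t x - k) \<partial>\<nu>)"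
    if "t \<in> {0..T}" for t
    unfolding split by (rule Bochner_Integration.integral_add) (use zI[OF that] zI'[OF that] in auto)
  show ?thesis
    using eq[of t] eq[of 0] t positive_part_contraction[OF v w lam k t] positive_part_contraction[OF w v lam k t] by simp
qed

end

section \<open>From the excess to all Lebesgue norms\<close>

text \<open>
  Two integrations by parts, packed into the primitive \<open>G\<close>.  For \<open>q < 2\<close> the integrand is singular at
  \<open>0\<close>, where \<open>G\<close> is only continuous, so the fundamental theorem is used on the interior.
\<close>

lemma powr_layer_cake:
  assumes q: "q > 1" and r: "r \<ge> 0"
  shows "(\<integral>\<^sup>+k\<in>{0<..}. ennreal (q * (q - 1) * k powr (q - 2) * max 0 (r - k)) \<partial>lborel) = ennreal (r powr q)"
proof -
  define G where "G k = q * r * k powr (q - 1) - (q - 1) * k powr q" for k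
  define h where "h k = q * (q - 1) * k powr (q - 2) * (r - k)" for k
  have cont: "continuous_on {0..r} G"
    unfolding G_def[abs_def]
    by (intro continuous_on_diff continuous_on_mult continuous_on_const continuous_on_powr' continuous_on_id)
       (use q in auto)
  have DG: "(G has_real_derivative h k) (at k)" if "k \<in> {0<..<r}" for k
  proof -
    have "(G has_real_derivative q * r * ((q - 1) * k powr (q - 1 - 1)) - (q - 1) * (q * k powr (q - 1))) (at k)"
      unfolding G_def[abs_def]
      by (intro DERIV_diff DERIV_cmult has_real_derivative_powr) (use that in auto)
    moreover have "k powr (q - 1) = k * k powr (q - 2)"
      using that powr_add[of k 1 "q - 2"] by simp
    moreover have "q - 1 - 1 = q - 2" by simp
    ultimately show ?thesis by (simp add: h_def algebra_simps)
  qed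
  have "(h has_integral (G r - G 0)) {0..r}"
    by (rule fundamental_theorem_of_calculus_interior[OF r cont])
       (use DG in \<open>simp add: has_real_derivative_iff_has_vector_derivative\<close>)
  moreover have "G r - G 0 = r powr q"
  proof (cases "r = 0")
    case False
    then have "r powr q = r * r powr (q - 1)" using r powr_add[of r 1 "q - 1"] by simp
    then show ?thesis using q by (simp add: G_def algebra_simps)
  qed (use q in \<open>simp add: G_def\<close>)
  ultimately have hi: "(h has_integral r powr q) {0..r}" by simp
  have h0: "0 \<le> h k" if "k \<in> {0..r}" for k using that q by (simp add: h_def)
  have [measurable]: "h \<in> borel_measurable borel" unfolding h_def[abs_def] by measurable
  have "(\<integral>\<^sup>+k\<in>{0<..}. ennreal (q * (q - 1) * k powr (q - 2) * max 0 (r - k)) \<partial>lborel)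
      = (\<integral>\<^sup>+k. ennreal (indicator {0..r} k * h k) \<partial>lborel)"
  proof (rule nn_integral_cong_AE)
    have "AE k in lborel. k \<noteq> (0::real)" by (rule AE_lborel_singleton)
    then show "AE k in lborel. ennreal (q * (q - 1) * k powr (q - 2) * max 0 (r - k)) * indicator {0<..} k
        = ennreal (indicator {0..r} k * h k)"
      by eventually_elim (auto simp: h_def indicator_def max_def)
  qed
  also have "\<dots> = ennreal (r powr q)"
    by (rule nn_integral_has_integral_lebesgue[OF h0 hi])
  finally show ?thesis .
qed

text \<open>
  For finite \<open>q > 1\<close> the powers are superpositions of excesses with nonnegative weights; for \<open>q = 1\<close> the
  level \<open>k = 0\<close> suffices, and for \<open>q = \<infinity>\<close> the level given by the essential supremum of \<open>w\<close>.
\<close>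

lemma Lq_norm_le_of_excess:
  fixes u w :: "'a \<Rightarrow> real"
  assumes fin: "finite_measure N" and u: "integrable N u" and w: "integrable N w"
    and le: "\<And>k. 0 \<le> k \<Longrightarrow> (\<integral>x. max 0 (\<bar>u x\<bar> - k) \<partial>N) \<le> (\<integral>x. max 0 (\<bar>w x\<bar> - k) \<partial>N)"
    and q: "1 \<le> q"
  shows "Lq_norm N q u \<le> Lq_norm N q w"
proof -
  interpret finite_measure N by fact
  have [measurable]: "u \<in> borel_measurable N" "w \<in> borel_measurable N" using u w by auto
  have ui: "integrable N (\<lambda>x. max 0 (\<bar>u x\<bar> - k))" and wi: "integrable N (\<lambda>x. max 0 (\<bar>w x\<bar> - k))" for k
    using u w by auto
  have nn_le: "(\<integral>\<^sup>+x. ennreal (max 0 (\<bar>u x\<bar> - k)) \<partial>N) \<le> (\<integral>\<^sup>+x. ennreal (max 0 (\<bar>w x\<bar> - k)) \<partial>N)" if "0 \<le> k" for k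
  proof -
    have "(\<integral>\<^sup>+x. ennreal (max 0 (\<bar>u x\<bar> - k)) \<partial>N) = ennreal (\<integral>x. max 0 (\<bar>u x\<bar> - k) \<partial>N)"
      by (rule nn_integral_eq_integral[OF ui]) simp
    also have "\<dots> \<le> ennreal (\<integral>x. max 0 (\<bar>w x\<bar> - k) \<partial>N)" by (rule ennreal_leI[OF le[OF that]])
    also have "\<dots> = (\<integral>\<^sup>+x. ennreal (max 0 (\<bar>w x\<bar> - k)) \<partial>N)"
      by (rule nn_integral_eq_integral[OF wi, symmetric]) simp
    finally show ?thesis .
  qed
  show ?thesis
  proof (cases "q = \<infinity>")
    case True
    let ?K = "esssup N (\<lambda>x. ennreal \<bar>w x\<bar>)"
    have "esssup N (\<lambda>x. ennreal \<bar>u x\<bar>) \<le> ?K"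
    proof (cases "?K = \<infinity>")
      case False
      then obtain k where k: "?K = ennreal k" "0 \<le> k" by (cases ?K) auto
      have "AE x in N. ennreal \<bar>w x\<bar> \<le> ?K" by (rule esssup_AE)
      then have "AE x in N. max 0 (\<bar>w x\<bar> - k) = 0"
        by eventually_elim (use k in \<open>auto simp: max_def\<close>)
      then have "(\<integral>x. max 0 (\<bar>w x\<bar> - k) \<partial>N) = (\<integral>x. 0 \<partial>N)" by (intro integral_cong_AE) auto
      then have "(\<integral>x. max 0 (\<bar>u x\<bar> - k) \<partial>N) \<le> 0" using le[OF k(2)] by simp
      then have "(\<integral>x. max 0 (\<bar>u x\<bar> - k) \<partial>N) = 0" by (intro antisym) (auto intro: integral_nonneg_AE)
      then have "AE x in N. max 0 (\<bar>u x\<bar> - k) = 0"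
        using integral_nonneg_eq_0_iff_AE[OF ui[of k]] by auto
      then have "AE x in N. ennreal \<bar>u x\<bar> \<le> ?K"
        by eventually_elim (use k in \<open>auto simp: max_def intro!: ennreal_leI split: if_splits\<close>)
      then show ?thesis by (intro esssup_I) auto
    qed auto
    then show ?thesis using True by (simp add: Lq_norm_def)
  next
    case False
    then obtain p where p: "q = ennreal p" "p \<ge> 1"
      using q by (cases q) (auto simp: ennreal_1[symmetric] simp del: ennreal_1)
    have I: "(\<integral>\<^sup>+x. ennreal (\<bar>u x\<bar> powr p) \<partial>N) \<le> (\<integral>\<^sup>+x. ennreal (\<bar>w x\<bar> powr p) \<partial>N)"
    proof (cases "p = 1")
      case True
      then show ?thesis using nn_le[of 0] by (simp add: powr_one)
    next
      case False
      then have p1: "p > 1" using p by simp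
      have *: "(\<integral>\<^sup>+x. ennreal (\<bar>s x\<bar> powr p) \<partial>N)
        = (\<integral>\<^sup>+k. ennreal (p * (p - 1) * k powr (p - 2)) * indicator {0<..} k * (\<integral>\<^sup>+x. ennreal (max 0 (\<bar>s x\<bar> - k)) \<partial>N) \<partial>lborel)"
        if [measurable]: "s \<in> borel_measurable N" for s
      proof -
        interpret pair_sigma_finite N lborel ..
        have "(\<integral>\<^sup>+x. ennreal (\<bar>s x\<bar> powr p) \<partial>N)
          = (\<integral>\<^sup>+x. (\<integral>\<^sup>+k. ennreal (p * (p - 1) * k powr (p - 2) * max 0 (\<bar>s x\<bar> - k)) * indicator {0<..} k \<partial>lborel) \<partial>N)"
          by (intro nn_integral_cong powr_layer_cake[symmetric] p1) auto
        also have "\<dots> = (\<integral>\<^sup>+k. (\<integral>\<^sup>+x. ennreal (p * (p - 1) * k powr (p - 2) * max 0 (\<bar>s x\<bar> - k)) * indicator {0<..} k \<partial>N) \<partial>lborel)"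
          by (rule Fubini'[symmetric]) measurable
        also have "\<dots> = (\<integral>\<^sup>+k. ennreal (p * (p - 1) * k powr (p - 2)) * indicator {0<..} k * (\<integral>\<^sup>+x. ennreal (max 0 (\<bar>s x\<bar> - k)) \<partial>N) \<partial>lborel)"
        proof (intro nn_integral_cong)
          fix k :: real
          have "(\<integral>\<^sup>+x. ennreal (p * (p - 1) * k powr (p - 2) * max 0 (\<bar>s x\<bar> - k)) * indicator {0<..} k \<partial>N)
            = (\<integral>\<^sup>+x. (ennreal (p * (p - 1) * k powr (p - 2)) * indicator {0<..} k) * ennreal (max 0 (\<bar>s x\<bar> - k)) \<partial>N)"
            using p1 by (intro nn_integral_cong) (auto simp: ennreal_mult indicator_def)
          also have "\<dots> = ennreal (p * (p - 1) * k powr (p - 2)) * indicator {0<..} k * (\<integral>\<^sup>+x. ennreal (max 0 (\<bar>s x\<bar> - k)) \<partial>N)"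
            by (rule nn_integral_cmult) measurable
          finally show "(\<integral>\<^sup>+x. ennreal (p * (p - 1) * k powr (p - 2) * max 0 (\<bar>s x\<bar> - k)) * indicator {0<..} k \<partial>N)
            = ennreal (p * (p - 1) * k powr (p - 2)) * indicator {0<..} k * (\<integral>\<^sup>+x. ennreal (max 0 (\<bar>s x\<bar> - k)) \<partial>N)" .
        qed
        finally show ?thesis .
      qed
      show ?thesis
        unfolding *[OF \<open>u \<in> borel_measurable N\<close>] *[OF \<open>w \<in> borel_measurable N\<close>]
      proof (rule nn_integral_mono)
        fix k :: real
        show "ennreal (p * (p - 1) * k powr (p - 2)) * indicator {0<..} k * (\<integral>\<^sup>+x. ennreal (max 0 (\<bar>u x\<bar> - k)) \<partial>N)
          \<le> ennreal (p * (p - 1) * k powr (p - 2)) * indicator {0<..} k * (\<integral>\<^sup>+x. ennreal (max 0 (\<bar>w x\<bar> - k)) \<partial>N)"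
          using nn_le[of k] by (cases "0 < k") (auto intro!: mult_left_mono simp: indicator_def)
      qed
    qed
    have p': "enn2real q = p" using p by simp
    show ?thesis
    proof (cases "(\<integral>\<^sup>+x. ennreal (\<bar>w x\<bar> powr p) \<partial>N) = \<infinity>")
      case True
      then show ?thesis using \<open>q \<noteq> \<infinity>\<close> by (simp add: Lq_norm_def p' Let_def)
    next
      case fin: False
      then have fin': "(\<integral>\<^sup>+x. ennreal (\<bar>u x\<bar> powr p) \<partial>N) \<noteq> \<infinity>" using I by (auto simp: top_unique)
      have "enn2real (\<integral>\<^sup>+x. ennreal (\<bar>u x\<bar> powr p) \<partial>N) \<le> enn2real (\<integral>\<^sup>+x. ennreal (\<bar>w x\<bar> powr p) \<partial>N)"
        using I fin by (intro enn2real_mono) (auto simp: less_top)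
      then have "enn2real (\<integral>\<^sup>+x. ennreal (\<bar>u x\<bar> powr p) \<partial>N) powr (1 / p) \<le> enn2real (\<integral>\<^sup>+x. ennreal (\<bar>w x\<bar> powr p) \<partial>N) powr (1 / p)"
        using p by (intro powr_mono2) auto
      then show ?thesis using \<open>q \<noteq> \<infinity>\<close> fin fin' by (simp add: Lq_norm_def p' Let_def ennreal_leI)
    qed
  qed
qed

lemma Lq_norm_cong_AE:
  assumes "u \<in> borel_measurable N" "w \<in> borel_measurable N" and ae: "AE x in N. u x = w x"
  shows "Lq_norm N q u = Lq_norm N q w"
proof -
  have "esssup N (\<lambda>x. ennreal \<bar>u x\<bar>) = esssup N (\<lambda>x. ennreal \<bar>w x\<bar>)"
    by (rule esssup_AE_cong) (use assms in auto)
  moreover have "(\<integral>\<^sup>+x. ennreal (\<bar>u x\<bar> powr r) \<partial>N) = (\<integral>\<^sup>+x. ennreal (\<bar>w x\<bar> powr r) \<partial>N)" for r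
    by (rule nn_integral_cong_AE) (use ae in auto)
  ultimately show ?thesis by (simp add: Lq_norm_def)
qed

context reversible_walk
begin

theorem strong_solution_contraction:
  assumes v: "strong_solution m \<nu> f lam T v0 v" and w: "strong_solution m \<nu> f lam T w0 w"
    and lam: "lam > 0" and t: "0 < t" "t < T" and q: "1 \<le> q"
    and L: "v0 \<in> L2_space \<nu>" "w0 \<in> L2_space \<nu>"
  shows "Lq_norm \<nu> q (\<lambda>x. v t x - w t x) \<le> Lq_norm \<nu> q (\<lambda>x. v0 x - w0 x)"
proof -
  have cv: "continuous_L2 \<nu> T v" and cw: "continuous_L2 \<nu> T w"
    using v w by (auto simp: strong_solution_def)
  have zL: "(\<lambda>x. v t x - w t x) \<in> L2_space \<nu>" if "t \<in> {0..T}" for t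
    using cv cw that by (intro L2_diff) (auto simp: continuous_L2_def)
  have zL: "(\<lambda>x. v t x - w t x) \<in> L2_space \<nu>" "(\<lambda>x. v 0 x - w 0 x) \<in> L2_space \<nu>"
    using zL[of t] zL[of 0] t by auto
  have "Lq_norm \<nu> q (\<lambda>x. v t x - w t x) \<le> Lq_norm \<nu> q (\<lambda>x. v 0 x - w 0 x)"
    by (intro Lq_norm_le_of_excess finite_nu L2_integrable zL excess_contraction[OF v w lam _ t] q)
  also have "\<dots> = Lq_norm \<nu> q (\<lambda>x. v0 x - w0 x)"
  proof (rule Lq_norm_cong_AE)
    show "AE x in \<nu>. v 0 x - w 0 x = v0 x - w0 x"
      using v w by (auto simp: strong_solution_def elim: eventually_elim2)
  qed (use L2_spaceD(1)[OF zL(2)] L2_spaceD(1)[OF L2_diff[OF L]] in auto)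
  finally show ?thesis .
qed

text \<open>
  At interior times this is the decay of the excess at level \<open>0\<close>, that is, of the \<open>L\<^sup>1\<close> distance; the end of
  the interval follows by continuity.
\<close>

theorem strong_solution_unique:
  assumes v: "strong_solution m \<nu> f lam T v0 v" and w: "strong_solution m \<nu> f lam T v0 w"
    and lam: "lam > 0" and t: "t \<in> {0..T}" and T: "T > 0"
  shows "AE x in \<nu>. v t x = w t x"
proof -
  have cv: "continuous_L2 \<nu> T v" and cw: "continuous_L2 \<nu> T w"
    using v w by (auto simp: strong_solution_def)
  have vL: "v t \<in> L2_space \<nu>" and wL: "w t \<in> L2_space \<nu>" if "t \<in> {0..T}" for t
    using cv cw that by (auto simp: continuous_L2_def)
  have zero: "AE x in \<nu>. v 0 x = w 0 x"
    using v w by (auto simp: strong_solution_def elim: eventually_elim2)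
  have inner: "AE x in \<nu>. v s x = w s x" if s: "0 < s" "s < T" for s
  proof -
    have sT: "s \<in> {0..T}" "0 \<in> {0..T}" using s by auto
    have i: "integrable \<nu> (\<lambda>x. \<bar>v s x - w s x\<bar>)" for s' using L2_integrable[OF L2_diff[OF vL wL]] sT by auto
    have "(\<integral>x. max 0 (\<bar>v 0 x - w 0 x\<bar> - 0) \<partial>\<nu>) = (\<integral>x. 0 \<partial>\<nu>)"
      using L2_spaceD(1)[OF L2_diff[OF vL[OF sT(2)] wL[OF sT(2)]]] zero
      by (intro integral_cong_AE) (auto elim: eventually_mono)
    then have "(\<integral>x. \<bar>v s x - w s x\<bar> \<partial>\<nu>) \<le> 0"
      using excess_contraction[OF v w lam order_refl s] by simp
    then have "(\<integral>x. \<bar>v s x - w s x\<bar> \<partial>\<nu>) = 0" by (intro antisym) auto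
    then have "AE x in \<nu>. \<bar>v s x - w s x\<bar> = 0" using integral_nonneg_eq_0_iff_AE[OF i] by auto
    then show ?thesis by auto
  qed
  consider "t = 0" | "0 < t" "t < T" | "t = T" using t by fastforce
  then show ?thesis
  proof cases
    case 3
    have TT: "T \<in> {0..T}" using T by simp
    have "((\<lambda>s. L2_dist \<nu> (v s) (v T) + L2_dist \<nu> (w s) (w T)) \<longlongrightarrow> 0 + 0) (at T within {0..T})"
      using cv cw TT by (intro tendsto_add) (auto simp: continuous_L2_def)
    then have "((\<lambda>s. L2_dist \<nu> (v s) (v T) + L2_dist \<nu> (w s) (w T)) \<longlongrightarrow> 0 + 0) (at T within {0<..<T})"
      by (rule tendsto_within_subset) auto
    then have "((\<lambda>s. L2_dist \<nu> (v s) (v T) + L2_dist \<nu> (w s) (w T)) \<longlongrightarrow> 0) (at T within {0<..<T})"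
      by simp
    moreover have "\<forall>\<^sub>F s in at T within {0<..<T}. L2_dist \<nu> (v T) (w T)
        \<le> L2_dist \<nu> (v s) (v T) + L2_dist \<nu> (w s) (w T)"
      unfolding eventually_at_filter
    proof (intro always_eventually allI impI)
      fix s assume s: "s \<in> {0<..<T}"
      then have sT: "s \<in> {0..T}" by simp
      have "L2_dist \<nu> (v T) (w T) \<le> L2_dist \<nu> (v T) (v s) + L2_dist \<nu> (v s) (w T)"
        by (intro L2_norm_triangle_diff vL wL sT TT)
      also have "L2_dist \<nu> (v s) (w T) = L2_dist \<nu> (w s) (w T)"
        by (rule L2_norm_cong_AE)
           (use inner[of s] s L2_spaceD(1)[OF L2_diff[OF vL[OF sT] wL[OF TT]]] L2_spaceD(1)[OF L2_diff[OF wL[OF sT] wL[OF TT]]] in auto)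
      finally show "L2_dist \<nu> (v T) (w T)
        \<le> L2_dist \<nu> (v s) (v T) + L2_dist \<nu> (w s) (w T)"
        by (simp only: L2_norm_minus_commute[of \<nu> "v T" "v s"])
    qed
    moreover have "at T within {0<..<T} \<noteq> bot"
      using T by (simp add: at_within_eq_bot_iff islimpt_greaterThanLessThan2 flip: trivial_limit_within)
    ultimately have "L2_dist \<nu> (v T) (w T) \<le> 0" by (intro tendsto_lowerbound)
    then have "L2_dist \<nu> (v T) (w T) = 0" by (rule order.antisym[OF _ L2_norm_nonneg])
    then have "AE x in \<nu>. v T x - w T x = 0" by (rule L2_norm_eq_0[OF L2_diff[OF vL[OF TT] wL[OF TT]]])
    then show ?thesis using 3 by auto
  qed (use zero inner in auto)
qed

end

section \<open>The explicit Euler scheme\<close>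

text \<open>
  The infima of the squared norm \<open>Q\<close> over the decreasing sets increase to a limit.  Two elements whose
  squared norms are close to it, and whose midpoint cannot be much shorter, are close to each other by the
  parallelogram law, which is assumed in terms of \<open>Q\<close> and the squared distance \<open>D\<close>.  This takes the place
  of weak compactness.
\<close>

lemma nested_midpoint_convex_Cauchy:
  fixes Q :: "'b \<Rightarrow> real" and D :: "'b \<Rightarrow> 'b \<Rightarrow> real" and mid :: "'b \<Rightarrow> 'b \<Rightarrow> 'b" and E :: "nat \<Rightarrow> 'b set"
  assumes nonempty: "\<And>n. E n \<noteq> {}" and dec: "\<And>n. E (Suc n) \<subseteq> E n"
    and mid: "\<And>n a b. a \<in> E n \<Longrightarrow> b \<in> E n \<Longrightarrow> mid a b \<in> E n"
    and bounds: "\<And>a. a \<in> E 0 \<Longrightarrow> 0 \<le> Q a \<and> Q a \<le> B"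
    and law: "\<And>a b. a \<in> E 0 \<Longrightarrow> b \<in> E 0 \<Longrightarrow> Q (mid a b) = (Q a + Q b) / 2 - D a b / 4"
  shows "\<exists>e. \<forall>n. e n \<in> E n \<and> D (e n) (e (Suc n)) \<le> (1/4) ^ n"
proof -
  have anti: "E n \<subseteq> E m" if "m \<le> n" for m n by (rule lift_Suc_antimono_le[of E, OF dec that])
  have E0: "a \<in> E 0" if "a \<in> E n" for a n using anti[of 0 n] that by auto
  define a where "a n = Inf (Q ` E n)" for n
  have bdd: "bdd_below (Q ` E n)" for n
    using bounds E0 by (intro bdd_belowI[of _ 0]) auto
  have a_le: "a n \<le> Q x" if "x \<in> E n" for n x
    unfolding a_def by (rule cInf_lower[OF _ bdd]) (use that in auto)
  have mono: "a m \<le> a n" if "m \<le> n" for m n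
    unfolding a_def by (rule cInf_superset_mono) (use nonempty bdd anti[OF that] in auto)
  have aB: "a n \<le> B" for n
  proof -
    obtain x where "x \<in> E n" using nonempty[of n] by auto
    then show ?thesis using a_le[of x n] bounds[OF E0] by fastforce
  qed
  define A where "A = Sup (range a)"
  have bddA: "bdd_above (range a)" using aB by (intro bdd_aboveI[of _ B]) auto
  have aA: "a n \<le> A" for n unfolding A_def by (rule cSup_upper[OF _ bddA]) auto
  \<comment> \<open>Elements with \<open>Q\<close> below \<open>A + \<delta>\<close> and a midpoint with \<open>Q\<close> above \<open>A - \<delta>\<close> have \<open>D \<le> 8 * \<delta>\<close>.\<close>
  define \<delta> where "\<delta> n = (1/4::real) ^ n / 8" for n
  have \<delta>0: "\<delta> n > 0" for n by (simp add: \<delta>_def)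
  have "\<exists>k. A - \<delta> n < a k" for n
  proof -
    have "\<exists>y\<in>range a. A - \<delta> n < y"
      unfolding A_def by (rule less_cSupD) (use \<delta>0[of n] in \<open>auto simp: A_def\<close>)
    then show ?thesis by auto
  qed
  then obtain k where k: "\<And>n. A - \<delta> n < a (k n)" by metis
  define \<kappa> where "\<kappa> n = max n (k n)" for n
  have \<kappa>: "A - \<delta> n < a (\<kappa> n)" for n using k[of n] mono[of "k n" "\<kappa> n"] by (simp add: \<kappa>_def)
  have "\<exists>x\<in>E (\<kappa> n). Q x < A + \<delta> n" for n
  proof -
    have "Inf (Q ` E (\<kappa> n)) < A + \<delta> n" using aA[of "\<kappa> n"] \<delta>0[of n] by (simp add: a_def)
    then have "\<exists>y\<in>Q ` E (\<kappa> n). y < A + \<delta> n" by (intro cInf_lessD) (use nonempty in auto)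
    then show ?thesis by auto
  qed
  then obtain e where e: "\<And>n. e n \<in> E (\<kappa> n)" "\<And>n. Q (e n) < A + \<delta> n" by metis
  have "D (e n) (e (Suc n)) \<le> (1/4) ^ n" for n
  proof -
    define j where "j = min (\<kappa> n) (\<kappa> (Suc n))"
    have "e n \<in> E j" "e (Suc n) \<in> E j"
      using e(1)[of n] e(1)[of "Suc n"] anti[of j "\<kappa> n"] anti[of j "\<kappa> (Suc n)"] by (auto simp: j_def)
    then have "a j \<le> Q (mid (e n) (e (Suc n)))" by (intro a_le mid)
    moreover have "\<delta> (Suc n) \<le> \<delta> n" by (simp add: \<delta>_def)
    moreover have "A - \<delta> n \<le> a j"
      using \<kappa>[of n] \<kappa>[of "Suc n"] \<open>\<delta> (Suc n) \<le> \<delta> n\<close> by (auto simp: j_def min_def)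
    moreover have "z \<le> 8 * d" if "l \<le> q" "d' \<le> d" "A - d \<le> l" "q = (x + y) / 2 - z / 4" "x < A + d" "y < A + d'"
      for l q d d' x y z :: real using that by argo
    ultimately have "D (e n) (e (Suc n)) \<le> 8 * \<delta> n"
      using law[OF E0[OF e(1)[of n]] E0[OF e(1)[of "Suc n"]]] e(2)[of n] e(2)[of "Suc n"] by blast
    then show ?thesis by (simp add: \<delta>_def)
  qed
  moreover have "e n \<in> E n" for n using e(1)[of n] anti[of n "\<kappa> n"] by (auto simp: \<kappa>_def)
  ultimately show ?thesis by blast
qed

lemma L2_parallelogram:
  assumes a: "a \<in> L2_space N" and b: "b \<in> L2_space N"
  shows "(L2_norm N (\<lambda>x. (a x + b x) / 2))\<^sup>2
    = ((L2_norm N a)\<^sup>2 + (L2_norm N b)\<^sup>2) / 2 - (L2_dist N a b)\<^sup>2 / 4"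
proof -
  note i = L2_spaceD(2)[OF a] L2_spaceD(2)[OF b] L2_spaceD(2)[OF L2_diff[OF a b]]
  have eq: "((a x + b x) / 2)\<^sup>2 = ((a x)\<^sup>2 + (b x)\<^sup>2) / 2 - (a x - b x)\<^sup>2 / 4" for x
    by (simp add: power2_eq_square field_simps)
  show ?thesis unfolding L2_norm_sq eq using i by simp
qed

locale flow_data = reversible_walk m \<nu> for m :: "'a::polish_space \<Rightarrow> 'a measure" and \<nu> +
  fixes f v0 :: "'a \<Rightarrow> real" and lam T :: real
  assumes f: "integrable \<nu> f" and v0: "v0 \<in> L2_space \<nu>" and lam: "lam > 0" and T: "T > 0"
begin

lemma f_measurable[measurable]: "f \<in> borel_measurable borel"
  using f by (auto simp flip: measurable_nu)

definition drift :: "('a \<Rightarrow> real) \<Rightarrow> 'a \<Rightarrow> real" where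
  "drift u x = TV_grad u x + lam * sgn (u x - f x)"

lemma TV_grad_L2:
  assumes "u \<in> L2_space \<nu>" shows "TV_grad u \<in> L2_space \<nu>"
  by (rule L2_bounded[OF finite_nu, where C=1])
     (use TV_grad_measurable TV_grad_bounded L2_measurable_borel[OF assms] in \<open>auto simp: measurable_nu\<close>)

lemma sgn_L2:
  assumes "u \<in> L2_space \<nu>" shows "(\<lambda>x. sgn (u x - f x)) \<in> L2_space \<nu>"
proof (rule L2_bounded[OF finite_nu, where C=1])
  have [measurable]: "u \<in> borel_measurable borel" by (rule L2_measurable_borel[OF assms])
  show "(\<lambda>x. sgn (u x - f x)) \<in> borel_measurable \<nu>" unfolding measurable_nu by measurable
qed (rule abs_sgn_le_1)

lemma drift_L2: "u \<in> L2_space \<nu> \<Longrightarrow> drift u \<in> L2_space \<nu>"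
  unfolding drift_def[abs_def] by (intro L2_add L2_scale TV_grad_L2 sgn_L2)

lemma drift_bounded:
  assumes "u \<in> L2_space \<nu>" shows "\<bar>drift u x\<bar> \<le> 1 + lam"
proof -
  have "\<bar>lam * sgn (u x - f x)\<bar> \<le> lam" using lam abs_sgn_le_1[of "u x - f x"] by (simp add: abs_mult del: abs_sgn_eq)
  then show ?thesis using TV_grad_bounded[OF L2_measurable_borel[OF assms], of x] by (simp add: drift_def)
qed

text \<open>
  Adding the subgradient inequalities at the two points makes \<open>TV_grad\<close> monotone; the sign is monotone
  pointwise.
\<close>

lemma drift_monotone:
  assumes u: "u \<in> L2_space \<nu>" and w: "w \<in> L2_space \<nu>"
  shows "0 \<le> (\<integral>x. (drift u x - drift w x) * (u x - w x) \<partial>\<nu>)"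
proof -
  have L: "(\<lambda>x. TV_grad u x - TV_grad w x) \<in> L2_space \<nu>" "(\<lambda>x. u x - w x) \<in> L2_space \<nu>"
    "(\<lambda>x. sgn (u x - f x) - sgn (w x - f x)) \<in> L2_space \<nu>"
    by (intro L2_diff TV_grad_L2 sgn_L2 u w)+
  have "L2_inner \<nu> (TV_grad u) (\<lambda>x. w x - u x) = - L2_inner \<nu> (TV_grad u) (\<lambda>x. u x - w x)"
    unfolding L2_inner_def by (subst Bochner_Integration.integral_minus[symmetric]) (simp add: algebra_simps)
  then have "0 \<le> L2_inner \<nu> (TV_grad u) (\<lambda>x. u x - w x) - L2_inner \<nu> (TV_grad w) (\<lambda>x. u x - w x)"
    using TV_grad_subgradient[OF u w] TV_grad_subgradient[OF w u] by simp
  also have "\<dots> = (\<integral>x. (TV_grad u x - TV_grad w x) * (u x - w x) \<partial>\<nu>)"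
    using L2_inner_diff_left[OF TV_grad_L2[OF u] TV_grad_L2[OF w] L(2)] by (simp add: L2_inner_def)
  finally have 1: "0 \<le> (\<integral>x. (TV_grad u x - TV_grad w x) * (u x - w x) \<partial>\<nu>)" .
  have 2: "0 \<le> (\<integral>x. (sgn (u x - f x) - sgn (w x - f x)) * (u x - w x) \<partial>\<nu>)"
  proof (rule Bochner_Integration.integral_nonneg)
    fix x show "0 \<le> (sgn (u x - f x) - sgn (w x - f x)) * (u x - w x)"
      by (cases "u x \<le> w x") (auto simp: sgn_if mult_nonneg_nonneg mult_nonpos_nonpos)
  qed
  have "(\<integral>x. (drift u x - drift w x) * (u x - w x) \<partial>\<nu>)
    = (\<integral>x. (TV_grad u x - TV_grad w x) * (u x - w x) + lam * ((sgn (u x - f x) - sgn (w x - f x)) * (u x - w x)) \<partial>\<nu>)"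
    by (simp add: drift_def algebra_simps)
  also have "\<dots> = (\<integral>x. (TV_grad u x - TV_grad w x) * (u x - w x) \<partial>\<nu>) + lam * (\<integral>x. (sgn (u x - f x) - sgn (w x - f x)) * (u x - w x) \<partial>\<nu>)"
    using L2_integrable_mult[OF L(1,2)] L2_integrable_mult[OF L(3,2)] by simp
  finally show ?thesis using 1 2 lam by simp
qed

definition mesh :: "nat \<Rightarrow> real" where
  "mesh n = T / 2 ^ n"

primrec euler :: "nat \<Rightarrow> nat \<Rightarrow> 'a \<Rightarrow> real" where
  "euler n 0 = v0"
| "euler n (Suc k) = (\<lambda>x. euler n k x - mesh n * drift (euler n k) x)"

abbreviation total_mass :: real where
  "total_mass \<equiv> measure \<nu> (space \<nu>)"

lemma mesh_pos: "mesh n > 0" and mesh_Suc: "mesh (Suc n) = mesh n / 2"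
  using T by (simp_all add: mesh_def)

lemma euler_L2: "euler n k \<in> L2_space \<nu>"
proof (induction k)
  case (Suc k)
  show ?case unfolding euler.simps by (intro L2_diff L2_scale drift_L2 Suc)
qed (simp add: v0)

text \<open>
  One step of the coarse scheme is compared with two steps of the fine one.  Monotonicity makes the
  first order terms nonpositive up to the displacement within a step, so that boundedness of the drift
  suffices for an error of the order of the square of the mesh.
\<close>

lemma euler_refinement:
  "(\<integral>x. (euler n k x - euler (Suc n) (2 * k) x)\<^sup>2 \<partial>\<nu>) \<le> 5 * real k * (mesh n)\<^sup>2 * (1 + lam)\<^sup>2 * total_mass"
proof (induction k)
  case 0 show ?case by simp
next
  case (Suc k)
  interpret N: finite_measure \<nu> by (rule finite_nu)
  define u w w' where "u = euler n k" and "w = euler (Suc n) (2 * k)" and "w' = euler (Suc n) (Suc (2 * k))"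
  define h M where "h = mesh n" and "M = 1 + lam"
  have h0: "h > 0" using mesh_pos by (simp add: h_def)
  have M0: "M > 0" using lam by (simp add: M_def)
  have L: "u \<in> L2_space \<nu>" "w \<in> L2_space \<nu>" "w' \<in> L2_space \<nu>" by (simp_all only: u_def w_def w'_def euler_L2)
  have w': "w' x = w x - h / 2 * drift w x" for x by (simp add: w'_def w_def h_def mesh_Suc)
  have next_diff: "euler n (Suc k) x - euler (Suc n) (2 * Suc k) x
      = (u x - w x) - h / 2 * (2 * drift u x - drift w x - drift w' x)" for x
  proof -
    have "euler (Suc n) (2 * Suc k) x = w' x - h / 2 * drift w' x"
      by (simp add: w'_def[symmetric] h_def mesh_Suc del: euler.simps(2)) (simp add: w'_def h_def mesh_Suc)
    moreover have "euler n (Suc k) x = u x - h * drift u x" by (simp add: u_def h_def)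
    ultimately show ?thesis unfolding w' by (simp add: algebra_simps)
  qed
  have i1: "integrable \<nu> (\<lambda>x. (drift u x - drift w x) * (u x - w x))"
    by (intro L2_integrable_mult L2_diff drift_L2 L)
  have i2: "integrable \<nu> (\<lambda>x. (drift u x - drift w' x) * (u x - w' x))"
    by (intro L2_integrable_mult L2_diff drift_L2 L)
  have i3: "integrable \<nu> (\<lambda>x. (u x - w x)\<^sup>2)" by (intro L2_spaceD(2) L2_diff L)
  have "(\<integral>x. (euler n (Suc k) x - euler (Suc n) (2 * Suc k) x)\<^sup>2 \<partial>\<nu>)
    \<le> (\<integral>x. (u x - w x)\<^sup>2 - h * ((drift u x - drift w x) * (u x - w x)) - h * ((drift u x - drift w' x) * (u x - w' x))
          + 5 * h\<^sup>2 * M\<^sup>2 \<partial>\<nu>)"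
  proof (rule integral_mono)
    show "integrable \<nu> (\<lambda>x. (euler n (Suc k) x - euler (Suc n) (2 * Suc k) x)\<^sup>2)"
      by (intro L2_spaceD(2) L2_diff euler_L2)
    show "integrable \<nu> (\<lambda>x. (u x - w x)\<^sup>2 - h * ((drift u x - drift w x) * (u x - w x)) - h * ((drift u x - drift w' x) * (u x - w' x))
          + 5 * h\<^sup>2 * M\<^sup>2)"
      using i1 i2 i3 by simp
    fix x
    define a b c d where "a = drift u x" and "b = drift w x" and "c = drift w' x" and "d = u x - w x"
    have abc: "\<bar>a\<bar> \<le> M" "\<bar>b\<bar> \<le> M" "\<bar>c\<bar> \<le> M"
      unfolding a_def b_def c_def M_def by (intro drift_bounded L)+
    have "\<bar>b * (a - c)\<bar> \<le> M * (2 * M)"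
      unfolding abs_mult by (intro mult_mono) (use abc M0 in auto)
    then have 1: "h\<^sup>2 * (b * (a - c)) \<le> h\<^sup>2 * (2 * M\<^sup>2)"
      by (intro mult_left_mono) (auto simp: power2_eq_square)
    have "\<bar>2 * a - b - c\<bar> \<le> 4 * M" using abc by linarith
    then have "(2 * a - b - c)\<^sup>2 \<le> (4 * M)\<^sup>2" by (metis abs_ge_zero power2_abs power_mono)
    then have 2: "h\<^sup>2 * (2 * a - b - c)\<^sup>2 \<le> h\<^sup>2 * (16 * M\<^sup>2)"
      by (intro mult_left_mono) (auto simp: power_mult_distrib)
    \<comment> \<open>The two remainders are bounded by \<open>2 * M\<^sup>2 / 2\<close> and \<open>16 * M\<^sup>2 / 4\<close>, whence the constant \<open>5\<close>.\<close>
    have "(d - h / 2 * (2 * a - b - c))\<^sup>2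
      = d\<^sup>2 - h * ((a - b) * d) - h * ((a - c) * (d + h / 2 * b)) + (h\<^sup>2 * (b * (a - c))) / 2 + (h\<^sup>2 * (2 * a - b - c)\<^sup>2) / 4"
      by (simp add: power2_eq_square field_simps)
    also have "\<dots> \<le> d\<^sup>2 - h * ((a - b) * d) - h * ((a - c) * (d + h / 2 * b)) + 5 * h\<^sup>2 * M\<^sup>2"
      using 1 2 by simp
    finally show "(euler n (Suc k) x - euler (Suc n) (2 * Suc k) x)\<^sup>2
      \<le> (u x - w x)\<^sup>2 - h * ((drift u x - drift w x) * (u x - w x)) - h * ((drift u x - drift w' x) * (u x - w' x))
          + 5 * h\<^sup>2 * M\<^sup>2"
      unfolding next_diff by (simp add: a_def b_def c_def d_def w' algebra_simps)
  qed
  also have "\<dots> = (\<integral>x. (u x - w x)\<^sup>2 \<partial>\<nu>) - h * (\<integral>x. (drift u x - drift w x) * (u x - w x) \<partial>\<nu>)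
      - h * (\<integral>x. (drift u x - drift w' x) * (u x - w' x) \<partial>\<nu>) + 5 * h\<^sup>2 * M\<^sup>2 * total_mass"
    using i1 i2 i3 by simp
  also have "\<dots> \<le> (\<integral>x. (u x - w x)\<^sup>2 \<partial>\<nu>) + 5 * h\<^sup>2 * M\<^sup>2 * total_mass"
    using mult_nonneg_nonneg[OF less_imp_le[OF h0] drift_monotone[OF L(1,2)]]
      mult_nonneg_nonneg[OF less_imp_le[OF h0] drift_monotone[OF L(1,3)]] by linarith
  also have "\<dots> \<le> 5 * real (Suc k) * h\<^sup>2 * M\<^sup>2 * total_mass"
    using Suc by (simp add: u_def w_def h_def M_def algebra_simps)
  finally show ?case by (simp only: h_def M_def)
qed

definition grid_index :: "nat \<Rightarrow> real \<Rightarrow> nat" where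
  "grid_index n t = nat \<lfloor>t / mesh n\<rfloor>"

definition approx :: "nat \<Rightarrow> real \<Rightarrow> 'a \<Rightarrow> real" where
  "approx n t = euler n (grid_index n t)"

text \<open>
  The errors are of the order of the square root of the mesh, so halving the mesh multiplies them by this factor.
\<close>

definition rate :: real where
  "rate = sqrt (1 / 2)"

text \<open>
  A bound for the \<open>L\<^sup>2\<close> length of a path of duration \<open>T\<close> whose velocity is at most \<open>1 + lam\<close>
  everywhere.
\<close>

definition scale :: real where
  "scale = T * (1 + lam) * sqrt total_mass"

lemma rate: "0 < rate" "rate < 1" "rate\<^sup>2 = 1 / 2"
  by (simp_all add: rate_def)

lemma mesh_rate: "mesh n = T * (rate ^ n)\<^sup>2"
proof -
  have "(rate ^ n)\<^sup>2 = (rate\<^sup>2) ^ n" by (simp flip: power_mult add: mult.commute)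
  also have "\<dots> = (1 / 2) ^ n" by (simp only: rate(3))
  finally show ?thesis by (simp add: mesh_def power_one_over)
qed

lemma scale_nonneg: "0 \<le> scale"
  using T lam by (simp add: scale_def)

lemma grid_index_le:
  assumes "t \<in> {0..T}" shows "grid_index n t \<le> 2 ^ n" "real (grid_index n t) * mesh n \<le> t" "t - real (grid_index n t) * mesh n \<le> mesh n"
proof -
  have nn: "0 \<le> t / mesh n" using assms mesh_pos[of n] by simp
  have r: "real (grid_index n t) = of_int \<lfloor>t / mesh n\<rfloor>" using nn by (simp add: grid_index_def)
  have "real (grid_index n t) \<le> t / mesh n" unfolding r by simp
  then show 1: "real (grid_index n t) * mesh n \<le> t" using mesh_pos[of n] by (simp add: pos_le_divide_eq)
  have "t / mesh n \<le> 2 ^ n" using assms T by (simp add: mesh_def field_simps)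
  then have "\<lfloor>t / mesh n\<rfloor> \<le> 2 ^ n" by (simp add: floor_le_iff)
  then show "grid_index n t \<le> 2 ^ n" by (simp add: grid_index_def nat_le_iff)
  have "t / mesh n \<le> real (grid_index n t) + 1" unfolding r by linarith
  then have "t \<le> (real (grid_index n t) + 1) * mesh n" using mesh_pos[of n] by (simp add: pos_divide_le_eq)
  then show "t - real (grid_index n t) * mesh n \<le> mesh n" by (simp add: algebra_simps)
qed

lemma grid_index_Suc:
  assumes "t \<in> {0..T}"
  shows "grid_index (Suc n) t = 2 * grid_index n t \<or> grid_index (Suc n) t = Suc (2 * grid_index n t)"
proof -
  define y where "y = t / mesh n"
  have y: "0 \<le> y" using assms mesh_pos[of n] by (simp add: y_def)
  have "t / mesh (Suc n) = 2 * y" by (simp add: mesh_Suc y_def)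
  moreover have "\<lfloor>2 * y\<rfloor> = 2 * \<lfloor>y\<rfloor> \<or> \<lfloor>2 * y\<rfloor> = 2 * \<lfloor>y\<rfloor> + 1" by linarith
  moreover have "0 \<le> \<lfloor>y\<rfloor>" using y by simp
  ultimately show ?thesis by (auto simp: grid_index_def y_def[symmetric] nat_mult_distrib nat_add_distrib)
qed

lemma approx_L2: "approx n t \<in> L2_space \<nu>"
  by (simp add: approx_def euler_L2)

lemma norm_drift_le:
  assumes "u \<in> L2_space \<nu>" "0 \<le> s" "s \<le> mesh n"
  shows "L2_norm \<nu> (\<lambda>x. s * drift u x) \<le> scale * rate ^ n"
proof -
  have "L2_norm \<nu> (drift u) \<le> \<bar>1 + lam\<bar> * sqrt total_mass"
    by (rule L2_norm_bounded[OF finite_nu]) (use drift_L2[OF assms(1)] drift_bounded[OF assms(1)] in \<open>auto dest: L2_spaceD(1)\<close>)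
  then have "s * L2_norm \<nu> (drift u) \<le> mesh n * ((1 + lam) * sqrt total_mass)"
    using assms lam by (intro mult_mono) (auto simp: L2_norm_nonneg)
  also have "\<dots> = scale * (rate ^ n)\<^sup>2" by (simp add: mesh_rate scale_def)
  also have "\<dots> \<le> scale * rate ^ n"
  proof (rule mult_left_mono[OF _ scale_nonneg])
    have "rate ^ n \<le> 1" using rate by (intro power_le_one) auto
    then show "(rate ^ n)\<^sup>2 \<le> rate ^ n" using rate(1) by (simp add: power2_eq_square mult_left_le)
  qed
  finally show ?thesis using assms by (simp add: L2_norm_scale)
qed

lemma approx_Cauchy:
  assumes t: "t \<in> {0..T}"
  shows "L2_dist \<nu> (approx (Suc n) t) (approx n t) \<le> 4 * scale * rate ^ n"
proof -
  define k where "k = grid_index n t"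
  have kh: "real k * mesh n \<le> T" using grid_index_le(2)[OF t, of n] t by (simp add: k_def)
  have "L2_dist \<nu> (euler n k) (euler (Suc n) (2 * k)) \<le> 3 * scale * rate ^ n"
  proof (rule power2_le_imp_le)
    have "(L2_dist \<nu> (euler n k) (euler (Suc n) (2 * k)))\<^sup>2 \<le> 5 * real k * (mesh n)\<^sup>2 * (1 + lam)\<^sup>2 * total_mass"
      unfolding L2_norm_sq by (rule euler_refinement)
    also have "\<dots> = 5 * ((real k * mesh n) * mesh n) * ((1 + lam)\<^sup>2 * total_mass)" by (simp add: power2_eq_square)
    also have "\<dots> \<le> 5 * (T * mesh n) * ((1 + lam)\<^sup>2 * total_mass)"
      using kh mesh_pos[of n] by (intro mult_right_mono mult_left_mono) auto
    also have "\<dots> = 5 * (scale * rate ^ n)\<^sup>2"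
      by (simp add: mesh_rate scale_def power_mult_distrib power2_eq_square)
    also have "\<dots> \<le> 9 * (scale * rate ^ n)\<^sup>2" by simp
    also have "\<dots> = (3 * scale * rate ^ n)\<^sup>2" by (simp add: power_mult_distrib)
    finally show "(L2_dist \<nu> (euler n k) (euler (Suc n) (2 * k)))\<^sup>2 \<le> (3 * scale * rate ^ n)\<^sup>2" .
  qed (use scale_nonneg rate in simp)
  then have coarse: "L2_dist \<nu> (euler (Suc n) (2 * k)) (euler n k) \<le> 3 * scale * rate ^ n"
    by (subst L2_norm_minus_commute)
  have fine: "L2_dist \<nu> (approx (Suc n) t) (euler (Suc n) (2 * k)) \<le> scale * rate ^ n"
    using grid_index_Suc[OF t, of n]
  proof
    assume "grid_index (Suc n) t = 2 * grid_index n t"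
    then show ?thesis using scale_nonneg rate by (simp add: approx_def k_def L2_norm_zero)
  next
    assume "grid_index (Suc n) t = Suc (2 * grid_index n t)"
    then have "L2_dist \<nu> (approx (Suc n) t) (euler (Suc n) (2 * k))
        = L2_norm \<nu> (\<lambda>x. - (mesh (Suc n) * drift (euler (Suc n) (2 * k)) x))"
      by (simp add: approx_def k_def)
    then show ?thesis
      using norm_drift_le[OF euler_L2, of "mesh (Suc n)" n] mesh_pos[of n]
      by (simp only: L2_norm_minus) (simp add: mesh_Suc)
  qed
  have "L2_dist \<nu> (approx (Suc n) t) (approx n t)
    \<le> L2_dist \<nu> (approx (Suc n) t) (euler (Suc n) (2 * k)) + L2_dist \<nu> (euler (Suc n) (2 * k)) (approx n t)"
    by (intro L2_norm_triangle_diff approx_L2 euler_L2)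
  also have "\<dots> \<le> 4 * scale * rate ^ n" using coarse fine by (simp add: approx_def k_def[symmetric])
  finally show ?thesis .
qed

lemma euler_limit_exists:
  "\<exists>V. \<forall>t\<in>{0..T}. V t \<in> L2_space \<nu> \<and> (\<forall>n. L2_dist \<nu> (approx n t) (V t) \<le> 4 * scale * rate ^ n / (1 - rate))"
proof -
  have "\<exists>g\<in>L2_space \<nu>. \<forall>n. L2_dist \<nu> (approx n t) g \<le> 4 * scale * rate ^ n / (1 - rate)"
    if t: "t \<in> {0..T}" for t
    by (rule Riesz_Fischer_geometric[OF finite_nu approx_L2 approx_Cauchy[OF t]]) (use rate in auto)
  then show ?thesis by metis
qed

lemma euler_eq_sum: "euler n k x = v0 x - mesh n * (\<Sum>j<k. drift (euler n j) x)"
  by (induction k) (simp_all add: algebra_simps)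

text \<open>
  Here \<open>y\<close> is the position within the cell of index \<open>i\<close>.  The right end of a cell already belongs to the
  next one and has to be discarded as a null set.
\<close>

lemma step_function_has_integral:
  fixes G :: "nat \<Rightarrow> real"
  assumes "0 \<le> y" "y \<le> mesh n"
  shows "((\<lambda>s. G (grid_index n s)) has_integral (mesh n * (\<Sum>j<i. G j) + y * G i)) {0..real i * mesh n + y}"
  using assms
proof (induction i arbitrary: y)
  have piece: "((\<lambda>s. G (grid_index n s)) has_integral y * G i) {real i * mesh n..real i * mesh n + y}"
    if y: "0 \<le> y" "y \<le> mesh n" for y i
  proof (rule has_integral_spike_finite[of "{real i * mesh n + y}"])
    show "((\<lambda>_. G i) has_integral y * G i) {real i * mesh n..real i * mesh n + y}"
      using has_integral_const_real[of "G i" "real i * mesh n" "real i * mesh n + y"] y by simp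
    fix s assume s: "s \<in> {real i * mesh n..real i * mesh n + y} - {real i * mesh n + y}"
    have "\<lfloor>s / mesh n\<rfloor> = int i"
      using s y mesh_pos[of n] by (intro floor_unique) (auto simp: field_simps)
    then show "G (grid_index n s) = G i" by (simp add: grid_index_def)
  qed simp
  {
    case 0
    then show ?case using piece[of y 0] by simp
  next
    case (Suc i)
    have e: "real (Suc i) * mesh n = real i * mesh n + mesh n" by (simp add: algebra_simps)
    have "((\<lambda>s. G (grid_index n s)) has_integral (mesh n * (\<Sum>j<i. G j) + mesh n * G i) + y * G (Suc i)) {0..real (Suc i) * mesh n + y}"
    proof (rule has_integral_combine)
      show "((\<lambda>s. G (grid_index n s)) has_integral (mesh n * (\<Sum>j<i. G j) + mesh n * G i)) {0..real (Suc i) * mesh n}"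
        unfolding e using Suc.IH[of "mesh n"] mesh_pos[of n] by simp
      show "((\<lambda>s. G (grid_index n s)) has_integral y * G (Suc i)) {real (Suc i) * mesh n..real (Suc i) * mesh n + y}"
        by (rule piece) (use Suc.prems in auto)
    qed (use Suc.prems mesh_pos[of n] in auto)
    then show ?case by (simp add: algebra_simps)
  }
qed

text \<open>
  The integral of the drift interpolates the Euler values linearly, while \<open>approx\<close> is constant on each
  cell; the difference is a fraction of one step.
\<close>

lemma approx_integral:
  assumes t: "t \<in> {0..T}"
  shows "L2_norm \<nu> (\<lambda>x. (v0 x - integral {0..t} (\<lambda>s. drift (approx n s) x)) - approx n t x) \<le> scale * rate ^ n"
proof -
  define k where "k = grid_index n t"
  define y where "y = t - real k * mesh n"
  have y: "0 \<le> y" "y \<le> mesh n" using grid_index_le[OF t, of n] by (auto simp: y_def k_def)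
  have "integral {0..t} (\<lambda>s. drift (approx n s) x) = mesh n * (\<Sum>j<k. drift (euler n j) x) + y * drift (euler n k) x" for x
    using step_function_has_integral[OF y, of "\<lambda>j. drift (euler n j) x" k]
    by (intro integral_unique) (simp add: approx_def y_def)
  then have "(\<lambda>x. (v0 x - integral {0..t} (\<lambda>s. drift (approx n s) x)) - approx n t x) = (\<lambda>x. - (y * drift (euler n k) x))"
    by (simp add: approx_def k_def[symmetric] euler_eq_sum fun_eq_iff)
  then show ?thesis
    using norm_drift_le[OF euler_L2 y] by (simp only: L2_norm_minus)
qed

end

section \<open>Passage to the limit\<close>

lemma integrable_lebesgue_on_subset:
  fixes h :: "real \<Rightarrow> real"
  assumes "integrable (lebesgue_on S) h" "S \<in> sets lebesgue" "R \<in> sets lebesgue" "R \<subseteq> S"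
  shows "integrable (lebesgue_on R) h"
  using set_integrable_subset[of lebesgue S h R] assms
  by (simp add: set_integrable_def integrable_restrict_space)

text \<open>
  Fubini's theorem on the triangle \<open>s < t\<close>, after which the inner integral of \<open>deriv \<phi>\<close> is computed by
  the fundamental theorem; the test function vanishes at both ends.
\<close>

lemma integral_by_parts_indefinite:
  fixes g :: "real \<Rightarrow> real"
  assumes \<phi>: "test_function T \<phi>" and g: "g \<in> borel_measurable (lebesgue_on {0<..<T})" and gB: "\<And>t. \<bar>g t\<bar> \<le> B" and T: "T > 0"
  shows "(\<integral>t. deriv \<phi> t * (c - (\<integral>s. (if s < t then g s else 0) \<partial>lebesgue_on {0<..<T})) \<partial>lebesgue_on {0<..<T})
    = (\<integral>t. \<phi> t * g t \<partial>lebesgue_on {0<..<T})"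
proof -
  let ?L = "lebesgue_on {0<..<T}"
  interpret L: finite_measure ?L by (rule finite_lebesgue_on)
  interpret P: pair_sigma_finite ?L ?L ..
  have smooth: "smooth \<phi>" using \<phi> by (simp add: test_function_def smooth_def)
  have \<phi>0: "\<phi> t = 0" if "t \<notin> {0<..<T}" for t using \<phi> that by (auto simp: test_function_def)
  have d\<phi>: "continuous_on UNIV (deriv \<phi>)"
    by (intro continuous_at_imp_continuous_on ballI smooth_isCont smooth_deriv smooth)
  have "bounded (deriv \<phi> ` {0..T})"
    by (intro compact_imp_bounded compact_continuous_image continuous_on_subset[OF d\<phi>]) auto
  then obtain C where C: "\<And>t. t \<in> {0..T} \<Longrightarrow> \<bar>deriv \<phi> t\<bar> \<le> C"
    unfolding bounded_iff real_norm_def by blast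
  have [measurable]: "deriv \<phi> \<in> borel_measurable ?L"
    using borel_measurable_continuous_onI[OF d\<phi>] by (simp add: measurable_restrict_space1 measurable_completion)
  have [measurable]: "(\<lambda>t. t) \<in> ?L \<rightarrow>\<^sub>M (borel :: real measure)"
    by (intro measurable_restrict_space1 measurable_completion) simp
  note g[measurable]
  have FTC: "integrable (lebesgue_on {s<..<T}) (deriv \<phi>)" "(\<integral>t. deriv \<phi> t \<partial>lebesgue_on {s<..<T}) = - \<phi> s"
    if s: "0 \<le> s" "s \<le> T" for s
  proof -
    have "integrable (lebesgue_on {s..T}) (deriv \<phi>)"
      by (rule continuous_imp_integrable_real) (rule continuous_on_subset[OF d\<phi>], simp)
    then show i: "integrable (lebesgue_on {s<..<T}) (deriv \<phi>)"
      by (rule integrable_lebesgue_on_subset) (auto simp: sets_lebesgue_greaterThanLessThan)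
    have "(deriv \<phi> has_integral (\<phi> T - \<phi> s)) {s..T}"
      by (rule fundamental_theorem_of_calculus[OF s(2)])
         (auto simp flip: has_real_derivative_iff_has_vector_derivative intro!: DERIV_subset[OF smooth_DERIV[OF smooth]])
    then have "(deriv \<phi> has_integral (\<phi> T - \<phi> s)) {s<..<T}"
      using has_integral_open_interval[of "deriv \<phi>" _ s T] by (simp add: box_real)
    moreover have "(\<integral>t. deriv \<phi> t \<partial>lebesgue_on {s<..<T}) = integral {s<..<T} (deriv \<phi>)"
      by (rule lebesgue_integral_eq_integral[OF i sets_lebesgue_greaterThanLessThan])
    ultimately show "(\<integral>t. deriv \<phi> t \<partial>lebesgue_on {s<..<T}) = - \<phi> s"
      using \<phi>0[of T] by (simp add: integral_unique)
  qed
  have i1: "integrable ?L (deriv \<phi>)" "(\<integral>t. deriv \<phi> t \<partial>?L) = 0"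
    using FTC[of 0] T \<phi>0[of 0] by auto
  have B0: "0 \<le> B" using gB[of 0] by linarith
  have C0: "0 \<le> C" using C[of 0] T by fastforce
  have i2: "integrable (?L \<Otimes>\<^sub>M ?L) (\<lambda>(t, s). deriv \<phi> t * (if s < t then g s else 0))"
  proof (rule finite_measure.integrable_const_bound[where B="C * B"])
    show "finite_measure (?L \<Otimes>\<^sub>M ?L)" by (rule finite_measure_pair_measure) (rule finite_lebesgue_on)+
    show "AE z in ?L \<Otimes>\<^sub>M ?L. norm (case z of (t, s) \<Rightarrow> deriv \<phi> t * (if s < t then g s else 0)) \<le> C * B"
    proof (rule AE_I2)
      fix z assume "z \<in> space (?L \<Otimes>\<^sub>M ?L)"
      then obtain t s where z: "z = (t, s)" "t \<in> {0..T}" by (auto simp: space_pair_measure)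
      show "norm (case z of (t, s) \<Rightarrow> deriv \<phi> t * (if s < t then g s else 0)) \<le> C * B"
        using C[OF z(2)] gB[of s] B0 C0 z by (auto simp: abs_mult intro!: mult_mono)
    qed
  qed measurable
  have i3: "integrable ?L (\<lambda>t. deriv \<phi> t * (\<integral>s. (if s < t then g s else 0) \<partial>?L))"
    using P.integrable_fst[OF i2] by simp
  have "(\<integral>t. deriv \<phi> t * (c - (\<integral>s. (if s < t then g s else 0) \<partial>?L)) \<partial>?L)
    = (\<integral>t. deriv \<phi> t * c \<partial>?L) - (\<integral>t. deriv \<phi> t * (\<integral>s. (if s < t then g s else 0) \<partial>?L) \<partial>?L)"
    unfolding right_diff_distrib by (rule Bochner_Integration.integral_diff) (use i1 i3 in auto)
  also have "\<dots> = - (\<integral>t. (\<integral>s. deriv \<phi> t * (if s < t then g s else 0) \<partial>?L) \<partial>?L)"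
    using i1 by simp
  also have "(\<integral>t. (\<integral>s. deriv \<phi> t * (if s < t then g s else 0) \<partial>?L) \<partial>?L) = (\<integral>s. (\<integral>t. deriv \<phi> t * (if s < t then g s else 0) \<partial>?L) \<partial>?L)"
    using P.Fubini_integral[OF i2] by simp
  also have "\<dots> = (\<integral>s. - (\<phi> s * g s) \<partial>?L)"
  proof (rule Bochner_Integration.integral_cong[OF refl])
    fix s assume "s \<in> space ?L"
    then have s: "0 < s" "s < T" by auto
    have "(\<integral>t. deriv \<phi> t * (if s < t then g s else 0) \<partial>?L) = (\<integral>t. indicator {0<..<T} t * (deriv \<phi> t * (if s < t then g s else 0)) \<partial>lebesgue)"
      by (simp add: integral_restrict_space)
    also have "\<dots> = (\<integral>t. (indicator {s<..<T} t * deriv \<phi> t) * g s \<partial>lebesgue)"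
      by (rule Bochner_Integration.integral_cong) (use s in \<open>auto simp: indicator_def\<close>)
    also have "\<dots> = (\<integral>t. deriv \<phi> t \<partial>lebesgue_on {s<..<T}) * g s"
      by (simp add: integral_restrict_space)
    also have "\<dots> = - (\<phi> s * g s)" using FTC(2)[of s] s by simp
    finally show "(\<integral>t. deriv \<phi> t * (if s < t then g s else 0) \<partial>?L) = - (\<phi> s * g s)" .
  qed
  finally show ?thesis by simp
qed

context flow_data
begin

abbreviation time :: "real measure" where
  "time \<equiv> lebesgue_on {0<..<T}"

sublocale TS: L2_valued time \<nu> by (rule L2_valued_lebesgue)

definition cumulative :: "(real \<Rightarrow> 'a \<Rightarrow> real) \<Rightarrow> real \<Rightarrow> 'a \<Rightarrow> real" where
  "cumulative g t x = (\<integral>s. (if s < t then g s x else 0) \<partial>time)"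

lemma measurable_time_ident: "(\<lambda>t. t) \<in> time \<rightarrow>\<^sub>M (borel :: real measure)"
  by (intro measurable_restrict_space1 measurable_completion) simp

definition bounded_joint :: "(real \<Rightarrow> 'a \<Rightarrow> real) \<Rightarrow> bool" where
  "bounded_joint g \<longleftrightarrow> case_prod g \<in> borel_measurable (time \<Otimes>\<^sub>M \<nu>) \<and> (\<forall>t x. \<bar>g t x\<bar> \<le> 1)"

lemma bounded_joint_sections:
  assumes "bounded_joint g"
  shows "(\<lambda>s. g s x) \<in> borel_measurable time" and "t \<in> {0<..<T} \<Longrightarrow> g t \<in> L2_space \<nu>"
    and "case_prod g \<in> L2_space (time \<Otimes>\<^sub>M \<nu>)"
    and "integrable time (\<lambda>s. g s x)" and "integrable time (\<lambda>s. if s < r then g s x else 0)"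
proof -
  note measurable_time_ident[measurable]
  have m: "case_prod g \<in> borel_measurable (time \<Otimes>\<^sub>M \<nu>)" and b: "\<And>t x. \<bar>g t x\<bar> \<le> 1"
    using assms by (auto simp: bounded_joint_def)
  show gm[measurable]: "(\<lambda>s. g s x) \<in> borel_measurable time"
    using measurable_Pair1[OF m, of x] by (simp add: space_nu)
  show "g t \<in> L2_space \<nu>" if "t \<in> {0<..<T}"
  proof (rule L2_bounded[OF finite_nu _ b])
    show "g t \<in> borel_measurable \<nu>" using measurable_Pair2[OF m, of t] that by simp
  qed
  show "case_prod g \<in> L2_space (time \<Otimes>\<^sub>M \<nu>)"
    by (rule L2_bounded[OF TS.P.finite_measure_axioms m, where C=1]) (auto simp: b)
  show "integrable time (\<lambda>s. g s x)"
    by (rule TS.M.integrable_const_bound[where B=1]) (auto simp: b)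
  show "integrable time (\<lambda>s. if s < r then g s x else 0)"
    by (rule TS.M.integrable_const_bound[where B=1]) (auto simp: b)
qed

lemma bounded_joint_cutoff:
  assumes "bounded_joint g" shows "bounded_joint (\<lambda>s x. if s < t then g s x else 0)"
proof -
  note measurable_time_ident[measurable]
  have m[measurable]: "case_prod g \<in> borel_measurable (time \<Otimes>\<^sub>M \<nu>)" and b: "\<And>t x. \<bar>g t x\<bar> \<le> 1"
    using assms by (auto simp: bounded_joint_def)
  have "(\<lambda>z. if fst z < t then case_prod g z else 0) \<in> borel_measurable (time \<Otimes>\<^sub>M \<nu>)" by measurable
  then show ?thesis using b by (auto simp: bounded_joint_def case_prod_unfold)
qed

lemma cumulative_L2: "bounded_joint g \<Longrightarrow> cumulative g t \<in> L2_space \<nu>"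
  unfolding cumulative_def[abs_def]
  by (rule TS.time_integral_L2(1)) (rule bounded_joint_sections(3)[OF bounded_joint_cutoff])

lemma cumulative_diff_norm:
  assumes g: "bounded_joint g" and h: "bounded_joint h"
  shows "L2_dist \<nu> (cumulative g t) (cumulative h t)
    \<le> sqrt (measure time (space time)) * L2_dist (time \<Otimes>\<^sub>M \<nu>) (case_prod g) (case_prod h)"
proof -
  let ?D = "\<lambda>s x. (if s < t then g s x else 0) - (if s < t then h s x else 0)"
  have D: "case_prod ?D \<in> L2_space (time \<Otimes>\<^sub>M \<nu>)"
    using L2_diff[OF bounded_joint_sections(3)[OF bounded_joint_cutoff[OF g, of t]] bounded_joint_sections(3)[OF bounded_joint_cutoff[OF h, of t]]]
    by (simp add: case_prod_unfold)
  have "(\<lambda>x. cumulative g t x - cumulative h t x) = (\<lambda>x. \<integral>s. ?D s x \<partial>time)"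
    using bounded_joint_sections(5)[OF g] bounded_joint_sections(5)[OF h] by (simp add: cumulative_def fun_eq_iff)
  then have "L2_dist \<nu> (cumulative g t) (cumulative h t) \<le> sqrt (measure time (space time)) * L2_norm (time \<Otimes>\<^sub>M \<nu>) (case_prod ?D)"
    using TS.time_integral_L2(2)[OF D] by simp
  also have "L2_norm (time \<Otimes>\<^sub>M \<nu>) (case_prod ?D) \<le> L2_dist (time \<Otimes>\<^sub>M \<nu>) (case_prod g) (case_prod h)"
    by (rule L2_norm_mono[OF L2_diff[OF bounded_joint_sections(3)[OF g] bounded_joint_sections(3)[OF h]] L2_spaceD(1)[OF D]])
       (auto simp: case_prod_unfold)
  finally show ?thesis by (simp add: mult_left_mono)
qed

lemma cumulative_Lipschitz:
  assumes g: "bounded_joint g"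
  shows "\<bar>cumulative g t x - cumulative g s x\<bar> \<le> \<bar>t - s\<bar>"
proof -
  note measurable_time_ident[measurable]
  have main: "\<bar>cumulative g t x - cumulative g s x\<bar> \<le> t - s" if st: "s \<le> t" for s t
  proof -
    have [measurable]: "{s..<t} \<inter> {0<..<T} \<in> sets lebesgue" by (rule sets_completionI_sets) simp
    have "\<bar>cumulative g t x - cumulative g s x\<bar> = \<bar>\<integral>r. (if r < t then g r x else 0) - (if r < s then g r x else 0) \<partial>time\<bar>"
      using bounded_joint_sections(5)[OF g] by (simp add: cumulative_def)
    also have "\<dots> \<le> (\<integral>r. \<bar>(if r < t then g r x else 0) - (if r < s then g r x else 0)\<bar> \<partial>time)" by (rule integral_abs_bound)
    also have "\<dots> \<le> (\<integral>r. (if s \<le> r \<and> r < t then 1 else 0) \<partial>time)"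
    proof (rule integral_mono)
      show "integrable time (\<lambda>r. \<bar>(if r < t then g r x else 0) - (if r < s then g r x else 0)\<bar>)"
        using bounded_joint_sections(5)[OF g] by (intro integrable_abs Bochner_Integration.integrable_diff)
      show "integrable time (\<lambda>r. if s \<le> r \<and> r < t then 1 else 0 :: real)"
        by (rule TS.M.integrable_const_bound[where B=1]) auto
      show "\<bar>(if r < t then g r x else 0) - (if r < s then g r x else 0)\<bar> \<le> (if s \<le> r \<and> r < t then 1 else 0)" for r
        using g st by (auto simp: bounded_joint_def)
    qed
    also have "\<dots> = (\<integral>r. indicator {0<..<T} r * (if s \<le> r \<and> r < t then 1 else 0) \<partial>lebesgue)"
      by (simp add: integral_restrict_space)
    also have "\<dots> = (\<integral>r. indicator ({s..<t} \<inter> {0<..<T}) r \<partial>lebesgue)"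
      by (rule Bochner_Integration.integral_cong) (auto simp: indicator_def)
    also have "\<dots> = measure lebesgue ({s..<t} \<inter> {0<..<T})" by (simp add: Bochner_Integration.integral_indicator del: indicator_simps)
    also have "\<dots> \<le> measure lebesgue {s..t}"
      by (rule measure_mono_fmeasurable) auto
    also have "\<dots> = t - s" using st by simp
    finally show ?thesis .
  qed
  show ?thesis using main[of s t] main[of t s] by (cases "s \<le> t") (auto simp: abs_minus_commute)
qed

lemma cumulative_zero: "cumulative g 0 x = 0"
proof -
  have "cumulative g 0 x = (\<integral>s. 0 \<partial>time)"
    unfolding cumulative_def by (rule Bochner_Integration.integral_cong) auto
  then show ?thesis by simp
qed

lemma cumulative_eq_integral:
  assumes g: "bounded_joint g" and t: "t \<in> {0..T}"
  shows "cumulative g t x = integral {0..t} (\<lambda>s. g s x)"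
proof -
  have i: "integrable (lebesgue_on {0<..<t}) (\<lambda>s. g s x)"
    by (rule integrable_lebesgue_on_subset[OF bounded_joint_sections(4)[OF g, of x]])
       (use t sets_lebesgue_greaterThanLessThan in auto)
  have "cumulative g t x = (\<integral>s. indicator {0<..<T} s * (if s < t then g s x else 0) \<partial>lebesgue)"
    unfolding cumulative_def by (simp add: integral_restrict_space)
  also have "\<dots> = (\<integral>s. indicator {0<..<t} s * g s x \<partial>lebesgue)"
    by (rule Bochner_Integration.integral_cong) (use t in \<open>auto simp: indicator_def\<close>)
  also have "\<dots> = (\<integral>s. g s x \<partial>lebesgue_on {0<..<t})" by (simp add: integral_restrict_space)
  also have "\<dots> = integral {0<..<t} (\<lambda>s. g s x)"
    by (rule lebesgue_integral_eq_integral[OF i sets_lebesgue_greaterThanLessThan])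
  also have "\<dots> = integral {0..t} (\<lambda>s. g s x)" by (rule integral_open_interval_real[symmetric])
  finally show ?thesis .
qed

lemma simple_bounded_joint:
  assumes "L2_simple time \<nu> p" "\<And>t x. \<bar>p t x\<bar> \<le> 1" shows "bounded_joint p"
  using TS.L2_simple_jointly_measurable[OF assms(1)] assms(2) by (simp add: bounded_joint_def)

lemma L2_simple_grid:
  assumes "\<And>k. G k \<in> L2_space \<nu>"
  shows "L2_simple time \<nu> (\<lambda>t. G (grid_index n t))"
proof (rule TS.L2_simpleI)
  have "simple_function time (\<lambda>t. real_of_int \<lfloor>t / mesh n\<rfloor>)"
  proof (rule simple_function_borel_measurable)
    have "(\<lambda>t::real. real_of_int \<lfloor>t / mesh n\<rfloor>) \<in> borel_measurable borel" by measurable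
    from measurable_compose[OF measurable_time_ident this]
    show "(\<lambda>t. real_of_int \<lfloor>t / mesh n\<rfloor>) \<in> borel_measurable time" .
    have "(\<lambda>t. real_of_int \<lfloor>t / mesh n\<rfloor>) ` space time \<subseteq> real_of_int ` {0..2 ^ n}"
    proof
      fix y assume "y \<in> (\<lambda>t. real_of_int \<lfloor>t / mesh n\<rfloor>) ` space time"
      then obtain t where t: "0 < t" "t < T" "y = real_of_int \<lfloor>t / mesh n\<rfloor>" by auto
      have "0 \<le> t / mesh n" "t / mesh n \<le> 2 ^ n" using t mesh_pos[of n] T by (auto simp: mesh_def field_simps)
      then have "0 \<le> \<lfloor>t / mesh n\<rfloor>" "\<lfloor>t / mesh n\<rfloor> \<le> 2 ^ n" by (auto simp: floor_le_iff)
      then show "y \<in> real_of_int ` {0..2 ^ n}" using t by auto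
    qed
    then show "finite ((\<lambda>t. real_of_int \<lfloor>t / mesh n\<rfloor>) ` space time)" by (rule finite_subset) auto
  qed
  from simple_function_compose1[OF this, of "\<lambda>y. G (nat \<lfloor>y\<rfloor>)"]
  show "simple_function time (\<lambda>t. G (grid_index n t))" by (simp add: grid_index_def)
qed (rule assms)

text \<open>
  As \<open>f\<close> is merely integrable, \<open>u - f\<close> need not be in \<open>L\<^sup>2\<close>.  Its truncation is, has the same sign and
  depends on \<open>u\<close> in a 1-Lipschitz way, so it can replace \<open>u - f\<close> in the characterisation of signs.
\<close>

definition clip :: "real \<Rightarrow> real" where
  "clip r = max (-1) (min 1 r)"

lemma clip_simps: "\<bar>clip r\<bar> \<le> 1" "\<bar>clip r - clip s\<bar> \<le> \<bar>r - s\<bar>" "sgn r * clip r = \<bar>clip r\<bar>"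
    "(clip r > 0) = (r > 0)" "(clip r < 0) = (r < 0)" "\<bar>r\<bar> \<le> 1 \<Longrightarrow> clip r = r"
  by (auto simp: clip_def sgn_if max_def min_def)

lemma clip_measurable[measurable]: "clip \<in> borel_measurable borel"
  unfolding clip_def[abs_def] by measurable

lemma clip_L2:
  assumes u: "u \<in> borel_measurable \<nu>" shows "(\<lambda>x. clip (u x - f x)) \<in> L2_space \<nu>"
proof (rule L2_bounded[OF finite_nu])
  have [measurable]: "u \<in> borel_measurable borel" using u by (simp add: measurable_nu)
  show "(\<lambda>x. clip (u x - f x)) \<in> borel_measurable \<nu>" unfolding measurable_nu by measurable
qed (rule clip_simps)

text \<open>
  Up to the error \<open>\<epsilon>\<close>, \<open>p\<close> is a subgradient of the total variation along \<open>V\<close>, \<open>q\<close> is a sign of \<open>V - f\<close>, and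
  together they drive \<open>V\<close>.  Simple functions of time form a linear space, and every other condition is an
  affine inequality or a bound for an affine expression in \<open>(p, q)\<close>, so the set is convex.
\<close>

definition approx_pairs :: "(real \<Rightarrow> 'a \<Rightarrow> real) \<Rightarrow> real \<Rightarrow> ((real \<Rightarrow> 'a \<Rightarrow> real) \<times> (real \<Rightarrow> 'a \<Rightarrow> real)) set" where
  "approx_pairs V \<epsilon> = {(p, q).
     L2_simple time \<nu> p \<and> L2_simple time \<nu> q \<and> (\<forall>t x. \<bar>p t x\<bar> \<le> 1) \<and> (\<forall>t x. \<bar>q t x\<bar> \<le> 1) \<and>
     (\<forall>t\<in>{0<..<T}. \<forall>w\<in>L2_space \<nu>. TVr (V t) + L2_inner \<nu> (p t) (\<lambda>x. w x - V t x) \<le> TVr w + \<epsilon>) \<and>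
     (\<forall>t\<in>{0<..<T}. (\<integral>x. \<bar>clip (V t x - f x)\<bar> \<partial>\<nu>) \<le> L2_inner \<nu> (q t) (\<lambda>x. clip (V t x - f x)) + \<epsilon>) \<and>
     (\<forall>t\<in>{0..T}. L2_norm \<nu> (\<lambda>x. (v0 x - (cumulative p t x + lam * cumulative q t x)) - V t x) \<le> \<epsilon>)}"

definition mid :: "(real \<Rightarrow> 'a \<Rightarrow> real) \<times> (real \<Rightarrow> 'a \<Rightarrow> real) \<Rightarrow> (real \<Rightarrow> 'a \<Rightarrow> real) \<times> (real \<Rightarrow> 'a \<Rightarrow> real)
    \<Rightarrow> (real \<Rightarrow> 'a \<Rightarrow> real) \<times> (real \<Rightarrow> 'a \<Rightarrow> real)" where
  "mid a b = ((\<lambda>t x. (fst a t x + fst b t x) / 2), (\<lambda>t x. (snd a t x + snd b t x) / 2))"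

lemma approx_pairs_mono: "\<epsilon> \<le> \<delta> \<Longrightarrow> approx_pairs V \<epsilon> \<subseteq> approx_pairs V \<delta>"
proof
  fix a assume le: "\<epsilon> \<le> \<delta>" and a: "a \<in> approx_pairs V \<epsilon>"
  have 1: "x \<le> y + \<epsilon> \<Longrightarrow> x \<le> y + \<delta>" "x \<le> \<epsilon> \<Longrightarrow> x \<le> \<delta>" for x y using le by simp_all
  show "a \<in> approx_pairs V \<delta>"
    using a 1 unfolding approx_pairs_def mem_Collect_eq case_prod_beta by (elim conjE, intro conjI; blast)
qed

lemma cumulative_mid:
  assumes "bounded_joint p" "bounded_joint q"
  shows "cumulative (\<lambda>t x. (p t x + q t x) / 2) t x = (cumulative p t x + cumulative q t x) / 2"
proof -
  have "cumulative (\<lambda>t x. (p t x + q t x) / 2) t x = (\<integral>s. ((if s < t then p s x else 0) + (if s < t then q s x else 0)) / 2 \<partial>time)"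
    unfolding cumulative_def by (rule Bochner_Integration.integral_cong) auto
  then show ?thesis
    using bounded_joint_sections(5)[OF assms(1)] bounded_joint_sections(5)[OF assms(2)] by (simp add: cumulative_def)
qed

lemma L2_inner_mid:
  assumes "a \<in> L2_space \<nu>" "b \<in> L2_space \<nu>" "w \<in> L2_space \<nu>"
  shows "L2_inner \<nu> (\<lambda>x. (a x + b x) / 2) w = (L2_inner \<nu> a w + L2_inner \<nu> b w) / 2"
  using L2_inner_add_left[OF assms] L2_inner_scale_left[of \<nu> "1/2" "\<lambda>x. a x + b x" w] by simp

lemma approx_pairs_mid:
  assumes V: "\<And>t. t \<in> {0..T} \<Longrightarrow> V t \<in> L2_space \<nu>"
    and a: "a \<in> approx_pairs V \<epsilon>" and b: "b \<in> approx_pairs V \<epsilon>"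
  shows "mid a b \<in> approx_pairs V \<epsilon>"
proof -
  obtain p q where a': "a = (p, q)" by (cases a)
  obtain r s where b': "b = (r, s)" by (cases b)
  have pq: "L2_simple time \<nu> p" "L2_simple time \<nu> q" "\<And>t x. \<bar>p t x\<bar> \<le> 1" "\<And>t x. \<bar>q t x\<bar> \<le> 1"
    and pq1: "\<And>t w. t \<in> {0<..<T} \<Longrightarrow> w \<in> L2_space \<nu> \<Longrightarrow> TVr (V t) + L2_inner \<nu> (p t) (\<lambda>x. w x - V t x) \<le> TVr w + \<epsilon>"
    and pq2: "\<And>t. t \<in> {0<..<T} \<Longrightarrow> (\<integral>x. \<bar>clip (V t x - f x)\<bar> \<partial>\<nu>) \<le> L2_inner \<nu> (q t) (\<lambda>x. clip (V t x - f x)) + \<epsilon>"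
    and pq3: "\<And>t. t \<in> {0..T} \<Longrightarrow> L2_norm \<nu> (\<lambda>x. (v0 x - (cumulative p t x + lam * cumulative q t x)) - V t x) \<le> \<epsilon>"
    using a unfolding a' approx_pairs_def by blast+
  have rs: "L2_simple time \<nu> r" "L2_simple time \<nu> s" "\<And>t x. \<bar>r t x\<bar> \<le> 1" "\<And>t x. \<bar>s t x\<bar> \<le> 1"
    and rs1: "\<And>t w. t \<in> {0<..<T} \<Longrightarrow> w \<in> L2_space \<nu> \<Longrightarrow> TVr (V t) + L2_inner \<nu> (r t) (\<lambda>x. w x - V t x) \<le> TVr w + \<epsilon>"
    and rs2: "\<And>t. t \<in> {0<..<T} \<Longrightarrow> (\<integral>x. \<bar>clip (V t x - f x)\<bar> \<partial>\<nu>) \<le> L2_inner \<nu> (s t) (\<lambda>x. clip (V t x - f x)) + \<epsilon>"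
    and rs3: "\<And>t. t \<in> {0..T} \<Longrightarrow> L2_norm \<nu> (\<lambda>x. (v0 x - (cumulative r t x + lam * cumulative s t x)) - V t x) \<le> \<epsilon>"
    using b unfolding b' approx_pairs_def by blast+
  note bj = simple_bounded_joint[OF pq(1,3)] simple_bounded_joint[OF pq(2,4)]
    simple_bounded_joint[OF rs(1,3)] simple_bounded_joint[OF rs(2,4)]
  have half: "(\<lambda>t x. (p t x + r t x) / 2) = (\<lambda>t x. 1/2 * p t x + 1/2 * r t x)"
    "(\<lambda>t x. (q t x + s t x) / 2) = (\<lambda>t x. 1/2 * q t x + 1/2 * s t x)" by (auto simp: fun_eq_iff)
  have simple: "L2_simple time \<nu> (\<lambda>t x. (p t x + r t x) / 2)" "L2_simple time \<nu> (\<lambda>t x. (q t x + s t x) / 2)"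
    unfolding half by (intro TS.L2_simple_lincomb pq rs simple_function_const)+
  have bounds: "\<bar>(p t x + r t x) / 2\<bar> \<le> 1" "\<bar>(q t x + s t x) / 2\<bar> \<le> 1" for t x
    using pq(3,4)[of t x] rs(3,4)[of t x] by (auto simp: abs_le_iff)
  have c1: "TVr (V t) + L2_inner \<nu> (\<lambda>x. (p t x + r t x) / 2) (\<lambda>x. w x - V t x) \<le> TVr w + \<epsilon>"
    if t: "t \<in> {0<..<T}" and w: "w \<in> L2_space \<nu>" for t w
  proof -
    have "L2_inner \<nu> (\<lambda>x. (p t x + r t x) / 2) (\<lambda>x. w x - V t x)
      = (L2_inner \<nu> (p t) (\<lambda>x. w x - V t x) + L2_inner \<nu> (r t) (\<lambda>x. w x - V t x)) / 2"
      using t by (intro L2_inner_mid bounded_joint_sections(2) bj L2_diff w V) auto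
    then show ?thesis using pq1[OF t w] rs1[OF t w] by simp
  qed
  have c2: "(\<integral>x. \<bar>clip (V t x - f x)\<bar> \<partial>\<nu>) \<le> L2_inner \<nu> (\<lambda>x. (q t x + s t x) / 2) (\<lambda>x. clip (V t x - f x)) + \<epsilon>"
    if t: "t \<in> {0<..<T}" for t
  proof -
    have "L2_inner \<nu> (\<lambda>x. (q t x + s t x) / 2) (\<lambda>x. clip (V t x - f x))
      = (L2_inner \<nu> (q t) (\<lambda>x. clip (V t x - f x)) + L2_inner \<nu> (s t) (\<lambda>x. clip (V t x - f x))) / 2"
      using t by (intro L2_inner_mid bounded_joint_sections(2) bj clip_L2 L2_spaceD(1)[OF V]) auto
    then show ?thesis using pq2[OF t] rs2[OF t] by simp
  qed
  have c3: "L2_norm \<nu> (\<lambda>x. (v0 x - (cumulative (\<lambda>t x. (p t x + r t x) / 2) t x + lam * cumulative (\<lambda>t x. (q t x + s t x) / 2) t x)) - V t x) \<le> \<epsilon>"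
    if t: "t \<in> {0..T}" for t
  proof -
    let ?a = "\<lambda>x. (v0 x - (cumulative p t x + lam * cumulative q t x)) - V t x"
    let ?b = "\<lambda>x. (v0 x - (cumulative r t x + lam * cumulative s t x)) - V t x"
    have L: "?a \<in> L2_space \<nu>" "?b \<in> L2_space \<nu>"
      by (intro L2_diff L2_add L2_scale cumulative_L2 bj V t v0)+
    have eq: "(\<lambda>x. (v0 x - (cumulative (\<lambda>t x. (p t x + r t x) / 2) t x + lam * cumulative (\<lambda>t x. (q t x + s t x) / 2) t x)) - V t x)
      = (\<lambda>x. 1/2 * ?a x + 1/2 * ?b x)"
      using bj by (simp add: cumulative_mid fun_eq_iff field_simps)
    have "L2_norm \<nu> (\<lambda>x. (v0 x - (cumulative (\<lambda>t x. (p t x + r t x) / 2) t x + lam * cumulative (\<lambda>t x. (q t x + s t x) / 2) t x)) - V t x)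
      \<le> L2_norm \<nu> (\<lambda>x. 1/2 * ?a x) + L2_norm \<nu> (\<lambda>x. 1/2 * ?b x)"
      unfolding eq by (rule L2_norm_triangle[OF L2_scale[OF L(1)] L2_scale[OF L(2)]])
    also have "\<dots> \<le> \<epsilon>" unfolding L2_norm_scale using pq3[OF t] rs3[OF t] by simp
    finally show ?thesis .
  qed
  show ?thesis
    unfolding a' b' mid_def fst_conv snd_conv approx_pairs_def mem_Collect_eq case_prod_conv
    by (intro conjI ballI allI simple bounds c1 c2 c3)
qed

text \<open>
  The schemes provide an exact subgradient and an exact sign, but at \<open>approx n t\<close>.  Moving the base
  point to \<open>V t\<close> costs a multiple of their distance, because the total variation is Lipschitz and the
  subgradients are bounded.
\<close>

lemma euler_approx_pair:
  assumes V: "\<And>t. t \<in> {0..T} \<Longrightarrow> V t \<in> L2_space \<nu>"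
    and close: "\<And>t n. t \<in> {0..T} \<Longrightarrow> L2_dist \<nu> (approx n t) (V t) \<le> 4 * scale * rate ^ n / (1 - rate)"
  shows "((\<lambda>t. TV_grad (approx n t)), (\<lambda>t x. sgn (approx n t x - f x)))
    \<in> approx_pairs V (((2 * sqrt total_mass + 1) * (4 * scale / (1 - rate)) + scale) * rate ^ n)"
proof -
  define \<delta> where "\<delta> = 4 * scale * rate ^ n / (1 - rate)"
  have \<delta>0: "0 \<le> \<delta>" using scale_nonneg rate by (simp add: \<delta>_def)
  define S where "S = sqrt total_mass"
  have S0: "0 \<le> S" by (simp add: S_def)
  have sr0: "0 \<le> scale * rate ^ n" using scale_nonneg rate by simp
  let ?e = "((2 * sqrt total_mass + 1) * (4 * scale / (1 - rate)) + scale) * rate ^ n"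
  have e: "?e = (2 * S + 1) * \<delta> + scale * rate ^ n"
    by (simp add: \<delta>_def S_def field_simps)
  have e_ge: "2 * S * \<delta> \<le> ?e" "scale * rate ^ n + \<delta> \<le> ?e"
    unfolding e using \<delta>0 S0 sr0 mult_nonneg_nonneg[OF S0 \<delta>0] by (simp_all add: algebra_simps)
  let ?p = "\<lambda>t. TV_grad (approx n t)" and ?q = "\<lambda>t x. sgn (approx n t x - f x)"
  have simple: "L2_simple time \<nu> ?p" "L2_simple time \<nu> ?q"
    unfolding approx_def
    using L2_simple_grid[of "\<lambda>k. TV_grad (euler n k)" n] L2_simple_grid[of "\<lambda>k x. sgn (euler n k x - f x)" n]
    by (auto intro: TV_grad_L2 sgn_L2 euler_L2)
  have bounds: "\<bar>?p t x\<bar> \<le> 1" "\<bar>?q t x\<bar> \<le> 1" for t x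
    by (rule TV_grad_bounded[OF L2_measurable_borel[OF approx_L2]], rule abs_sgn_le_1)
  have c1: "TVr (V t) + L2_inner \<nu> (?p t) (\<lambda>x. w x - V t x) \<le> TVr w + ?e"
    if t: "t \<in> {0<..<T}" and w: "w \<in> L2_space \<nu>" for t w
  proof -
    have t': "t \<in> {0..T}" using t by simp
    have pL: "?p t \<in> L2_space \<nu>" by (intro TV_grad_L2 approx_L2)
    have cl: "L2_dist \<nu> (approx n t) (V t) \<le> \<delta>" using close[OF t'] by (simp add: \<delta>_def)
    have pn: "L2_norm \<nu> (?p t) \<le> S"
      using L2_norm_bounded[OF finite_nu L2_spaceD(1)[OF pL], of 1] bounds by (simp add: S_def)
    have "TVr (V t) \<le> TVr (approx n t) + S * \<delta>"
      using TVr_Lipschitz[OF approx_L2 V[OF t'], of n t] mult_left_mono[OF cl S0] by (simp add: S_def)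
    moreover have "TVr (approx n t) + L2_inner \<nu> (?p t) (\<lambda>x. w x - approx n t x) \<le> TVr w"
      by (rule TV_grad_subgradient[OF approx_L2 w])
    moreover have "L2_inner \<nu> (?p t) (\<lambda>x. w x - V t x)
        = L2_inner \<nu> (?p t) (\<lambda>x. w x - approx n t x) + L2_inner \<nu> (?p t) (\<lambda>x. approx n t x - V t x)"
      using L2_inner_add_left[OF L2_diff[OF w approx_L2[of n t]] L2_diff[OF approx_L2[of n t] V[OF t']] pL]
      by (simp add: L2_inner_commute[of \<nu> "?p t"])
    moreover have "L2_inner \<nu> (?p t) (\<lambda>x. approx n t x - V t x) \<le> S * \<delta>"
    proof -
      have "L2_inner \<nu> (?p t) (\<lambda>x. approx n t x - V t x) \<le> L2_norm \<nu> (?p t) * L2_dist \<nu> (approx n t) (V t)"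
        using L2_inner_le[OF pL L2_diff[OF approx_L2 V[OF t']]] by (simp add: abs_le_iff)
      also have "\<dots> \<le> S * \<delta>" by (intro mult_mono pn cl S0 L2_norm_nonneg)
      finally show ?thesis .
    qed
    ultimately show ?thesis using e_ge(1) by linarith
  qed
  have c2: "(\<integral>x. \<bar>clip (V t x - f x)\<bar> \<partial>\<nu>) \<le> L2_inner \<nu> (?q t) (\<lambda>x. clip (V t x - f x)) + ?e"
    if t: "t \<in> {0<..<T}" for t
  proof -
    have t': "t \<in> {0..T}" using t by simp
    have VL: "V t \<in> L2_space \<nu>" by (rule V[OF t'])
    have qL: "?q t \<in> L2_space \<nu>" by (intro sgn_L2 approx_L2)
    have DL: "(\<lambda>x. approx n t x - V t x) \<in> L2_space \<nu>" by (intro L2_diff approx_L2 VL)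
    note cV = clip_L2[OF L2_spaceD(1)[OF VL]]
    have i1: "integrable \<nu> (\<lambda>x. \<bar>clip (V t x - f x)\<bar>)" using L2_integrable[OF cV] by simp
    have i2: "integrable \<nu> (\<lambda>x. ?q t x * clip (V t x - f x))" by (rule L2_integrable_mult[OF qL cV])
    have i3: "integrable \<nu> (\<lambda>x. \<bar>approx n t x - V t x\<bar>)" using L2_integrable[OF DL] by simp
    have "(\<integral>x. \<bar>clip (V t x - f x)\<bar> \<partial>\<nu>) \<le> (\<integral>x. ?q t x * clip (V t x - f x) + 2 * \<bar>approx n t x - V t x\<bar> \<partial>\<nu>)"
    proof (rule integral_mono)
      fix x
      let ?a = "approx n t x - f x" and ?b = "V t x - f x"
      have ab: "\<bar>clip ?a - clip ?b\<bar> \<le> \<bar>approx n t x - V t x\<bar>" using clip_simps(2)[of ?a ?b] by simp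
      have "\<bar>sgn ?a * (clip ?b - clip ?a)\<bar> \<le> \<bar>clip ?b - clip ?a\<bar>"
        unfolding abs_mult by (rule mult_left_le_one_le) (auto simp: abs_sgn_le_1 simp del: abs_sgn_eq)
      moreover have "sgn ?a * clip ?b = \<bar>clip ?a\<bar> + sgn ?a * (clip ?b - clip ?a)"
        using clip_simps(3)[of ?a] by (simp add: right_diff_distrib)
      moreover have "\<bar>B\<bar> \<le> s + 2 * d" if "\<bar>z\<bar> \<le> \<bar>B - A\<bar>" "s = \<bar>A\<bar> + z" "\<bar>A - B\<bar> \<le> d"
        for A B s z d :: real using that by linarith
      ultimately show "\<bar>clip ?b\<bar> \<le> ?q t x * clip ?b + 2 * \<bar>approx n t x - V t x\<bar>"
        using ab by blast
    qed (use i1 i2 i3 in auto)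
    also have "\<dots> = L2_inner \<nu> (?q t) (\<lambda>x. clip (V t x - f x)) + 2 * (\<integral>x. \<bar>approx n t x - V t x\<bar> \<partial>\<nu>)"
      using i2 i3 by (simp add: L2_inner_def)
    also have "(\<integral>x. \<bar>approx n t x - V t x\<bar> \<partial>\<nu>) \<le> S * L2_dist \<nu> (approx n t) (V t)"
      unfolding S_def by (rule L1_norm_le_L2_norm[OF finite_nu DL])
    also have "\<dots> \<le> S * \<delta>" using close[OF t', of n] S0 by (intro mult_left_mono) (auto simp: \<delta>_def)
    finally show ?thesis using e_ge(1) by simp
  qed
  have c3: "L2_norm \<nu> (\<lambda>x. (v0 x - (cumulative ?p t x + lam * cumulative ?q t x)) - V t x) \<le> ?e"
    if t: "t \<in> {0..T}" for t
  proof -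
    note bj = simple_bounded_joint[OF simple(1) bounds(1)] simple_bounded_joint[OF simple(2) bounds(2)]
    have int: "(\<lambda>s. ?p s x) integrable_on {0..t}" "(\<lambda>s. ?q s x) integrable_on {0..t}" for x
    proof -
      define k where "k = grid_index n t"
      define y where "y = t - real k * mesh n"
      have y: "0 \<le> y" "y \<le> mesh n" using grid_index_le[OF t, of n] by (auto simp: y_def k_def)
      show "(\<lambda>s. ?p s x) integrable_on {0..t}" "(\<lambda>s. ?q s x) integrable_on {0..t}"
        using step_function_has_integral[OF y, of "\<lambda>j. TV_grad (euler n j) x" k]
          step_function_has_integral[OF y, of "\<lambda>j. sgn (euler n j x - f x)" k]
        by (auto simp: approx_def y_def intro: has_integral_integrable)
    qed
    have "cumulative ?p t x + lam * cumulative ?q t x = integral {0..t} (\<lambda>s. drift (approx n s) x)" for x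
    proof -
      have "integral {0..t} (\<lambda>s. drift (approx n s) x) = integral {0..t} (\<lambda>s. ?p s x) + integral {0..t} (\<lambda>s. lam * ?q s x)"
        unfolding drift_def
        by (rule Henstock_Kurzweil_Integration.integral_add[OF int(1) integrable_on_mult_right[OF int(2)]])
      then show ?thesis by (simp add: cumulative_eq_integral[OF bj(1) t] cumulative_eq_integral[OF bj(2) t])
    qed
    then have near: "L2_norm \<nu> (\<lambda>x. (v0 x - (cumulative ?p t x + lam * cumulative ?q t x)) - approx n t x) \<le> scale * rate ^ n"
      using approx_integral[OF t, of n] by simp
    have "L2_norm \<nu> (\<lambda>x. (v0 x - (cumulative ?p t x + lam * cumulative ?q t x)) - V t x)
      \<le> L2_norm \<nu> (\<lambda>x. (v0 x - (cumulative ?p t x + lam * cumulative ?q t x)) - approx n t x) + L2_dist \<nu> (approx n t) (V t)"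
      by (intro L2_norm_triangle_diff L2_diff L2_add L2_scale cumulative_L2 bj v0 approx_L2 V t)
    also have "\<dots> \<le> scale * rate ^ n + \<delta>" using near close[OF t, of n] by (simp add: \<delta>_def)
    finally show ?thesis using e_ge(2) by linarith
  qed
  show ?thesis
    unfolding approx_pairs_def mem_Collect_eq case_prod_conv
    by (intro conjI ballI allI simple bounds c1 c2 c3)
qed

end

section \<open>Existence\<close>

context flow_data
begin

text \<open>
  The squared distances at a fixed time have a sum which is integrable over time, so they tend to zero for
  almost every time, with no passage to a subsequence.  Clipping the limit makes the bound hold everywhere
  and, being a contraction that fixes the sequence, does not spoil the convergence.
\<close>

lemma fast_simple_sequence_limit:
  assumes p: "\<And>n::nat. L2_simple time \<nu> (p n)" and b: "\<And>n t x. \<bar>p n t x\<bar> \<le> 1"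
    and fast: "\<And>n. L2_dist (time \<Otimes>\<^sub>M \<nu>) (case_prod (p n)) (case_prod (p (Suc n))) \<le> (1 / 2) ^ n"
  obtains \<eta> where "bounded_joint \<eta>" "L2_strongly_measurable time \<nu> \<eta>"
    "\<And>n. L2_dist (time \<Otimes>\<^sub>M \<nu>) (case_prod (p n)) (case_prod \<eta>) \<le> 2 * (1 / 2) ^ n"
    "AE t in time. (\<lambda>n. L2_dist \<nu> (p n t) (\<eta> t)) \<longlonglongrightarrow> 0"
proof -
  let ?P = "time \<Otimes>\<^sub>M \<nu>"
  have bj: "bounded_joint (p n)" for n by (rule simple_bounded_joint[OF p b])
  have "\<exists>g\<in>L2_space ?P. \<forall>n. L2_dist ?P (case_prod (p n)) g \<le> 1 * (1 / 2) ^ n / (1 - 1 / 2)"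
  proof (rule Riesz_Fischer_geometric[OF TS.P.finite_measure_axioms bounded_joint_sections(3)[OF bj]])
    show "L2_dist ?P (case_prod (p (Suc n))) (case_prod (p n)) \<le> 1 * (1 / 2) ^ n" for n
      using fast[of n] by (subst L2_norm_minus_commute) simp
  qed auto
  then have "\<exists>g\<in>L2_space ?P. \<forall>n. L2_dist ?P (case_prod (p n)) g \<le> 2 * (1 / 2) ^ n"
    by (simp add: mult.commute)
  then obtain g where g: "g \<in> L2_space ?P" "\<And>n. L2_dist ?P (case_prod (p n)) g \<le> 2 * (1 / 2) ^ n"
    by blast
  have [measurable]: "g \<in> borel_measurable ?P" using g(1) by (rule L2_spaceD(1))
  define \<eta> where "\<eta> t x = clip (g (t, x))" for t x
  have \<eta>g: "case_prod \<eta> = (\<lambda>z. clip (g z))" by (auto simp: \<eta>_def fun_eq_iff)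
  have \<eta>: "bounded_joint \<eta>"
    unfolding bounded_joint_def \<eta>g by (auto simp: \<eta>_def clip_simps)
  have norm: "L2_dist ?P (case_prod (p n)) (case_prod \<eta>) \<le> 2 * (1 / 2) ^ n" for n
  proof -
    have "L2_dist ?P (case_prod (p n)) (case_prod \<eta>) \<le> L2_dist ?P (case_prod (p n)) g"
    proof (rule L2_norm_mono)
      show "(\<lambda>z. case_prod (p n) z - g z) \<in> L2_space ?P" by (intro L2_diff bounded_joint_sections(3) bj g)
      show "(\<lambda>z. case_prod (p n) z - case_prod \<eta> z) \<in> borel_measurable ?P"
        by (intro L2_spaceD(1) L2_diff bounded_joint_sections(3) bj \<eta>)
      show "AE z in ?P. \<bar>case_prod (p n) z - case_prod \<eta> z\<bar> \<le> \<bar>case_prod (p n) z - g z\<bar>"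
      proof (rule AE_I2)
        fix z
        have "clip (case_prod (p n) z) = case_prod (p n) z" using b by (intro clip_simps) (simp add: case_prod_beta)
        then show "\<bar>case_prod (p n) z - case_prod \<eta> z\<bar> \<le> \<bar>case_prod (p n) z - g z\<bar>"
          unfolding \<eta>g using clip_simps(2)[of "case_prod (p n) z" "g z"] by simp
      qed
    qed
    then show ?thesis using g(2)[of n] by linarith
  qed
  have DL: "(\<lambda>x. p n t x - \<eta> t x) \<in> L2_space \<nu>" if "t \<in> space time" for n t
    using that by (intro L2_diff bounded_joint_sections(2)[OF bj] bounded_joint_sections(2)[OF \<eta>]) auto
  have Dm: "case_prod (\<lambda>t x. p n t x - \<eta> t x) \<in> borel_measurable ?P" for n
    using L2_spaceD(1)[OF L2_diff[OF bounded_joint_sections(3)[OF bj[of n]] bounded_joint_sections(3)[OF \<eta>]]]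
    by (simp add: case_prod_unfold)
  have DP: "(\<lambda>z. case_prod (p n) z - case_prod \<eta> z) \<in> L2_space ?P" for n
    by (intro L2_diff bounded_joint_sections(3) bj \<eta>)
  have int: "(\<integral>\<^sup>+t. ennreal ((L2_dist \<nu> (p n t) (\<eta> t))\<^sup>2) \<partial>time) \<le> ennreal (4 * (1 / 4) ^ n)" for n
  proof -
    have "(\<integral>\<^sup>+t. ennreal ((L2_dist \<nu> (p n t) (\<eta> t))\<^sup>2) \<partial>time)
      = (\<integral>\<^sup>+z. ennreal ((case_prod (\<lambda>t x. p n t x - \<eta> t x) z)\<^sup>2) \<partial>?P)"
      by (rule TS.nn_integral_L2_norm_sq[OF Dm DL])
    also have "\<dots> = ennreal ((L2_dist ?P (case_prod (p n)) (case_prod \<eta>))\<^sup>2)"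
      using L2_norm_ennreal[OF DP[of n]] by (simp add: case_prod_unfold)
    also have "\<dots> \<le> ennreal ((2 * (1 / 2) ^ n)\<^sup>2)"
      by (intro ennreal_leI power_mono norm L2_norm_nonneg)
    also have "(2 * (1 / 2) ^ n)\<^sup>2 = (4 * (1 / 4) ^ n :: real)"
    proof -
      have "(1 / 4 :: real) ^ n = (1 / 2) ^ n * (1 / 2) ^ n" by (simp flip: power_mult_distrib)
      then show ?thesis by (simp only: power2_eq_square)
    qed
    finally show ?thesis .
  qed
  have [measurable]: "(\<lambda>t. ennreal ((L2_dist \<nu> (p n t) (\<eta> t))\<^sup>2)) \<in> borel_measurable time" for n
  proof -
    have "(\<lambda>t. \<integral>\<^sup>+x. ennreal ((p n t x - \<eta> t x)\<^sup>2) \<partial>\<nu>) \<in> borel_measurable time"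
      by (rule TS.N.borel_measurable_nn_integral) (use Dm[of n] in measurable)
    then show ?thesis by (subst measurable_cong[OF L2_norm_ennreal[OF DL]])
  qed
  have "(\<integral>\<^sup>+t. (\<Sum>n. ennreal ((L2_dist \<nu> (p n t) (\<eta> t))\<^sup>2)) \<partial>time)
      = (\<Sum>n. \<integral>\<^sup>+t. ennreal ((L2_dist \<nu> (p n t) (\<eta> t))\<^sup>2) \<partial>time)"
    by (rule nn_integral_suminf) measurable
  also have "\<dots> \<le> (\<Sum>n. ennreal (4 * (1 / 4) ^ n))" by (intro suminf_le int) auto
  also have "\<dots> < \<infinity>"
  proof -
    have "summable (\<lambda>n. 4 * (1 / 4 :: real) ^ n)" by (intro summable_mult summable_geometric) auto
    then show ?thesis by (subst suminf_ennreal_eq[OF _ summable_sums]) auto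
  qed
  finally have "AE t in time. (\<Sum>n. ennreal ((L2_dist \<nu> (p n t) (\<eta> t))\<^sup>2)) \<noteq> \<infinity>"
    by (intro nn_integral_PInf_AE) auto
  then have lim: "AE t in time. (\<lambda>n. L2_dist \<nu> (p n t) (\<eta> t)) \<longlonglongrightarrow> 0"
  proof eventually_elim
    case (elim t)
    then have "summable (\<lambda>n. (L2_dist \<nu> (p n t) (\<eta> t))\<^sup>2)"
      by (intro summable_suminf_not_top) (auto simp: top_ennreal_def)
    then have "(\<lambda>n. sqrt ((L2_dist \<nu> (p n t) (\<eta> t))\<^sup>2)) \<longlonglongrightarrow> sqrt 0"
      by (intro tendsto_real_sqrt summable_LIMSEQ_zero)
    then show ?case by (simp add: L2_norm_nonneg)
  qed
  have "L2_strongly_measurable time \<nu> \<eta>"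
    unfolding L2_strongly_measurable_def
  proof (intro conjI ballI exI[of _ p] allI p)
    show "\<eta> t \<in> L2_space \<nu>" if "t \<in> space time" for t using bounded_joint_sections(2)[OF \<eta>] that by simp
    show "AE t in time. (\<lambda>n. L2_dist \<nu> (\<eta> t) (p n t)) \<longlonglongrightarrow> 0"
      using lim by (simp add: L2_norm_minus_commute[of \<nu> "\<eta> _"])
  qed
  then show thesis using that[OF \<eta> _ norm lim] by blast
qed

text \<open>
  The sets of approximate pairs decrease with the error and contain the pairs of the Euler schemes.
  A fast Cauchy sequence of members exists by the parallelogram law in \<open>L\<^sup>2\<close> of the product space, and
  the conditions defining the sets pass to its limit with error zero.
\<close>

lemma limit_pair_exists:
  obtains V \<eta> \<xi> where
    "\<And>t. t \<in> {0..T} \<Longrightarrow> V t \<in> L2_space \<nu>"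
    "\<And>t. t \<in> {0..T} \<Longrightarrow> (\<lambda>n. L2_dist \<nu> (approx n t) (V t)) \<longlonglongrightarrow> 0"
    "bounded_joint \<eta>" "L2_strongly_measurable time \<nu> \<eta>"
    "bounded_joint \<xi>" "L2_strongly_measurable time \<nu> \<xi>"
    "\<And>t. t \<in> {0..T} \<Longrightarrow> L2_norm \<nu> (\<lambda>x. (v0 x - (cumulative \<eta> t x + lam * cumulative \<xi> t x)) - V t x) = 0"
    "AE t in time. \<forall>w\<in>L2_space \<nu>. TVr (V t) + L2_inner \<nu> (\<eta> t) (\<lambda>x. w x - V t x) \<le> TVr w"
    "AE t in time. (\<integral>x. \<bar>clip (V t x - f x)\<bar> \<partial>\<nu>) \<le> L2_inner \<nu> (\<xi> t) (\<lambda>x. clip (V t x - f x))"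
proof -
  let ?P = "time \<Otimes>\<^sub>M \<nu>"
  obtain V where V: "\<And>t. t \<in> {0..T} \<Longrightarrow> V t \<in> L2_space \<nu>"
    and close: "\<And>t n. t \<in> {0..T} \<Longrightarrow> L2_dist \<nu> (approx n t) (V t) \<le> 4 * scale * rate ^ n / (1 - rate)"
    using euler_limit_exists by blast
  have rate0: "(\<lambda>n. rate ^ n) \<longlonglongrightarrow> 0" using rate by (intro LIMSEQ_realpow_zero) auto
  have Vlim: "(\<lambda>n. L2_dist \<nu> (approx n t) (V t)) \<longlonglongrightarrow> 0" if t: "t \<in> {0..T}" for t
  proof (rule tendsto_sandwich[OF _ _ tendsto_const])
    have "(\<lambda>n. 4 * scale * rate ^ n / (1 - rate)) \<longlonglongrightarrow> 4 * scale * 0 / (1 - rate)"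
      using rate by (intro tendsto_intros rate0) auto
    then show "(\<lambda>n. 4 * scale * rate ^ n / (1 - rate)) \<longlonglongrightarrow> 0" by simp
  qed (use close[OF t] in \<open>auto simp: L2_norm_nonneg\<close>)
  define K where "K = (2 * sqrt total_mass + 1) * (4 * scale / (1 - rate)) + scale"
  have K0: "0 \<le> K" using scale_nonneg rate by (simp add: K_def)
  define \<epsilon> where "\<epsilon> n = K * rate ^ n" for n
  have \<epsilon>0: "\<epsilon> \<longlonglongrightarrow> 0" unfolding \<epsilon>_def[abs_def] using tendsto_mult_right_zero[OF rate0] .
  define E where "E n = approx_pairs V (\<epsilon> n)" for n
  define Q where "Q a = (L2_norm ?P (case_prod (fst a)))\<^sup>2 + (L2_norm ?P (case_prod (snd a)))\<^sup>2"
    for a :: "(real \<Rightarrow> 'a \<Rightarrow> real) \<times> (real \<Rightarrow> 'a \<Rightarrow> real)"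
  define D where "D a b = (L2_dist ?P (case_prod (fst a)) (case_prod (fst b)))\<^sup>2
      + (L2_dist ?P (case_prod (snd a)) (case_prod (snd b)))\<^sup>2"
    for a b :: "(real \<Rightarrow> 'a \<Rightarrow> real) \<times> (real \<Rightarrow> 'a \<Rightarrow> real)"
  have E_bj: "bounded_joint (fst a)" "bounded_joint (snd a)" if "a \<in> E n" for a n
    using that unfolding E_def approx_pairs_def mem_Collect_eq case_prod_beta
    by (blast intro: simple_bounded_joint)+
  define B where "B = sqrt (measure ?P (space ?P))"
  have norm_B: "(L2_norm ?P (case_prod g))\<^sup>2 \<le> B\<^sup>2" if "bounded_joint g" for g
    using L2_norm_bounded[OF TS.P.finite_measure_axioms, of "case_prod g" 1] that
    by (intro power_mono) (auto simp: B_def bounded_joint_def L2_norm_nonneg)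
  have "\<exists>e. \<forall>n. e n \<in> E n \<and> D (e n) (e (Suc n)) \<le> (1/4) ^ n"
  proof (rule nested_midpoint_convex_Cauchy[where Q=Q and mid=mid and B="B\<^sup>2 + B\<^sup>2"])
    show "E n \<noteq> {}" for n
      using euler_approx_pair[OF V close, of n] by (auto simp: E_def \<epsilon>_def K_def)
    show "E (Suc n) \<subseteq> E n" for n
      unfolding E_def by (rule approx_pairs_mono) (use K0 rate in \<open>auto simp: \<epsilon>_def mult_left_mono mult_left_le_one_le\<close>)
    show "mid a b \<in> E n" if "a \<in> E n" "b \<in> E n" for n a b
      using approx_pairs_mid[of V a "\<epsilon> n" b] V that unfolding E_def by blast
    show "0 \<le> Q a \<and> Q a \<le> B\<^sup>2 + B\<^sup>2" if "a \<in> E 0" for a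
      using norm_B[OF E_bj(1)[OF that]] norm_B[OF E_bj(2)[OF that]] by (simp add: Q_def)
    fix a b assume a: "a \<in> E 0" and b: "b \<in> E 0"
    have m: "case_prod (fst (mid a b)) = (\<lambda>z. (case_prod (fst a) z + case_prod (fst b) z) / 2)"
      "case_prod (snd (mid a b)) = (\<lambda>z. (case_prod (snd a) z + case_prod (snd b) z) / 2)"
      by (auto simp: mid_def fun_eq_iff)
    show "Q (mid a b) = (Q a + Q b) / 2 - D a b / 4"
      unfolding Q_def D_def m
        L2_parallelogram[OF bounded_joint_sections(3)[OF E_bj(1)[OF a]] bounded_joint_sections(3)[OF E_bj(1)[OF b]]]
        L2_parallelogram[OF bounded_joint_sections(3)[OF E_bj(2)[OF a]] bounded_joint_sections(3)[OF E_bj(2)[OF b]]]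
      by (simp add: field_simps)
  qed
  then obtain e where e: "\<And>n. e n \<in> E n" "\<And>n. D (e n) (e (Suc n)) \<le> (1/4) ^ n" by blast
  define p q where "p n = fst (e n)" and "q n = snd (e n)" for n
  have pq_mem: "(p n, q n) \<in> approx_pairs V (\<epsilon> n)" for n using e(1)[of n] by (simp add: E_def p_def q_def)
  have simple: "L2_simple time \<nu> (p n)" "L2_simple time \<nu> (q n)"
    and bounds: "\<bar>p n t x\<bar> \<le> 1" "\<bar>q n t x\<bar> \<le> 1"
    and c1: "t \<in> {0<..<T} \<Longrightarrow> w \<in> L2_space \<nu> \<Longrightarrow> TVr (V t) + L2_inner \<nu> (p n t) (\<lambda>x. w x - V t x) \<le> TVr w + \<epsilon> n"
    and c2: "t \<in> {0<..<T} \<Longrightarrow> (\<integral>x. \<bar>clip (V t x - f x)\<bar> \<partial>\<nu>) \<le> L2_inner \<nu> (q n t) (\<lambda>x. clip (V t x - f x)) + \<epsilon> n"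
    and c3: "t \<in> {0..T} \<Longrightarrow> L2_norm \<nu> (\<lambda>x. (v0 x - (cumulative (p n) t x + lam * cumulative (q n) t x)) - V t x) \<le> \<epsilon> n"
    for n t x w
    using pq_mem[of n] unfolding approx_pairs_def by blast+
  have bj: "bounded_joint (p n)" "bounded_joint (q n)" for n
    by (rule simple_bounded_joint[OF simple(1) bounds(1)], rule simple_bounded_joint[OF simple(2) bounds(2)])
  have fast: "L2_dist ?P (case_prod (p n)) (case_prod (p (Suc n))) \<le> (1/2) ^ n"
    "L2_dist ?P (case_prod (q n)) (case_prod (q (Suc n))) \<le> (1/2) ^ n" for n
  proof -
    have "(1/4 :: real) ^ n = ((1/2) ^ n)\<^sup>2" unfolding power2_eq_square by (simp flip: power_mult_distrib)
    then have "(L2_dist ?P (case_prod (p n)) (case_prod (p (Suc n))))\<^sup>2 \<le> ((1/2) ^ n)\<^sup>2"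
      "(L2_dist ?P (case_prod (q n)) (case_prod (q (Suc n))))\<^sup>2 \<le> ((1/2) ^ n)\<^sup>2"
      using e(2)[of n] zero_le_power2[of "L2_dist ?P (case_prod (p n)) (case_prod (p (Suc n)))"]
        zero_le_power2[of "L2_dist ?P (case_prod (q n)) (case_prod (q (Suc n)))"]
      unfolding D_def p_def q_def by linarith+
    then show "L2_dist ?P (case_prod (p n)) (case_prod (p (Suc n))) \<le> (1/2) ^ n"
      "L2_dist ?P (case_prod (q n)) (case_prod (q (Suc n))) \<le> (1/2) ^ n"
      by (auto intro: power2_le_imp_le)
  qed
  obtain \<eta> where \<eta>: "bounded_joint \<eta>" "L2_strongly_measurable time \<nu> \<eta>"
    "\<And>n. L2_dist ?P (case_prod (p n)) (case_prod \<eta>) \<le> 2 * (1 / 2) ^ n"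
    "AE t in time. (\<lambda>n. L2_dist \<nu> (p n t) (\<eta> t)) \<longlonglongrightarrow> 0"
    using fast_simple_sequence_limit[OF simple(1) bounds(1) fast(1)] by blast
  obtain \<xi> where \<xi>: "bounded_joint \<xi>" "L2_strongly_measurable time \<nu> \<xi>"
    "\<And>n. L2_dist ?P (case_prod (q n)) (case_prod \<xi>) \<le> 2 * (1 / 2) ^ n"
    "AE t in time. (\<lambda>n. L2_dist \<nu> (q n t) (\<xi> t)) \<longlonglongrightarrow> 0"
    using fast_simple_sequence_limit[OF simple(2) bounds(2) fast(2)] by blast
  have r1: "AE t in time. \<forall>w\<in>L2_space \<nu>. TVr (V t) + L2_inner \<nu> (\<eta> t) (\<lambda>x. w x - V t x) \<le> TVr w"
    using \<eta>(4) AE_space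
  proof eventually_elim
    case (elim t)
    then have t: "t \<in> {0<..<T}" "t \<in> {0..T}" by auto
    show ?case
    proof
      fix w assume w: "w \<in> L2_space \<nu>"
      have "(\<lambda>n. TVr (V t) + L2_inner \<nu> (p n t) (\<lambda>x. w x - V t x)) \<longlonglongrightarrow> TVr (V t) + L2_inner \<nu> (\<eta> t) (\<lambda>x. w x - V t x)"
        by (intro tendsto_add tendsto_const L2_inner_tendsto elim(1) always_eventually allI bounded_joint_sections(2) bj \<eta>(1) t L2_diff w V)
      moreover have "(\<lambda>n. TVr w + \<epsilon> n) \<longlonglongrightarrow> TVr w + 0" by (intro tendsto_add tendsto_const \<epsilon>0)
      ultimately show "TVr (V t) + L2_inner \<nu> (\<eta> t) (\<lambda>x. w x - V t x) \<le> TVr w"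
        using c1[OF t(1) w] by (auto intro: LIMSEQ_le)
    qed
  qed
  have r2: "AE t in time. (\<integral>x. \<bar>clip (V t x - f x)\<bar> \<partial>\<nu>) \<le> L2_inner \<nu> (\<xi> t) (\<lambda>x. clip (V t x - f x))"
    using \<xi>(4) AE_space
  proof eventually_elim
    case (elim t)
    then have t: "t \<in> {0<..<T}" "t \<in> {0..T}" by auto
    have "(\<lambda>n. L2_inner \<nu> (q n t) (\<lambda>x. clip (V t x - f x)) + \<epsilon> n) \<longlonglongrightarrow> L2_inner \<nu> (\<xi> t) (\<lambda>x. clip (V t x - f x)) + 0"
      by (intro tendsto_add \<epsilon>0 L2_inner_tendsto elim(1) always_eventually allI bounded_joint_sections(2) bj \<xi>(1) t clip_L2 L2_spaceD(1)[OF V])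
    then show ?case using c2[OF t(1)] by (intro LIMSEQ_le_const) auto
  qed
  have r3: "L2_norm \<nu> (\<lambda>x. (v0 x - (cumulative \<eta> t x + lam * cumulative \<xi> t x)) - V t x) = 0" if t: "t \<in> {0..T}" for t
  proof -
    let ?S = "sqrt (measure time (space time))"
    have le: "L2_norm \<nu> (\<lambda>x. (v0 x - (cumulative \<eta> t x + lam * cumulative \<xi> t x)) - V t x)
      \<le> \<epsilon> n + (?S * (2 * (1/2) ^ n) + lam * (?S * (2 * (1/2) ^ n)))" for n
    proof -
      let ?a = "\<lambda>x. (v0 x - (cumulative (p n) t x + lam * cumulative (q n) t x)) - V t x"
      let ?b = "\<lambda>x. cumulative (p n) t x - cumulative \<eta> t x"
      let ?c = "\<lambda>x. lam * (cumulative (q n) t x - cumulative \<xi> t x)"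
      have L: "?a \<in> L2_space \<nu>" "?b \<in> L2_space \<nu>" "?c \<in> L2_space \<nu>"
        by (intro L2_diff L2_add L2_scale cumulative_L2 bj \<eta> \<xi> v0 V t)+
      have eq: "(\<lambda>x. (v0 x - (cumulative \<eta> t x + lam * cumulative \<xi> t x)) - V t x) = (\<lambda>x. ?a x + (?b x + ?c x))"
        by (simp add: fun_eq_iff algebra_simps)
      have "L2_norm \<nu> (\<lambda>x. (v0 x - (cumulative \<eta> t x + lam * cumulative \<xi> t x)) - V t x)
        \<le> L2_norm \<nu> ?a + (L2_norm \<nu> ?b + L2_norm \<nu> ?c)"
        unfolding eq using L2_norm_triangle[OF L(1) L2_add[OF L(2,3)]] L2_norm_triangle[OF L(2,3)] by linarith
      moreover have "L2_norm \<nu> ?b \<le> ?S * (2 * (1/2) ^ n)"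
        using cumulative_diff_norm[OF bj(1) \<eta>(1), of n t] mult_left_mono[OF \<eta>(3)[of n], of ?S] by simp
      moreover have "L2_norm \<nu> ?c \<le> lam * (?S * (2 * (1/2) ^ n))"
      proof -
        have "L2_dist \<nu> (cumulative (q n) t) (cumulative \<xi> t) \<le> ?S * (2 * (1/2) ^ n)"
          using cumulative_diff_norm[OF bj(2) \<xi>(1), of n t] mult_left_mono[OF \<xi>(3)[of n], of ?S] by simp
        then show ?thesis unfolding L2_norm_scale using lam by (simp add: mult_left_mono)
      qed
      ultimately show ?thesis using c3[OF t, of n] by linarith
    qed
    have half0: "(\<lambda>n. (1/2 :: real) ^ n) \<longlonglongrightarrow> 0" by (rule LIMSEQ_realpow_zero) auto
    have "(\<lambda>n. \<epsilon> n + (?S * (2 * (1/2) ^ n) + lam * (?S * (2 * (1/2) ^ n)))) \<longlonglongrightarrow> 0 + (?S * (2 * 0) + lam * (?S * (2 * 0)))"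
      by (intro tendsto_add \<epsilon>0 tendsto_mult tendsto_const half0)
    then have "L2_norm \<nu> (\<lambda>x. (v0 x - (cumulative \<eta> t x + lam * cumulative \<xi> t x)) - V t x) \<le> 0"
      using le by (intro LIMSEQ_le_const) auto
    then show ?thesis by (rule order.antisym[OF _ L2_norm_nonneg])
  qed
  show thesis by (rule that[OF V Vlim \<eta>(1,2) \<xi>(1,2) r3 r1 r2])
qed

lemma L1_loc_bounded:
  assumes sm: "L2_strongly_measurable time \<nu> g" and b: "\<And>t. t \<in> {0<..<T} \<Longrightarrow> L2_norm \<nu> (g t) \<le> C"
  shows "L1_loc_L2 \<nu> T g"
  unfolding L1_loc_L2_def
proof (intro conjI allI impI sm)
  fix K assume K: "compact K \<and> K \<subseteq> {0<..<T}"
  interpret K: finite_measure "lebesgue_on K"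
    using K by (intro finite_measure_lebesgue_on lmeasurable_compact) auto
  have "(\<integral>\<^sup>+t. ennreal (L2_norm \<nu> (g t)) \<partial>lebesgue_on K) \<le> (\<integral>\<^sup>+t. ennreal C \<partial>lebesgue_on K)"
    by (intro nn_integral_mono ennreal_leI b) (use K in auto)
  also have "\<dots> < \<infinity>"
    using K.emeasure_finite[of "space (lebesgue_on K)"]
    by (auto simp: ennreal_mult_eq_top_iff simp flip: top.not_eq_extremum)
  finally show "(\<integral>\<^sup>+t. ennreal (L2_norm \<nu> (g t)) \<partial>lebesgue_on K) < \<infinity>" .
qed

lemma cumulative_jointly_measurable:
  assumes g: "bounded_joint g"
  shows "case_prod (cumulative g) \<in> borel_measurable (time \<Otimes>\<^sub>M \<nu>)"
proof -
  have gm: "case_prod g \<in> borel_measurable (time \<Otimes>\<^sub>M \<nu>)" using g by (simp add: bounded_joint_def)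
  have [measurable]: "(\<lambda>y. g (snd y) (snd (fst y))) \<in> borel_measurable ((time \<Otimes>\<^sub>M \<nu>) \<Otimes>\<^sub>M time)"
    using measurable_compose[OF _ gm, of "\<lambda>y. (snd y, snd (fst y))" "(time \<Otimes>\<^sub>M \<nu>) \<Otimes>\<^sub>M time"] by simp
  note measurable_time_ident[measurable]
  have "case_prod (\<lambda>z s. if s < fst z then g s (snd z) else 0) \<in> borel_measurable ((time \<Otimes>\<^sub>M \<nu>) \<Otimes>\<^sub>M time)"
    unfolding case_prod_beta by measurable
  then have "(\<lambda>z. \<integral>s. (if s < fst z then g s (snd z) else 0) \<partial>time) \<in> borel_measurable (time \<Otimes>\<^sub>M \<nu>)"
    by (rule TS.M.borel_measurable_lebesgue_integral)
  then show ?thesis by (simp add: cumulative_def[abs_def] case_prod_unfold)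
qed

lemma TVr_cong_norm_zero:
  assumes "u \<in> L2_space \<nu>" "w \<in> L2_space \<nu>" "L2_dist \<nu> u w = 0"
  shows "TVr u = TVr w"
  using TVr_Lipschitz[OF assms(1,2)] assms(3) by simp

text \<open>
  The solution is not the limit \<open>V\<close> of the schemes, whose values are determined only up to null sets
  depending on time, but the function driven by \<open>(\<eta>, \<xi>)\<close>, which equals \<open>V t\<close> almost everywhere for every
  \<open>t\<close>.  It is jointly measurable and Lipschitz in time at every point, so that its weak derivative is found
  by integration by parts at each point of the space.
\<close>

theorem strong_solution_exists: "\<exists>v. strong_solution m \<nu> f lam T v0 v"
proof -
  obtain V \<eta> \<xi> where V: "\<And>t. t \<in> {0..T} \<Longrightarrow> V t \<in> L2_space \<nu>"
    and Vlim: "\<And>t. t \<in> {0..T} \<Longrightarrow> (\<lambda>n. L2_dist \<nu> (approx n t) (V t)) \<longlonglongrightarrow> 0"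
    and \<eta>: "bounded_joint \<eta>" "L2_strongly_measurable time \<nu> \<eta>"
    and \<xi>: "bounded_joint \<xi>" "L2_strongly_measurable time \<nu> \<xi>"
    and drive: "\<And>t. t \<in> {0..T} \<Longrightarrow> L2_norm \<nu> (\<lambda>x. (v0 x - (cumulative \<eta> t x + lam * cumulative \<xi> t x)) - V t x) = 0"
    and sub: "AE t in time. \<forall>w\<in>L2_space \<nu>. TVr (V t) + L2_inner \<nu> (\<eta> t) (\<lambda>x. w x - V t x) \<le> TVr w"
    and sign: "AE t in time. (\<integral>x. \<bar>clip (V t x - f x)\<bar> \<partial>\<nu>) \<le> L2_inner \<nu> (\<xi> t) (\<lambda>x. clip (V t x - f x))"
    using limit_pair_exists by blast
  define v where "v t x = v0 x - (cumulative \<eta> t x + lam * cumulative \<xi> t x)" for t x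
  define v' where "v' t x = (-1) * \<eta> t x - lam * \<xi> t x" for t x
  have drive': "L2_dist \<nu> (v t) (V t) = 0" if "t \<in> {0..T}" for t using drive[OF that] by (simp add: v_def)
  have vL: "v t \<in> L2_space \<nu>" for t
    unfolding v_def[abs_def] by (intro L2_diff L2_add L2_scale cumulative_L2 \<eta> \<xi> v0)
  have \<eta>L: "\<eta> t \<in> L2_space \<nu>" and \<xi>L: "\<xi> t \<in> L2_space \<nu>" if "t \<in> {0<..<T}" for t
    by (rule bounded_joint_sections(2)[OF \<eta>(1) that], rule bounded_joint_sections(2)[OF \<xi>(1) that])
  have \<eta>b: "\<bar>\<eta> t x\<bar> \<le> 1" and \<xi>b: "\<bar>\<xi> t x\<bar> \<le> 1" for t x using \<eta> \<xi> by (auto simp: bounded_joint_def)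
  have Lip: "\<bar>v s x - v t x\<bar> \<le> (1 + lam) * \<bar>s - t\<bar>" for s t x
  proof -
    have "\<bar>lam * (cumulative \<xi> t x - cumulative \<xi> s x)\<bar> \<le> lam * \<bar>s - t\<bar>"
      using cumulative_Lipschitz[OF \<xi>(1), of t x s] lam by (simp add: abs_mult abs_minus_commute mult_left_mono)
    moreover have "v s x - v t x = (cumulative \<eta> t x - cumulative \<eta> s x) + lam * (cumulative \<xi> t x - cumulative \<xi> s x)"
      by (simp add: v_def algebra_simps)
    ultimately show ?thesis
      using cumulative_Lipschitz[OF \<eta>(1), of t x s] by (simp add: distrib_right abs_minus_commute)
  qed
  have LipL: "L2_dist \<nu> (v s) (v t) \<le> (1 + lam) * \<bar>s - t\<bar> * sqrt total_mass" for s t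
    using L2_norm_bounded[OF finite_nu L2_spaceD(1)[OF L2_diff[OF vL vL]] Lip, of s t] lam by (simp add: abs_mult)
  have cont: "continuous_L2 \<nu> T v"
    unfolding continuous_L2_def
  proof (intro ballI conjI vL)
    fix t
    have "((\<lambda>s. (1 + lam) * \<bar>s - t\<bar> * sqrt total_mass) \<longlongrightarrow> (1 + lam) * \<bar>t - t\<bar> * sqrt total_mass) (at t within {0..T})"
      by (intro tendsto_intros)
    then have "((\<lambda>s. (1 + lam) * \<bar>s - t\<bar> * sqrt total_mass) \<longlongrightarrow> 0) (at t within {0..T})" by simp
    then show "((\<lambda>s. L2_dist \<nu> (v s) (v t)) \<longlongrightarrow> 0) (at t within {0..T})"
      by (rule Lim_null_comparison[rotated]) (use LipL in \<open>auto simp: L2_norm_nonneg\<close>)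
  qed
  have init: "v 0 x = v0 x" for x by (simp add: v_def cumulative_zero)
  have v_sm: "L2_strongly_measurable time \<nu> v"
    unfolding L2_strongly_measurable_def
  proof (intro conjI ballI exI[of _ approx] allI vL AE_I2)
    show "L2_simple time \<nu> (approx n)" for n
      unfolding approx_def[abs_def] by (rule L2_simple_grid[OF euler_L2])
    fix t assume "t \<in> space time"
    then have t: "t \<in> {0..T}" by simp
    show "(\<lambda>n. L2_dist \<nu> (v t) (approx n t)) \<longlonglongrightarrow> 0"
    proof (rule tendsto_sandwich[OF _ _ tendsto_const Vlim[OF t]])
      have "L2_dist \<nu> (v t) (approx n t) \<le> L2_dist \<nu> (approx n t) (V t)" for n
        using L2_norm_triangle_diff[OF vL V[OF t] approx_L2, of t n t] drive'[OF t]
        by (simp add: L2_norm_minus_commute[of \<nu> "V t"])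
      then show "\<forall>\<^sub>F n in sequentially. L2_dist \<nu> (v t) (approx n t) \<le> L2_dist \<nu> (approx n t) (V t)" by simp
    qed (auto simp: L2_norm_nonneg)
  qed
  have v'_sm: "L2_strongly_measurable time \<nu> v'"
    unfolding v'_def[abs_def]
    by (intro TS.L2_strongly_measurable_diff TS.L2_strongly_measurable_cmult \<eta> \<xi>) auto
  have v'b: "\<bar>v' t x\<bar> \<le> 1 + lam" for t x
  proof -
    have "\<bar>lam * \<xi> t x\<bar> \<le> lam" using \<xi>b[of t x] lam by (simp add: abs_mult)
    then show ?thesis using \<eta>b[of t x] by (simp add: v'_def)
  qed
  have v'L: "v' t \<in> L2_space \<nu>" if "t \<in> {0<..<T}" for t
    unfolding v'_def[abs_def] by (intro L2_diff L2_scale \<eta>L \<xi>L that)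
  have v'n: "L2_norm \<nu> (v' t) \<le> (1 + lam) * sqrt total_mass" if "t \<in> {0<..<T}" for t
    using L2_norm_bounded[OF finite_nu L2_spaceD(1)[OF v'L[OF that]] v'b] lam by simp
  have vn: "L2_norm \<nu> (v t) \<le> L2_norm \<nu> v0 + (1 + lam) * T * sqrt total_mass" if t: "t \<in> {0<..<T}" for t
  proof -
    have "L2_norm \<nu> (v t) \<le> L2_norm \<nu> v0 + L2_dist \<nu> (v t) (v 0)"
      using L2_norm_triangle[OF v0 L2_diff[OF vL[of t] vL[of 0]]] by (simp add: init)
    also have "L2_dist \<nu> (v t) (v 0) \<le> (1 + lam) * \<bar>t - 0\<bar> * sqrt total_mass" by (rule LipL)
    also have "\<dots> \<le> (1 + lam) * T * sqrt total_mass"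
      using t lam by (intro mult_right_mono mult_left_mono) auto
    finally show ?thesis by simp
  qed
  have \<eta>m: "case_prod \<eta> \<in> borel_measurable (time \<Otimes>\<^sub>M \<nu>)" and \<xi>m: "case_prod \<xi> \<in> borel_measurable (time \<Otimes>\<^sub>M \<nu>)"
    using \<eta> \<xi> by (auto simp: bounded_joint_def)
  have v_joint: "case_prod v \<in> borel_measurable (time \<Otimes>\<^sub>M \<nu>)"
  proof -
    have [measurable]: "v0 \<in> borel_measurable \<nu>" by (rule L2_spaceD(1)[OF v0])
    have [measurable]: "(\<lambda>z. cumulative \<eta> (fst z) (snd z)) \<in> borel_measurable (time \<Otimes>\<^sub>M \<nu>)"
      "(\<lambda>z. cumulative \<xi> (fst z) (snd z)) \<in> borel_measurable (time \<Otimes>\<^sub>M \<nu>)"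
      using cumulative_jointly_measurable[OF \<eta>(1)] cumulative_jointly_measurable[OF \<xi>(1)] by (simp_all add: case_prod_unfold)
    show ?thesis unfolding v_def case_prod_unfold by measurable
  qed
  have v'_joint: "case_prod v' \<in> borel_measurable (time \<Otimes>\<^sub>M \<nu>)"
    using \<eta>m \<xi>m unfolding v'_def case_prod_unfold by measurable
  have W: "W11_loc_derivative \<nu> T v v'"
    unfolding W11_loc_derivative_def
  proof (intro conjI allI impI)
    show "L1_loc_L2 \<nu> T v" by (rule L1_loc_bounded[OF v_sm vn])
    show "L1_loc_L2 \<nu> T v'" by (rule L1_loc_bounded[OF v'_sm v'n])
    fix \<phi> assume test: "test_function T \<phi>"
    have smooth: "smooth \<phi>" using test by (simp add: test_function_def smooth_def)
    have bounded: "\<exists>C. \<forall>t\<in>{0..T}. \<bar>h t\<bar> \<le> C" and meas: "h \<in> borel_measurable time" if h: "smooth h" for h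
    proof -
      have c: "continuous_on A h" for A by (intro continuous_at_imp_continuous_on ballI smooth_isCont h)
      have "bounded (h ` {0..T})" by (intro compact_imp_bounded compact_continuous_image c) auto
      then show "\<exists>C. \<forall>t\<in>{0..T}. \<bar>h t\<bar> \<le> C" unfolding bounded_iff real_norm_def by blast
      show "h \<in> borel_measurable time"
        using borel_measurable_continuous_onI[OF c] by (simp add: measurable_restrict_space1 measurable_completion)
    qed
    have pointwise: "has_L2_integral time \<nu> (\<lambda>t x. h t * g t x) (\<lambda>x. \<integral>t. h t * g t x \<partial>time)"
      if h: "smooth h" and g: "L2_strongly_measurable time \<nu> g" "case_prod g \<in> borel_measurable (time \<Otimes>\<^sub>M \<nu>)"
        and b: "\<And>t. t \<in> {0<..<T} \<Longrightarrow> L2_norm \<nu> (g t) \<le> B" for h g B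
    proof -
      obtain C where C: "\<And>t. t \<in> {0..T} \<Longrightarrow> \<bar>h t\<bar> \<le> C" using bounded[OF h] by blast
      show ?thesis
      proof (rule TS.has_L2_integral_pointwise)
        show "L2_strongly_measurable time \<nu> (\<lambda>t x. h t * g t x)"
          by (rule TS.L2_strongly_measurable_cmult[OF g(1) meas[OF h]])
        have [measurable]: "h \<in> borel_measurable time" by (rule meas[OF h])
        show "case_prod (\<lambda>t x. h t * g t x) \<in> borel_measurable (time \<Otimes>\<^sub>M \<nu>)"
          using g(2) unfolding case_prod_unfold by measurable
        fix t assume "t \<in> space time"
        then have t: "t \<in> {0<..<T}" "t \<in> {0..T}" by auto
        show "L2_norm \<nu> (\<lambda>x. h t * g t x) \<le> C * B"
          unfolding L2_norm_scale using C[OF t(2)] b[OF t(1)]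
          by (intro mult_mono) (auto intro: order_trans[OF L2_norm_nonneg] order_trans[OF abs_ge_zero] simp: L2_norm_nonneg)
      qed
    qed
    have I1: "has_L2_integral time \<nu> (\<lambda>t x. deriv \<phi> t * v t x) (\<lambda>x. \<integral>t. deriv \<phi> t * v t x \<partial>time)"
      by (rule pointwise[OF smooth_deriv[OF smooth] v_sm v_joint vn])
    have I2: "has_L2_integral time \<nu> (\<lambda>t x. \<phi> t * v' t x) (\<lambda>x. \<integral>t. \<phi> t * v' t x \<partial>time)"
      by (rule pointwise[OF smooth v'_sm v'_joint v'n])
    have parts: "(\<integral>t. \<phi> t * v' t x \<partial>time) = - (\<integral>t. deriv \<phi> t * v t x \<partial>time)" for x
    proof -
      let ?g = "\<lambda>t. \<eta> t x + lam * \<xi> t x"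
      have v_eq: "v t x = v0 x - (\<integral>s. (if s < t then ?g s else 0) \<partial>time)" for t
      proof -
        have "(\<integral>s. (if s < t then ?g s else 0) \<partial>time) = (\<integral>s. (if s < t then \<eta> s x else 0) + lam * (if s < t then \<xi> s x else 0) \<partial>time)"
          by (rule Bochner_Integration.integral_cong) auto
        also have "\<dots> = cumulative \<eta> t x + lam * cumulative \<xi> t x"
          using bounded_joint_sections(5)[OF \<eta>(1)] bounded_joint_sections(5)[OF \<xi>(1)] by (simp add: cumulative_def)
        finally show ?thesis by (simp add: v_def)
      qed
      have "(\<integral>t. deriv \<phi> t * v t x \<partial>time) = (\<integral>t. \<phi> t * ?g t \<partial>time)"
        unfolding v_eq
      proof (rule integral_by_parts_indefinite[OF test _ _ T])
        show "?g \<in> borel_measurable time"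
          using bounded_joint_sections(1)[OF \<eta>(1)] bounded_joint_sections(1)[OF \<xi>(1)] by measurable
        show "\<bar>?g t\<bar> \<le> 1 + lam" for t using v'b[of t x] by (simp add: v'_def abs_le_iff)
      qed
      moreover have "(\<integral>t. \<phi> t * v' t x \<partial>time) = (\<integral>t. - (\<phi> t * ?g t) \<partial>time)"
        by (rule Bochner_Integration.integral_cong) (auto simp: v'_def algebra_simps)
      ultimately show ?thesis by simp
    qed
    show "\<exists>I. has_L2_integral time \<nu> (\<lambda>t x. deriv \<phi> t * v t x) I \<and> has_L2_integral time \<nu> (\<lambda>t x. \<phi> t * v' t x) (\<lambda>x. - I x)"
      using I1 I2 unfolding parts by blast
  qed
  have "AE t in time. \<exists>\<xi>\<in>sign_set \<nu> (\<lambda>x. v t x - f x). (\<lambda>x. lam * \<xi> x + v' t x) \<in> one_Laplacian m \<nu> (v t)"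
    using sub sign AE_space
  proof eventually_elim
    case (elim t)
    then have t: "t \<in> {0<..<T}" "t \<in> {0..T}" by auto
    have Vv: "AE x in \<nu>. v t x = V t x"
      using L2_norm_eq_0[OF L2_diff[OF vL V[OF t(2)]] drive'[OF t(2)]] by auto
    have cL: "(\<lambda>x. clip (V t x - f x)) \<in> L2_space \<nu>" by (intro clip_L2 L2_spaceD(1) V t)
    have i: "integrable \<nu> (\<lambda>x. \<bar>clip (V t x - f x)\<bar> - \<xi> t x * clip (V t x - f x))"
      using L2_integrable[OF cL] L2_integrable_mult[OF \<xi>L[OF t(1)] cL] by auto
    \<comment> \<open>A nonnegative integrand whose integral is at most zero vanishes, which forces \<open>\<xi>\<close> to be a sign.\<close>
    have nn: "0 \<le> \<bar>clip (V t x - f x)\<bar> - \<xi> t x * clip (V t x - f x)" for x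
    proof -
      have "\<bar>\<xi> t x * clip (V t x - f x)\<bar> \<le> \<bar>clip (V t x - f x)\<bar>"
        unfolding abs_mult by (rule mult_left_le_one_le) (auto simp: \<xi>b)
      then show ?thesis by linarith
    qed
    have "(\<integral>x. \<bar>clip (V t x - f x)\<bar> - \<xi> t x * clip (V t x - f x) \<partial>\<nu>) \<le> 0"
      using elim(2) L2_integrable[OF cL] L2_integrable_mult[OF \<xi>L[OF t(1)] cL] by (simp add: L2_inner_def)
    moreover have "0 \<le> (\<integral>x. \<bar>clip (V t x - f x)\<bar> - \<xi> t x * clip (V t x - f x) \<partial>\<nu>)"
      by (rule Bochner_Integration.integral_nonneg) (rule nn)
    ultimately have "AE x in \<nu>. \<bar>clip (V t x - f x)\<bar> - \<xi> t x * clip (V t x - f x) = 0"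
      using integral_nonneg_eq_0_iff_AE[OF i] nn by auto
    with Vv have "AE x in \<nu>. (v t x - f x > 0 \<longrightarrow> \<xi> t x = 1) \<and> (v t x - f x < 0 \<longrightarrow> \<xi> t x = -1) \<and> (v t x - f x = 0 \<longrightarrow> \<xi> t x \<in> {-1..1})"
    proof eventually_elim
      case (elim x)
      let ?c = "clip (v t x - f x)"
      have eq: "\<bar>?c\<bar> = \<xi> t x * ?c" using elim by simp
      have "\<xi> t x = 1" if "v t x - f x > 0"
      proof -
        have "?c > 0" using that clip_simps(4) by simp
        then show ?thesis using eq by simp
      qed
      moreover have "\<xi> t x = -1" if "v t x - f x < 0"
      proof -
        have "?c < 0" using that clip_simps(5) by simp
        then have "(\<xi> t x + 1) * ?c = 0" using eq by (simp add: distrib_right)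
        then show ?thesis using \<open>?c < 0\<close> by simp
      qed
      ultimately show ?case using \<xi>b[of t x] by (auto simp: abs_le_iff)
    qed
    then have "\<xi> t \<in> sign_set \<nu> (\<lambda>x. v t x - f x)"
      using L2_spaceD(1)[OF \<xi>L[OF t(1)]] by (simp add: sign_set_def)
    moreover have "(\<lambda>x. lam * \<xi> t x + v' t x) \<in> one_Laplacian m \<nu> (v t)"
    proof -
      have eq: "(\<lambda>x. - (lam * \<xi> t x + v' t x)) = \<eta> t" by (simp add: v'_def fun_eq_iff)
      have "TVr (v t) + L2_inner \<nu> (\<eta> t) (\<lambda>x. w x - v t x) \<le> TVr w" if w: "w \<in> L2_space \<nu>" for w
      proof -
        have "L2_inner \<nu> (\<eta> t) (\<lambda>x. w x - v t x) = L2_inner \<nu> (\<eta> t) (\<lambda>x. w x - V t x)"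
          unfolding L2_inner_def
          by (rule integral_cong_AE)
             (use Vv L2_spaceD(1)[OF \<eta>L[OF t(1)]] L2_spaceD(1)[OF w] L2_spaceD(1)[OF vL[of t]] L2_spaceD(1)[OF V[OF t(2)]] in auto)
        moreover have "TVr (v t) = TVr (V t)" by (rule TVr_cong_norm_zero[OF vL V[OF t(2)] drive'[OF t(2)]])
        ultimately show ?thesis using elim(1) w by simp
      qed
      then show ?thesis
        unfolding one_Laplacian_def mem_Collect_eq eq L2_subdifferential_iff using \<eta>L[OF t(1)] vL by blast
    qed
    ultimately show ?case by blast
  qed
  then have "strong_solution m \<nu> f lam T v0 v"
    unfolding strong_solution_def using cont W init by auto
  then show ?thesis by blast
qed

end

theorem theorem3p38:
  fixes m :: "'a::polish_space \<Rightarrow> 'a measure" and \<nu> :: "'a measure"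
    and f :: "'a \<Rightarrow> real" and lam :: real
  assumes "random_walk m"
    and "radon_measure \<nu>" and "finite_measure \<nu>" and "emeasure \<nu> UNIV \<noteq> 0"
    and "reversible m \<nu>" and "ergodic m \<nu>"
    and "integrable \<nu> f" and "lam > 0"
  shows "(\<forall>v0\<in>L2_space \<nu>. \<forall>T>0.
            (\<exists>v. strong_solution m \<nu> f lam T v0 v) \<and>
            (\<forall>v w. strong_solution m \<nu> f lam T v0 v \<longrightarrow> strong_solution m \<nu> f lam T v0 w \<longrightarrow>
               (\<forall>t\<in>{0..T}. AE x in \<nu>. v t x = w t x))) \<and>
         (\<forall>v0\<in>L2_space \<nu>. \<forall>w0\<in>L2_space \<nu>. \<forall>T>0. \<forall>v w.
            strong_solution m \<nu> f lam T v0 v \<longrightarrow> strong_solution m \<nu> f lam T w0 w \<longrightarrow>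
            (\<forall>q::ennreal. 1 \<le> q \<longrightarrow>
               (\<forall>t. 0 < t \<and> t < T \<longrightarrow>
                  Lq_norm \<nu> q (\<lambda>x. v t x - w t x) \<le> Lq_norm \<nu> q (\<lambda>x. v0 x - w0 x))))"
proof -
  interpret reversible_walk m \<nu>
    by (rule reversible_walk.intro)
       (use assms(1,3,5) \<open>radon_measure \<nu>\<close> in \<open>simp_all add: radon_measure_def\<close>)
  have exists: "\<exists>v. strong_solution m \<nu> f lam T v0 v" if "v0 \<in> L2_space \<nu>" "T > 0" for v0 T
  proof -
    interpret flow_data m \<nu> f v0 lam T
      by (intro flow_data.intro flow_data_axioms.intro reversible_walk_axioms that assms)
    show ?thesis by (rule strong_solution_exists)
  qed
  show ?thesis
  proof (intro conjI ballI allI impI, goal_cases)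
    case (1 v0 T)
    then show ?case by (rule exists)
  next
    case (2 v0 T v w t)
    then show ?case using strong_solution_unique[OF _ _ \<open>lam > 0\<close>] by blast
  next
    case (3 v0 w0 T v w q t)
    then show ?case using strong_solution_contraction[OF _ _ \<open>lam > 0\<close>] by blast
  qed
qed

end
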